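(* Let $Q$ be an $n$TBI $q$-matrix (with $h_{\mathbf 0}<0$) that is regular and satisfies (A-1), (A-2), (A-3) and $B_1(0,\dots,0)>0$. Then the corresponding $n$TBIP is recurrent if and only if $\rho(1,\dots,1)\le0$ and $J=+\infty$, where $$J=\int_0^1\frac{1}{B_1(y,u_2(y),\dots,u_n(y))}\,e^{\int_0^y\frac{A(x,u_2(x),\dots,u_n(x))}{B_1(x,u_2(x),\dots,u_n(x))}dx}\,dy .$$
   Context: Fix $n\ge1$. For $\mathbf i\in\mathbf Z_+^n$ write $|\mathbf i|=\sum_k i_k$; $\mathbf e_k$ is the $k$-th unit vector and $\chi$ is the indicator function of $\mathbf Z_+^n$. An $n$TBI $q$-matrix ($n$-type branching with immigration and resurrection) is a matrix $Q=(q_{\mathbf{ij}})$ on $\mathbf Z_+^n$ with $q_{\mathbf{0j}}=h_{\mathbf j}$ and, for $|\mathbf i|>0$, $$q_{\mathbf{ij}}=\sum_{k=1}^n i_k b^{(k)}_{\mathbf j-\mathbf i+\mathbf e_k}\chi(\mathbf j-\mathbf i+\mathbf e_k)+a_{\mathbf j-\mathbf i}\chi(\mathbf j-\mathbf i),$$ where $h_{\mathbf j}\ge0$ and $a_{\mathbf j}\ge 0$ for $\mathbf j\ne\mathbf 0$, $0<\sum_{\mathbf j\ne\mathbf 0}h_{\mathbf j}=-h_{\mathbf 0}<\infty$, $0<\sum_{\mathbf j\ne\mathbf 0}a_{\mathbf j}=-a_{\mathbf 0}<\infty$, and for each $k$: $b^{(k)}_{\mathbf j}\ge0$ ($\mathbf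 j\ne\mathbf e_k$), $0<\sum_{\mathbf j\ne\mathbf e_k}b^{(k)}_{\mathbf j}=-b^{(k)}_{\mathbf e_k}<\infty$. The $n$TBIP is the continuous-time Markov chain given by the Feller minimal $Q$-function; $Q$ is regular when this function is honest. Generating functions on $[0,1]^n$: $A(u)=\sum_{\mathbf j}a_{\mathbf j}u_1^{j_1}\cdots u_n^{j_n}$, $B_k(u)=\sum_{\mathbf j}b^{(k)}_{\mathbf j}u_1^{j_1}\cdots u_n^{j_n}$; $B_{ij}=\partial B_i/\partial u_j$, $g_{ij}=\delta_{ij}-B_{ij}/b^{(i)}_{\mathbf e_i}$, $G=(g_{ij})$. $\rho(u)$ is the maximal eigenvalue of the matrix $(B_{ij}(u))$. (A-1) $\{B_i\}$ is nonsingular: there is no $n\times n$ matrix $M$ with $(B_1(u),\dots,B_n(u))^{T}=M(u_1,\dots,u_n)^{T}$ for all $u$. (A-2) $B_{ij}(1,\dots,1)<\infty$ for all $i,j$. (A-3) $G(1,\dots,1)$ is positively regular (some power has all entries strictly positive). When $\rho(1,\dots,1)\le 0$ the smallest nonnegative solution in $[0,1]^n$ of $B_1=\dots=B_n=0$ is $(1,\dots,1)$, and $(u_2(u),\dots,u_n(u))$, $u\in[0,1]$, is the unique solution of $u_k'(u)=B_k(u,u_2,\dots,u_n)/B_1(u,u_2,\dots,u_n)$, $u_k(0)=0$ ($2\le k\le n$), with $u_k(1)=1$. $J$ is used only in this case. *)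

theory Defs
  imports "HOL-Analysis.Analysis"
begin

(* The types 1, ..., n are the elements of a finite index type 'n, so Z_+^n is nat^'n, ordered
   componentwise, and e_k is axis k 1. The type playing the role of "type 1" is passed explicitly
   where it matters. On real^'n the constant 1 is the vector (1, ..., 1) and {0..1} is the cube
   [0,1]^n. *)

section \<open>Branching with immigration and resurrection\<close>

(* Subtraction on nat^'n is truncated. The guard i \<le> j + e_k (resp. i \<le> j) is the indicator
   chi(j - i + e_k) (resp. chi(j - i)); where it holds no truncation occurs. *)
definition is_nTBI_qmatrix ::
  "(nat^'n \<Rightarrow> nat^'n \<Rightarrow> real) \<Rightarrow> (nat^'n \<Rightarrow> real) \<Rightarrow> (nat^'n \<Rightarrow> real) \<Rightarrow> ('n \<Rightarrow> nat^'n \<Rightarrow> real) \<Rightarrow> bool"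
  where
  "is_nTBI_qmatrix Q h a b \<longleftrightarrow>
     (\<forall>j. j \<noteq> 0 \<longrightarrow> h j \<ge> 0) \<and> h 0 < 0 \<and> (h has_sum (- h 0)) (UNIV - {0}) \<and>
     (\<forall>j. j \<noteq> 0 \<longrightarrow> a j \<ge> 0) \<and> a 0 < 0 \<and> (a has_sum (- a 0)) (UNIV - {0}) \<and>
     (\<forall>k. (\<forall>j. j \<noteq> axis k 1 \<longrightarrow> b k j \<ge> 0) \<and> b k (axis k 1) < 0 \<and>
          (b k has_sum (- b k (axis k 1))) (UNIV - {axis k 1})) \<and>
     (\<forall>i j. Q i j =
        (if i = 0 then h j
         else (\<Sum>k\<in>UNIV. real (i $ k) *
                 (if i \<le> j + axis k 1 then b k (j + axis k 1 - i) else 0))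
              + (if i \<le> j then a (j - i) else 0)))"

section \<open>The Feller minimal Q-function\<close>

(* Feller's construction: iterate the integrated backward equation
     f_ij(t) = delta_ij exp(-q_i t) + int_0^t exp(-q_i (t-s)) sum_{k ~= i} q_ik f_kj(s) ds,
   with q_i = -q_ii, from 0. The iterates increase to its minimal nonnegative solution. *)
primrec feller_iter ::
  "('s \<Rightarrow> 's \<Rightarrow> real) \<Rightarrow> nat \<Rightarrow> real \<Rightarrow> 's \<Rightarrow> 's \<Rightarrow> ennreal" where
  "feller_iter Q 0 = (\<lambda>t i j. 0)"
| "feller_iter Q (Suc m) = (\<lambda>t i j.
     (if i = j then ennreal (exp (Q i i * t)) else 0) +
     (\<integral>\<^sup>+s\<in>{0..t}. ennreal (exp (Q i i * (t - s))) *
        (\<integral>\<^sup>+k. ennreal (Q i k) * feller_iter Q m s k j \<partial>count_space (UNIV - {i})) \<partial>lborel))"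

definition feller_minimal :: "('s \<Rightarrow> 's \<Rightarrow> real) \<Rightarrow> real \<Rightarrow> 's \<Rightarrow> 's \<Rightarrow> ennreal" where
  "feller_minimal Q t i j = (SUP m. feller_iter Q m t i j)"

definition regular_qmatrix :: "('s \<Rightarrow> 's \<Rightarrow> real) \<Rightarrow> bool" where
  "regular_qmatrix Q \<longleftrightarrow>
     (\<forall>t\<ge>0. \<forall>i. (\<integral>\<^sup>+j. feller_minimal Q t i j \<partial>count_space UNIV) = 1)"

(* A state i is recurrent for the transition function P if the expected total time spent in i,
   int_0^oo P_ii(t) dt, is infinite; the chain is recurrent if all its states are. *)
definition recurrent_transition :: "(real \<Rightarrow> 's \<Rightarrow> 's \<Rightarrow> ennreal) \<Rightarrow> bool" where
  "recurrent_transition P \<longleftrightarrow> (\<forall>i. (\<integral>\<^sup>+t\<in>{0..}. P t i i \<partial>lborel) = \<infinity>)"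

section \<open>Generating functions\<close>

definition genfun :: "(nat^'n \<Rightarrow> real) \<Rightarrow> real^'n \<Rightarrow> real" where
  "genfun c u = (\<Sum>\<^sub>\<infinity>j. c j * (\<Prod>k\<in>UNIV. (u $ k) ^ (j $ k)))"

definition slice :: "(real^'n \<Rightarrow> real) \<Rightarrow> 'n \<Rightarrow> real^'n \<Rightarrow> real \<Rightarrow> real" where
  "slice f j u s = f (\<chi> l. if l = j then s else u $ l)"

(* Partial derivatives on the cube [0,1]^n, hence one-sided on its boundary. *)
definition partial_differentiable :: "(real^'n \<Rightarrow> real) \<Rightarrow> 'n \<Rightarrow> real^'n \<Rightarrow> bool" where
  "partial_differentiable f j u \<longleftrightarrow> slice f j u differentiable (at (u $ j) within {0..1})"

definition partial_deriv :: "(real^'n \<Rightarrow> real) \<Rightarrow> 'n \<Rightarrow> real^'n \<Rightarrow> real" where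
  "partial_deriv f j u = vector_derivative (slice f j u) (at (u $ j) within {0..1})"

definition Bmat :: "('n \<Rightarrow> nat^'n \<Rightarrow> real) \<Rightarrow> real^'n \<Rightarrow> real^'n^'n" where
  "Bmat b u = (\<chi> i j. partial_deriv (genfun (b i)) j u)"

definition Gmat :: "('n \<Rightarrow> nat^'n \<Rightarrow> real) \<Rightarrow> real^'n \<Rightarrow> real^'n^'n" where
  "Gmat b u = (\<chi> i j. (if i = j then 1 else 0) - Bmat b u $ i $ j / b i (axis i 1))"

(* The off-diagonal entries of the matrices concerned are nonnegative, so by the Perron-Frobenius
   theorem a largest real eigenvalue exists and dominates the real parts of all complex
   eigenvalues. *)
definition max_eigenvalue :: "real^'n^'n \<Rightarrow> real" where
  "max_eigenvalue M = Max {r. \<exists>v. v \<noteq> 0 \<and> M *v v = r *\<^sub>R v}"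

definition rho :: "('n \<Rightarrow> nat^'n \<Rightarrow> real) \<Rightarrow> real^'n \<Rightarrow> real" where
  "rho b u = max_eigenvalue (Bmat b u)"

(* Matrix power with respect to **; the power operator on real^'n^'n would be entrywise. *)
primrec matrix_pow :: "real^'n^'n \<Rightarrow> nat \<Rightarrow> real^'n^'n" where
  "matrix_pow M 0 = mat 1"
| "matrix_pow M (Suc m) = M ** matrix_pow M m"

definition positively_regular :: "real^'n^'n \<Rightarrow> bool" where
  "positively_regular M \<longleftrightarrow> (\<exists>m\<ge>1. \<forall>i j. matrix_pow M m $ i $ j > 0)"

definition nonsingular_family :: "('n \<Rightarrow> nat^'n \<Rightarrow> real) \<Rightarrow> bool" where
  "nonsingular_family b \<longleftrightarrow>
     \<not> (\<exists>M :: real^'n^'n. \<forall>u\<in>{0..1}. (\<chi> i. genfun (b i) u) = M *v u)"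

definition finite_mean_matrix :: "('n \<Rightarrow> nat^'n \<Rightarrow> real) \<Rightarrow> bool" where
  "finite_mean_matrix b \<longleftrightarrow> (\<forall>i j. partial_differentiable (genfun (b i)) j 1)"

section \<open>The integral J\<close>

(* U x is the vector (x, u_2(x), ..., u_n(x)), with one the index of type 1. The differential
   equation is imposed on [0,1), since both sides of the quotient vanish at the endpoint
   (1, ..., 1), where U is required to be continuous. *)
definition branching_curve :: "('n \<Rightarrow> nat^'n \<Rightarrow> real) \<Rightarrow> 'n \<Rightarrow> (real \<Rightarrow> real^'n) \<Rightarrow> bool" where
  "branching_curve b one U \<longleftrightarrow>
     (\<forall>x\<in>{0..1}. U x \<in> {0..1} \<and> U x $ one = x) \<and>
     continuous_on {0..1} U \<and> U 0 = 0 \<and> U 1 = 1 \<and>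
     (\<forall>k. k \<noteq> one \<longrightarrow> (\<forall>x\<in>{0..<1}.
        ((\<lambda>y. U y $ k) has_real_derivative genfun (b k) (U x) / genfun (b one) (U x))
          (at x within {0..1})))"

(* The solution is unique on [0,1] and only its values there enter J. *)
definition the_curve :: "('n \<Rightarrow> nat^'n \<Rightarrow> real) \<Rightarrow> 'n \<Rightarrow> real \<Rightarrow> real^'n" where
  "the_curve b one = (SOME U. branching_curve b one U)"

definition J_integral ::
  "(nat^'n \<Rightarrow> real) \<Rightarrow> ('n \<Rightarrow> nat^'n \<Rightarrow> real) \<Rightarrow> 'n \<Rightarrow> ennreal" where
  "J_integral a b one =
     (let U = the_curve b one in
      \<integral>\<^sup>+y\<in>{0<..<1}. ennreal
         (1 / genfun (b one) (U y) *
          exp (integral {0..y} (\<lambda>x. genfun a (U x) / genfun (b one) (U x)))) \<partial>lborel)"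

end

theory Submission
  imports Defs
begin

text \<open>
  Integrating the Feller iteration over time turns it into the minimal solution of
  \<open>q_i g_i = \<delta>_ij + (\<Sum>k\<noteq>i. q_ik g_k)\<close>, so that recurrence becomes a question about nonnegative
  super- and subsolutions of the generator. On a monomial \<open>i \<mapsto> u ^ i\<close> the generator acts as
  \<open>(\<Sum>k. i_k u ^ (i - e_k) B_k(u)) + u ^ i A(u)\<close>. If \<open>\<rho>(1) > 0\<close>, a positive vector \<open>w\<close> with
  \<open>B'(1) w > 0\<close> gives a point \<open>q = 1 - \<epsilon> w\<close> with \<open>B(q) \<le> 0\<close>, and \<open>i \<mapsto> q ^ i\<close> is a supersolution.
  If \<open>\<rho>(1) \<le> 0\<close>, the flow \<open>u' = B(u)\<close>, \<open>u(0) = 0\<close> increases to \<open>1\<close>, and in the parameter \<open>x = u_1\<close> it is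
  the curve \<open>U\<close> of the statement. With \<open>\<Phi> = exp (\<integral> A/B_1)\<close> and \<open>\<psi> = \<Phi>/B_1\<close> along the curve,
  \<open>f_y(i) = \<integral>_0^y U ^ i \<psi>\<close> is mapped by the generator to \<open>U(y) ^ i \<Phi>(y) \<ge> 0\<close> for \<open>i \<noteq> 0\<close>. If \<open>J\<close> is finite,
  the limit \<open>y \<rightarrow> 1\<close> yields a supersolution that is strict at \<open>0\<close>. If \<open>J\<close> is infinite, the quotients
  \<open>f_y / f_y(0)\<close> are subharmonic off \<open>0\<close>, vanish at infinity and tend to \<open>1\<close>; by the minimum principle
  finite superharmonic functions are then constant, which no finite Green function can be.
\<close>

section \<open>Green functions\<close>

text \<open>All \<open>B k\<close> vanish at the endpoint \<open>1\<close> of the curve, and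
  \<open>B_1(U(x)) \<le> c (1 - x)\<close> makes \<open>1/B_1\<close> non-integrable there. Every
  formula is therefore used on \<open>[0,y]\<close> with \<open>y < 1\<close>, at the price of the
  boundary term \<open>U(y) ^ i \<Phi>(y)\<close>. For infinite \<open>J\<close> its sign is the
  right one, and the truncation keeps the curve in a compact part of \<open>[0,1)^n\<close>, which
  is why \<open>f_y\<close> vanishes at infinity. For finite \<open>J\<close> the sign is wrong and
  the term must disappear in the limit: \<open>\<Phi>\<close> decreases while \<open>1/B_1\<close>
  has infinite integral, so a finite integral of \<open>\<Phi>/B_1\<close> forces
  \<open>\<Phi> \<rightarrow> 0\<close>. The curve is taken from the flow because its own
  differential equation is singular at the end. The flow is the limit of a monotone iteration, and
  monotonicity in time also yields its limit and the positivity of \<open>B_1\<close> along it.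
  Irreducibility is not assumed. It is derived from \<open>\<rho>(1) \<le> 0\<close>, positive
  regularity and \<open>B_1(0) > 0\<close>; the same three facts exclude a common zero of the
  \<open>B_k\<close> other than \<open>1\<close>.\<close>

definition green :: "('s \<Rightarrow> 's \<Rightarrow> real) \<Rightarrow> 's \<Rightarrow> 's \<Rightarrow> ennreal" where
  "green Q i j = (\<integral>\<^sup>+t\<in>{0..}. feller_minimal Q t i j \<partial>lborel)"

lemma borel_measurable_nn_integral_count_space:
  fixes f :: "'s \<Rightarrow> 'b \<Rightarrow> ennreal"
  assumes "countable I" and "\<And>k. k \<in> I \<Longrightarrow> f k \<in> borel_measurable M"
  shows "(\<lambda>x. \<integral>\<^sup>+k. f k x \<partial>count_space I) \<in> borel_measurable M"
proof -
  interpret sigma_finite_measure "count_space I"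
    by (rule sigma_finite_measure_count_space_countable[OF assms(1)])
  show ?thesis
  proof (rule borel_measurable_nn_integral)
    have "(\<lambda>(k, x). f k x) \<in> borel_measurable (count_space I \<Otimes>\<^sub>M M)"
      by (rule measurable_pair_measure_countable1[OF assms(1)]) (use assms in auto)
    from measurable_compose[OF measurable_pair_swap' this]
    show "(\<lambda>(x, k). f k x) \<in> borel_measurable (M \<Otimes>\<^sub>M count_space I)"
      by (simp add: case_prod_unfold)
  qed
qed

lemma borel_measurable_feller_iter:
  fixes Q :: "'s::countable \<Rightarrow> 's \<Rightarrow> real"
  shows "(\<lambda>t. feller_iter Q m t i j) \<in> borel_measurable borel"
proof (induction m arbitrary: i)
  case (Suc m)
  let ?S = "\<lambda>s. \<integral>\<^sup>+k. ennreal (Q i k) * feller_iter Q m s k j \<partial>count_space (UNIV - {i})"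
  have [measurable]: "?S \<in> borel_measurable borel"
    by (intro borel_measurable_nn_integral_count_space) (use Suc in auto)
  have "(\<lambda>t. \<integral>\<^sup>+s. ennreal (exp (Q i i * (t - s))) * ?S s * indicator {0..t} s \<partial>lborel)
    \<in> borel_measurable borel"
    unfolding indicator_def atLeastAtMost_iff by measurable
  then show ?case by simp
qed auto

lemma nn_integral_exponential:
  assumes "q > 0"
  shows "(\<integral>\<^sup>+t. ennreal (exp (- (q * (t - s)))) * indicator {s..} t \<partial>lborel) = ennreal (1 / q)"
proof -
  have "(\<integral>\<^sup>+t. ennreal (exp (- (q * (t - s)))) * indicator {s..} t \<partial>lborel)
      = ennreal (0 - (- exp (- (q * (s - s))) / q))"
  proof (rule nn_integral_FTC_atLeast[where F="\<lambda>t. - exp (- (q * (t - s))) / q"])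
    show "((\<lambda>t. - exp (- (q * (t - s))) / q) has_real_derivative exp (- (q * (t - s)))) (at t)" for t
      using assms by (auto intro!: derivative_eq_intros)
    have "filterlim (\<lambda>t. - (q * (t - s))) at_bot at_top"
      unfolding filterlim_at_bot_le[where c=0]
    proof (intro allI impI)
      fix Z :: real
      show "eventually (\<lambda>t. - (q * (t - s)) \<le> Z) at_top"
        using eventually_ge_at_top[of "s + \<bar>Z\<bar> / q"]
      proof eventually_elim
        case (elim t)
        then have "\<bar>Z\<bar> / q \<le> t - s" by simp
        then show ?case using assms by (simp add: divide_le_eq mult.commute)
      qed
    qed
    then have "((\<lambda>t. exp (- (q * (t - s)))) \<longlongrightarrow> 0) at_top"
      by (rule filterlim_compose[OF exp_at_bot])
    from tendsto_divide[OF tendsto_minus[OF this] tendsto_const[of q]] assms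
    show "((\<lambda>t. - exp (- (q * (t - s))) / q) \<longlongrightarrow> 0) at_top" by simp
  qed auto
  then show ?thesis by simp
qed

text \<open>The recursion step is a convolution of an exponential with the jump term. Under the
  integral over all \<open>t\<close>, Tonelli factors it, and the exponential contributes its total
  mass \<open>1 / - Q i i\<close>.\<close>

lemma nn_integral_feller_iter_Suc:
  fixes Q :: "'s::countable \<Rightarrow> 's \<Rightarrow> real"
  assumes "Q i i < 0"
  shows "(\<integral>\<^sup>+t\<in>{0..}. feller_iter Q (Suc m) t i j \<partial>lborel) =
    ennreal (1 / - Q i i) * ((if i = j then 1 else 0) +
      (\<integral>\<^sup>+k. ennreal (Q i k) * (\<integral>\<^sup>+t\<in>{0..}. feller_iter Q m t k j \<partial>lborel) \<partial>count_space (UNIV - {i})))"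
proof -
  note [measurable] = borel_measurable_feller_iter
  define S where "S s = (\<integral>\<^sup>+k. ennreal (Q i k) * feller_iter Q m s k j \<partial>count_space (UNIV - {i}))" for s
  have S[measurable]: "S \<in> borel_measurable borel"
    unfolding S_def by (intro borel_measurable_nn_integral_count_space) auto
  define q where "q = - Q i i"
  have q: "q > 0" and Qi: "Q i i = - q" using assms by (auto simp: q_def)
  have "(\<integral>\<^sup>+t\<in>{0..}. (\<integral>\<^sup>+s\<in>{0..t}. ennreal (exp (- (q * (t - s)))) * S s \<partial>lborel) \<partial>lborel)
      = (\<integral>\<^sup>+t. (\<integral>\<^sup>+s. ennreal (exp (- (q * (t - s)))) * S s * indicator {0..t} s * indicator {0..} t \<partial>lborel) \<partial>lborel)"
    by (subst nn_integral_multc) (auto simp: mult_ac indicator_def of_bool_def cong: if_cong)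
  also have "\<dots> = (\<integral>\<^sup>+s. (\<integral>\<^sup>+t. ennreal (exp (- (q * (t - s)))) * S s * indicator {0..t} s * indicator {0..} t \<partial>lborel) \<partial>lborel)"
    unfolding indicator_def atLeastAtMost_iff atLeast_iff by (rule lborel_pair.Fubini') measurable
  also have "\<dots> = (\<integral>\<^sup>+s. (\<integral>\<^sup>+t. (S s * indicator {0..} s) * (ennreal (exp (- (q * (t - s)))) * indicator {s..} t) \<partial>lborel) \<partial>lborel)"
    by (intro nn_integral_cong) (auto simp: indicator_def mult_ac)
  also have "\<dots> = (\<integral>\<^sup>+s. (S s * indicator {0..} s) * ennreal (1 / q) \<partial>lborel)"
    by (subst nn_integral_cmult) (auto simp: nn_integral_exponential[OF q])
  also have "\<dots> = ennreal (1 / q) * (\<integral>\<^sup>+s\<in>{0..}. S s \<partial>lborel)"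
    by (subst nn_integral_multc) (auto simp: mult.commute)
  also have "(\<integral>\<^sup>+s\<in>{0..}. S s \<partial>lborel) = (\<integral>\<^sup>+s. (\<integral>\<^sup>+k. ennreal (Q i k) * (feller_iter Q m s k j * indicator {0..} s) \<partial>count_space (UNIV - {i})) \<partial>lborel)"
    unfolding S_def by (subst nn_integral_multc[symmetric]) (auto simp: mult.assoc)
  also have "\<dots> = (\<integral>\<^sup>+k. ennreal (Q i k) * (\<integral>\<^sup>+t\<in>{0..}. feller_iter Q m t k j \<partial>lborel) \<partial>count_space (UNIV - {i}))"
    by (subst nn_integral_count_space_nn_integral) (auto intro!: nn_integral_cong nn_integral_cmult)
  finally have 1: "(\<integral>\<^sup>+t\<in>{0..}. (\<integral>\<^sup>+s\<in>{0..t}. ennreal (exp (- (q * (t - s)))) * S s \<partial>lborel) \<partial>lborel) =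
    ennreal (1 / q) * (\<integral>\<^sup>+k. ennreal (Q i k) * (\<integral>\<^sup>+t\<in>{0..}. feller_iter Q m t k j \<partial>lborel) \<partial>count_space (UNIV - {i}))" .
  have 2: "(\<integral>\<^sup>+t\<in>{0..}. (if i = j then ennreal (exp (- (q * t))) else 0) \<partial>lborel) = ennreal (1 / q) * (if i = j then 1 else 0)"
    using nn_integral_exponential[OF q, of 0] by auto
  have [measurable]: "(\<lambda>t. \<integral>\<^sup>+s\<in>{0..t}. ennreal (exp (- (q * (t - s)))) * S s \<partial>lborel) \<in> borel_measurable borel"
    unfolding indicator_def atLeastAtMost_iff by measurable
  have "feller_iter Q (Suc m) t i j = (if i = j then ennreal (exp (- (q * t))) else 0)
     + (\<integral>\<^sup>+s\<in>{0..t}. ennreal (exp (- (q * (t - s)))) * S s \<partial>lborel)" for t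
    by (simp only: feller_iter.simps Qi S_def mult_minus_left)
  then have "(\<integral>\<^sup>+t\<in>{0..}. feller_iter Q (Suc m) t i j \<partial>lborel)
     = (\<integral>\<^sup>+t. (if i = j then ennreal (exp (- (q * t))) else 0) * indicator {0..} t
       + (\<integral>\<^sup>+s\<in>{0..t}. ennreal (exp (- (q * (t - s)))) * S s \<partial>lborel) * indicator {0..} t \<partial>lborel)"
    by (simp only: ring_distribs)
  also have "\<dots> = (\<integral>\<^sup>+t\<in>{0..}. (if i = j then ennreal (exp (- (q * t))) else 0) \<partial>lborel)
     + (\<integral>\<^sup>+t\<in>{0..}. (\<integral>\<^sup>+s\<in>{0..t}. ennreal (exp (- (q * (t - s)))) * S s \<partial>lborel) \<partial>lborel)"
    by (intro nn_integral_add) measurable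
  finally show ?thesis
    using 1 2 by (simp add: q_def ring_distribs)
qed

lemma feller_iter_mono: "feller_iter Q m t i j \<le> feller_iter Q (Suc m) t i j"
proof (induction m arbitrary: t i)
  case (Suc m)
  show ?case
    unfolding feller_iter.simps(2)[of _ "Suc m"]
    apply (subst feller_iter.simps(2))
    by (intro add_left_mono nn_integral_mono mult_right_mono mult_left_mono Suc) auto
qed simp

lemma green_eq_SUP:
  fixes Q :: "'s::countable \<Rightarrow> 's \<Rightarrow> real"
  shows "green Q i j = (SUP m. \<integral>\<^sup>+t\<in>{0..}. feller_iter Q m t i j \<partial>lborel)"
proof -
  note [measurable] = borel_measurable_feller_iter
  have "green Q i j = (\<integral>\<^sup>+t. (SUP m. feller_iter Q m t i j * indicator {0..} t) \<partial>lborel)"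
    unfolding green_def feller_minimal_def
    by (intro nn_integral_cong) (auto simp: SUP_mult_right_ennreal indicator_def)
  also have "\<dots> = (SUP m. \<integral>\<^sup>+t\<in>{0..}. feller_iter Q m t i j \<partial>lborel)"
    by (intro nn_integral_monotone_convergence_SUP)
       (auto simp: incseq_Suc_iff le_fun_def intro!: mult_right_mono feller_iter_mono simp del: feller_iter.simps)
  finally show ?thesis .
qed

lemma ennreal_times_inverse_le:
  assumes "q > 0" "x \<le> ennreal q * y" shows "ennreal (1 / q) * x \<le> y"
proof -
  have "ennreal (1 / q) * x \<le> ennreal (1 / q) * (ennreal q * y)"
    by (intro mult_left_mono assms) auto
  also have "\<dots> = y"
    using assms(1) by (simp add: mult.assoc[symmetric] ennreal_mult[symmetric])
  finally show ?thesis .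
qed

text \<open>Induction over the iterates: the recursion for their time integrals is monotone and
  starts at \<open>0\<close>, so it never rises above a supersolution. Infinite values of
  \<open>g\<close> are allowed.\<close>

lemma green_least:
  fixes Q :: "'s::countable \<Rightarrow> 's \<Rightarrow> real"
  assumes neg: "\<And>i. Q i i < 0"
    and super: "\<And>i. (if i = j then 1 else 0) + (\<integral>\<^sup>+k. ennreal (Q i k) * g k \<partial>count_space (UNIV - {i}))
      \<le> ennreal (- Q i i) * g i"
  shows "green Q i j \<le> g i"
proof -
  have "(\<integral>\<^sup>+t\<in>{0..}. feller_iter Q m t i j \<partial>lborel) \<le> g i" for m
  proof (induction m arbitrary: i)
    case (Suc m)
    have "ennreal (1 / - Q i i) * ((if i = j then 1 else 0) +
        (\<integral>\<^sup>+k. ennreal (Q i k) * (\<integral>\<^sup>+t\<in>{0..}. feller_iter Q m t k j \<partial>lborel) \<partial>count_space (UNIV - {i}))) \<le> g i"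
    proof (rule ennreal_times_inverse_le)
      show "- Q i i > 0" using neg by simp
      have "(\<integral>\<^sup>+k. ennreal (Q i k) * (\<integral>\<^sup>+t\<in>{0..}. feller_iter Q m t k j \<partial>lborel) \<partial>count_space (UNIV - {i}))
        \<le> (\<integral>\<^sup>+k. ennreal (Q i k) * g k \<partial>count_space (UNIV - {i}))"
        by (intro nn_integral_mono mult_left_mono Suc) auto
      from add_left_mono[OF this] super[of i]
      show "(if i = j then 1 else 0) +
        (\<integral>\<^sup>+k. ennreal (Q i k) * (\<integral>\<^sup>+t\<in>{0..}. feller_iter Q m t k j \<partial>lborel) \<partial>count_space (UNIV - {i}))
        \<le> ennreal (- Q i i) * g i"
        by (meson order_trans)
    qed
    then show ?case by (subst nn_integral_feller_iter_Suc[of Q i, OF neg])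
  qed simp
  then show ?thesis unfolding green_eq_SUP by (rule SUP_least)
qed

text \<open>The recursion for the time integrals passes to the limit by monotone convergence.
  Nothing is subtracted, so the identity keeps its meaning when \<open>green\<close> is
  infinite.\<close>

lemma green_eq:
  fixes Q :: "'s::countable \<Rightarrow> 's \<Rightarrow> real"
  assumes neg: "Q i i < 0"
  shows "ennreal (- Q i i) * green Q i j =
    (if i = j then 1 else 0) + (\<integral>\<^sup>+k. ennreal (Q i k) * green Q k j \<partial>count_space (UNIV - {i}))"
proof -
  define g where "g m i = (\<integral>\<^sup>+t\<in>{0..}. feller_iter Q m t i j \<partial>lborel)" for m i
  have inc: "incseq (\<lambda>m. g m i)" for i
    unfolding g_def incseq_Suc_iff
    by (auto intro!: nn_integral_mono mult_right_mono feller_iter_mono simp del: feller_iter.simps)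
  have step: "ennreal (- Q i i) * g (Suc m) i = (if i = j then 1 else 0) + (\<integral>\<^sup>+k. ennreal (Q i k) * g m k \<partial>count_space (UNIV - {i}))" for m
  proof -
    have "ennreal (- Q i i) * (ennreal (1 / - Q i i) * x) = x" for x
      using neg by (simp add: mult.assoc[symmetric] ennreal_mult[symmetric])
    then show ?thesis unfolding g_def nn_integral_feller_iter_Suc[of Q i, OF neg] by simp
  qed
  have "green Q i j = (SUP m. g (Suc m) i)"
    unfolding green_eq_SUP g_def[symmetric]
    by (rule antisym) (use inc in \<open>auto intro!: SUP_mono simp: incseq_Suc_iff\<close>)
  then have "ennreal (- Q i i) * green Q i j = (SUP m. ennreal (- Q i i) * g (Suc m) i)"
    by (simp add: SUP_mult_left_ennreal)
  also have "\<dots> = (SUP m. (if i = j then 1 else 0) + (\<integral>\<^sup>+k. ennreal (Q i k) * g m k \<partial>count_space (UNIV - {i})))"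
    by (simp only: step)
  also have "\<dots> = (if i = j then 1 else 0) + (SUP m. \<integral>\<^sup>+k. ennreal (Q i k) * g m k \<partial>count_space (UNIV - {i}))"
    by (rule ennreal_SUP_add_right[symmetric]) auto
  also have "(SUP m. \<integral>\<^sup>+k. ennreal (Q i k) * g m k \<partial>count_space (UNIV - {i}))
     = (\<integral>\<^sup>+k. (SUP m. ennreal (Q i k) * g m k) \<partial>count_space (UNIV - {i}))"
    by (intro nn_integral_monotone_convergence_SUP[symmetric])
       (use inc in \<open>auto simp: incseq_def le_fun_def intro!: mult_left_mono\<close>)
  also have "\<dots> = (\<integral>\<^sup>+k. ennreal (Q i k) * green Q k j \<partial>count_space (UNIV - {i}))"
    unfolding green_eq_SUP g_def by (simp add: SUP_mult_left_ennreal)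
  finally show ?thesis .
qed

section \<open>A recurrence criterion\<close>

lemma nn_integral_count_space_eq_has_sum:
  fixes f :: "'s \<Rightarrow> real"
  assumes "(f has_sum s) A" "\<And>k. k \<in> A \<Longrightarrow> f k \<ge> 0"
  shows "(\<integral>\<^sup>+k. ennreal (f k) \<partial>count_space A) = ennreal s"
proof -
  have "f summable_on A" using assms(1) by (auto simp: summable_on_def)
  then have "(\<lambda>x. norm (f x)) summable_on A"
    by (rule summable_on_cong[THEN iffD1, rotated]) (use assms in auto)
  then have abs: "Infinite_Set_Sum.abs_summable_on f A"
    using abs_summable_equivalent by blast
  then have "infsetsum f A = s"
    using assms(1) by (simp add: infsetsum_infsum infsumI)
  then show ?thesis
    using nn_integral_conv_infsetsum[OF abs] assms(2) by simp
qed

lemma summable_on_if_nn_integral_count_space_le: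
  fixes f :: "'s \<Rightarrow> real"
  assumes "(\<integral>\<^sup>+k. ennreal (f k) \<partial>count_space A) \<le> ennreal x" "x \<ge> 0" "\<And>k. k \<in> A \<Longrightarrow> f k \<ge> 0"
  shows "f summable_on A" and "infsum f A \<le> x"
proof -
  have "sum f F \<le> x" if F: "finite F" "F \<subseteq> A" for F
  proof -
    have "ennreal (sum f F) = (\<Sum>k\<in>F. ennreal (f k))"
      by (rule sum_ennreal[symmetric]) (use F assms in auto)
    also have "\<dots> = (\<integral>\<^sup>+k. ennreal (f k) \<partial>count_space F)"
      using F by (simp add: nn_integral_count_space_finite)
    also have "\<dots> = (\<integral>\<^sup>+k. ennreal (f k) * indicator F k \<partial>count_space A)"
      using F by (subst nn_integral_count_space_indicator)
        (auto intro!: nn_integral_count_space_eq simp: indicator_def)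
    also have "\<dots> \<le> (\<integral>\<^sup>+k. ennreal (f k) \<partial>count_space A)"
      by (intro nn_integral_mono) (auto simp: indicator_def)
    also note assms(1)
    finally show ?thesis using assms(2) by simp
  qed
  then show s: "f summable_on A"
    by (intro nonneg_bdd_above_summable_on bdd_aboveI2[where M=x]) (use assms in auto)
  then show "infsum f A \<le> x"
    by (rule infsum_le_finite_sums) fact
qed

definition q_edge :: "('s \<Rightarrow> 's \<Rightarrow> real) \<Rightarrow> 's \<Rightarrow> 's \<Rightarrow> bool" where
  "q_edge Q i k \<longleftrightarrow> i \<noteq> k \<and> Q i k > 0"

text \<open>By conservativity, the supersolution inequality says that the terms
  \<open>Q i k * (D k - D i)\<close> have a sum of at most \<open>0\<close>. At a minimum of
  \<open>D\<close> they are all nonnegative, hence all zero.\<close>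

lemma minimum_propagates:
  fixes Q :: "'s \<Rightarrow> 's \<Rightarrow> real"
  assumes nonneg: "\<And>k. k \<noteq> i \<Longrightarrow> Q i k \<ge> 0"
    and cons: "(Q i has_sum - Q i i) (UNIV - {i})"
    and super: "((\<lambda>k. Q i k * D k) has_sum s) (UNIV - {i})" "s \<le> - Q i i * D i"
    and min: "\<And>k. D i \<le> D k" and edge: "q_edge Q i k"
  shows "D k = D i"
proof -
  have "((\<lambda>k. Q i k * D k - D i * Q i k) has_sum (s - D i * (- Q i i))) (UNIV - {i})"
    using has_sum_add[OF super(1) has_sum_cmult_right[OF cons, of "- D i"]] by simp
  moreover have "(\<lambda>k. Q i k * D k - D i * Q i k) = (\<lambda>k. Q i k * (D k - D i))"
    by (auto simp: algebra_simps)
  ultimately have *: "((\<lambda>k. Q i k * (D k - D i)) has_sum (s - D i * (- Q i i))) (UNIV - {i})"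
    by simp
  have nn: "Q i l * (D l - D i) \<ge> 0" if "l \<in> UNIV - {i}" for l
    using that nonneg min by simp
  have "s - D i * (- Q i i) \<le> 0" using super(2) by (simp add: mult.commute)
  then have "s - D i * (- Q i i) = 0"
    using has_sum_nonneg[OF * nn] by linarith
  with * have "((\<lambda>k. Q i k * (D k - D i)) has_sum 0) (UNIV - {i})" by simp
  from nonneg_has_sum_le_0D[OF this _ nn, of k] edge
  have "Q i k * (D k - D i) = 0" by (auto simp: q_edge_def)
  with edge show ?thesis by (simp add: q_edge_def)
qed

text \<open>A negative value would make \<open>D\<close> attain a negative minimum, because
  \<open>decay\<close> leaves only finitely many candidates. The minimum spreads along every edge
  that leaves a state other than \<open>z\<close>, so a path to \<open>z\<close> would carry the
  negative value there.\<close>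

lemma minimum_principle:
  fixes Q :: "'s \<Rightarrow> 's \<Rightarrow> real"
  assumes nonneg: "\<And>i k. k \<noteq> i \<Longrightarrow> Q i k \<ge> 0"
    and cons: "\<And>i. (Q i has_sum - Q i i) (UNIV - {i})"
    and reach: "\<And>i. (q_edge Q)\<^sup>*\<^sup>* i z"
    and super: "\<And>i. i \<noteq> z \<Longrightarrow> \<exists>s. ((\<lambda>k. Q i k * D k) has_sum s) (UNIV - {i}) \<and> s \<le> - Q i i * D i"
    and z: "D z \<ge> 0"
    and decay: "\<And>e. e > 0 \<Longrightarrow> finite {k. D k < - e}"
  shows "D j \<ge> (0::real)"
proof (rule ccontr)
  assume neg: "\<not> D j \<ge> 0"
  define S where "S = {k. D k \<le> D j}"
  have "finite S"
    by (rule finite_subset[OF _ decay[of "- D j / 2"]]) (use neg in \<open>auto simp: S_def\<close>)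
  moreover have "j \<in> S" by (simp add: S_def)
  ultimately obtain m where m: "m \<in> S" "\<And>k. k \<in> S \<Longrightarrow> D m \<le> D k"
    using finite_has_minimal[of "D ` S"]
    by (metis (no_types, lifting) arg_min_if_finite(1) arg_min_least empty_iff)
  have min: "D m \<le> D k" for k
    using m(1) m(2)[of k] unfolding S_def mem_Collect_eq by linarith
  have "D m < 0" using m(1) neg by (auto simp: S_def)
  have "D i = D m" if "(q_edge Q)\<^sup>*\<^sup>* m i" for i
    using that
  proof induction
    case (step i k)
    then have "i \<noteq> z" using z \<open>D m < 0\<close> by auto
    then obtain s where "((\<lambda>k. Q i k * D k) has_sum s) (UNIV - {i})" "s \<le> - Q i i * D i"
      using super by blast
    from minimum_propagates[OF nonneg cons this _ step(2)] show ?case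
      using step min by simp
  qed simp
  from this[OF reach] z \<open>D m < 0\<close> show False by simp
qed

text \<open>If the Green function \<open>g\<close> of \<open>j\<close> were finite,
  \<open>g - g z * f n\<close> would be superharmonic off \<open>z\<close>, zero at \<open>z\<close>
  and above any given negative level outside a finite set. The minimum principle gives
  \<open>g \<ge> g z * f n\<close>, and in the limit \<open>z\<close> becomes a minimum point of
  \<open>g\<close>.\<close>

lemma recurrent_if_subharmonic_family:
  fixes Q :: "'s::countable \<Rightarrow> 's \<Rightarrow> real" and f :: "nat \<Rightarrow> 's \<Rightarrow> real"
  assumes neg: "\<And>i. Q i i < 0" and nonneg: "\<And>i k. k \<noteq> i \<Longrightarrow> Q i k \<ge> 0"
    and cons: "\<And>i. (Q i has_sum - Q i i) (UNIV - {i})"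
    and irred: "\<And>i j. (q_edge Q)\<^sup>*\<^sup>* i j"
    and z: "\<And>n. f n z = 1"
    and sub: "\<And>n i. i \<noteq> z \<Longrightarrow> \<exists>s. ((\<lambda>k. Q i k * f n k) has_sum s) (UNIV - {i}) \<and> s \<ge> - Q i i * f n i"
    and decay: "\<And>n e. e > 0 \<Longrightarrow> finite {k. f n k > e}"
    and lim: "\<And>k. (\<lambda>n. f n k) \<longlonglongrightarrow> 1"
  shows "green Q j j = \<infinity>"
proof (rule ccontr)
  assume inf: "green Q j j \<noteq> \<infinity>"
  \<comment> \<open>Finiteness travels along an edge from source to target, since
    \<open>Q i k * green Q k j\<close> is a single term of the equation at \<open>i\<close>.\<close>
  have fin: "green Q i j \<noteq> \<infinity>" for i
    using irred[of j i]
  proof induction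
    case (step i k)
    then have e: "i \<noteq> k" "Q i k > 0" by (auto simp: q_edge_def)
    have "ennreal (Q i k) * green Q k j \<le> (\<integral>\<^sup>+k. ennreal (Q i k) * green Q k j \<partial>count_space (UNIV - {i}))"
      using e by (intro nn_integral_ge_point) auto
    also have "\<dots> \<le> ennreal (- Q i i) * green Q i j"
      unfolding green_eq[of Q i, OF neg] by simp
    also have "\<dots> < \<infinity>"
      using step.IH by (simp add: ennreal_mult_less_top less_top)
    finally show ?case using e by (auto simp: ennreal_mult_eq_top_iff)
  qed (fact inf)
  define g where "g i = enn2real (green Q i j)" for i
  have g: "green Q i j = ennreal (g i)" "g i \<ge> 0" for i
    using fin[of i] by (auto simp: g_def less_top)
  have super: "(\<lambda>k. Q i k * g k) summable_on (UNIV - {i})"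
    "infsum (\<lambda>k. Q i k * g k) (UNIV - {i}) \<le> - Q i i * g i - (if i = j then 1 else 0)" for i
  proof -
    have "(\<integral>\<^sup>+k. ennreal (Q i k * g k) \<partial>count_space (UNIV - {i}))
      = (\<integral>\<^sup>+k. ennreal (Q i k) * green Q k j \<partial>count_space (UNIV - {i}))" (is "?I = _")
      by (intro nn_integral_cong) (use nonneg g in \<open>auto simp: ennreal_mult\<close>)
    then have *: "ennreal (- Q i i * g i) = ennreal (if i = j then 1 else 0) + ?I"
      using green_eq[of Q i j, OF neg] ennreal_mult[of "- Q i i" "g i"] neg[of i] g(2)[of i]
      by (simp add: g(1) del: mult_minus_left)
    then have le: "ennreal (if i = j then 1 else 0) \<le> ennreal (- Q i i * g i)"
      by simp
    have pos: "- Q i i * g i \<ge> 0" using g neg[of i] by (simp add: mult_nonpos_nonneg)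
    then have le': "(if i = j then 1 else 0) \<le> - Q i i * g i"
      using le by (simp only: ennreal_le_iff)
    have "?I \<le> ennreal (- Q i i * g i - (if i = j then 1 else 0))"
      using * le' by (simp add: ennreal_minus[symmetric] del: ennreal_minus_if)
    from summable_on_if_nn_integral_count_space_le[OF this] le' nonneg g
    show "(\<lambda>k. Q i k * g k) summable_on (UNIV - {i})"
      "infsum (\<lambda>k. Q i k * g k) (UNIV - {i}) \<le> - Q i i * g i - (if i = j then 1 else 0)"
      by (auto simp: mult_nonneg_nonneg)
  qed
  have min: "g z \<le> g k" for k
  proof -
    have "0 \<le> g k - g z * f n k" for n
    proof (rule minimum_principle[of Q z "\<lambda>k. g k - g z * f n k", OF nonneg cons irred])
      fix i assume "i \<noteq> z"
      then obtain s where s: "((\<lambda>k. Q i k * f n k) has_sum s) (UNIV - {i})" "s \<ge> - Q i i * f n i"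
        using sub by blast
      have "((\<lambda>k. Q i k * g k + (- g z) * (Q i k * f n k)) has_sum
          (infsum (\<lambda>k. Q i k * g k) (UNIV - {i}) + (- g z) * s)) (UNIV - {i})"
        by (intro has_sum_add has_sum_cmult_right s has_sum_infsum super)
      moreover have "(\<lambda>k. Q i k * g k + (- g z) * (Q i k * f n k)) = (\<lambda>k. Q i k * (g k - g z * f n k))"
        by (auto simp: algebra_simps)
      moreover have "g z * s \<ge> g z * (- Q i i * f n i)"
        by (intro mult_left_mono s g)
      then have "infsum (\<lambda>k. Q i k * g k) (UNIV - {i}) + (- g z) * s \<le> - Q i i * (g i - g z * f n i)"
        using super(2)[of i] by (auto simp: algebra_simps split: if_splits)
      ultimately show "\<exists>s. ((\<lambda>k. Q i k * (g k - g z * f n k)) has_sum s) (UNIV - {i}) \<and>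
          s \<le> - Q i i * (g i - g z * f n i)" by metis
    next
      fix e :: real assume "e > 0"
      \<comment> \<open>The summand \<open>1\<close> in the threshold \<open>e / (g z + 1)\<close>
        covers the case \<open>g z = 0\<close>.\<close>
      have "{k. g k - g z * f n k < - e} \<subseteq> {k. f n k > e / (g z + 1)}"
      proof (clarify)
        fix k assume "g k - g z * f n k < - e"
        then have *: "e < g z * f n k" using g(2)[of k] by simp
        then have "f n k > 0" using g(2)[of z] \<open>e > 0\<close>
          by (metis less_trans zero_less_mult_pos not_less_iff_gr_or_eq mult_zero_left order_le_less)
        with * have "e < (g z + 1) * f n k" by (simp add: algebra_simps)
        then show "f n k > e / (g z + 1)" using g(2)[of z] by (simp add: divide_less_eq mult.commute)
      qed
      then show "finite {k. g k - g z * f n k < - e}"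
        using decay[of "e / (g z + 1)" n] \<open>e > 0\<close> g(2)[of z] finite_subset by fastforce
    next
      show "0 \<le> g z - g z * f n z" using z[of n] by simp
    qed
    then have "g z * f n k \<le> g k" for n by (simp add: algebra_simps)
    moreover have "(\<lambda>n. g z * f n k) \<longlonglongrightarrow> g z * 1" by (intro tendsto_intros lim)
    ultimately show "g z \<le> g k"
      using LIMSEQ_le_const2[of "\<lambda>n. g z * f n k"] by auto
  qed
  \<comment> \<open>\<open>g\<close> is superharmonic at every state, \<open>z\<close> included, so
    its minimum at \<open>z\<close> spreads to everything reachable from \<open>z\<close>.\<close>
  have const: "g i = g z" for i
    using irred[of z i]
  proof induction
    case (step i k)
    have "infsum (\<lambda>k. Q i k * g k) (UNIV - {i}) \<le> - Q i i * g i"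
      using super(2)[of i] by (simp split: if_splits)
    from minimum_propagates[OF nonneg cons has_sum_infsum[OF super(1)] this _ step(2)] show ?case
      using min step by auto
  qed simp
  \<comment> \<open>A constant satisfies the balance at \<open>j\<close> exactly, whereas the Green
    function has a source of size \<open>1\<close> there.\<close>
  have "infsum (\<lambda>k. Q j k * g k) (UNIV - {j}) = - Q j j * g z"
    using has_sum_cmult_left[OF cons[of j], of "g z"] by (subst const) (auto intro!: infsumI)
  with super(2)[of j] const[of j] show False by simp
qed

section \<open>Matrices with nonnegative off-diagonal entries\<close>

text \<open>\<open>max_eigenvalue\<close> is a \<open>Max\<close> over this set, which is
  informative only for a finite set. Eigenvectors of distinct eigenvalues are independent, and
  independent sets are finite here.\<close>

lemma finite_real_eigenvalues:
  fixes M :: "real^'n^'n"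
  shows "finite {r. \<exists>v. v \<noteq> 0 \<and> M *v v = r *\<^sub>R v}"
proof -
  define E where "E = {r. \<exists>v. v \<noteq> 0 \<and> M *v v = r *\<^sub>R v}"
  define w where "w r = (SOME v. v \<noteq> 0 \<and> M *v v = r *\<^sub>R v)" for r
  have w: "w r \<noteq> 0" "M *v w r = r *\<^sub>R w r" if "r \<in> E" for r
    using someI_ex[OF that[unfolded E_def mem_Collect_eq]] unfolding w_def by blast+
  have indep: "c r = 0" if "finite F" "F \<subseteq> E" "(\<Sum>r\<in>F. c r *\<^sub>R w r) = 0" "r \<in> F" for F c r
    using that
  proof (induction F arbitrary: c r)
    case (insert x F)
    have eig: "M *v w r = r *\<^sub>R w r" if "r \<in> insert x F" for r
      using w insert.prems(1) that by blast
    \<comment> \<open>Applying \<open>M\<close> to the relation and subtracting \<open>x\<close>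
      times it removes \<open>w x\<close>; the induction hypothesis then handles the coefficients
      \<open>c r * (r - x)\<close>.\<close>
    have "M *v (\<Sum>r\<in>insert x F. c r *\<^sub>R w r) = (\<Sum>r\<in>insert x F. (c r * r) *\<^sub>R w r)"
      unfolding linear_sum[OF matrix_vector_mul_linear]
      by (intro sum.cong refl) (simp only: matrix_vector_mult_scaleR eig scaleR_scaleR)
    then have "(\<Sum>r\<in>insert x F. (c r * r) *\<^sub>R w r) - x *\<^sub>R (\<Sum>r\<in>insert x F. c r *\<^sub>R w r) = 0"
      using insert.prems(2) by (simp only: matrix_vector_mult_0_right scaleR_zero_right diff_0_right)
    moreover have "(\<Sum>r\<in>insert x F. (c r * r) *\<^sub>R w r) - x *\<^sub>R (\<Sum>r\<in>insert x F. c r *\<^sub>R w r)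
        = (\<Sum>r\<in>F. (c r * (r - x)) *\<^sub>R w r)"
      using insert.hyps by (simp add: scaleR_sum_right sum_subtractf[symmetric] algebra_simps)
    ultimately have "(\<Sum>r\<in>F. (c r * (r - x)) *\<^sub>R w r) = 0" by simp
    from insert.IH[OF _ this] insert.prems(1) have "c r * (r - x) = 0" if "r \<in> F" for r
      using that by blast
    then have F0: "c r = 0" if "r \<in> F" for r using that insert.hyps(2) by (metis mult_eq_0_iff right_minus_eq)
    then have "c x *\<^sub>R w x = 0"
      using insert.prems(2) insert.hyps by simp
    then have "c x = 0" using w(1)[of x] insert.prems(1) by simp
    with F0 insert.prems(3) show ?case by auto
  qed simp
  have inj: "inj_on w E"
  proof (rule inj_onI)
    fix r s assume rs: "r \<in> E" "s \<in> E" "w r = w s"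
    have "r *\<^sub>R w r = s *\<^sub>R w r" using w(2)[OF rs(1)] w(2)[OF rs(2)] rs(3) by metis
    then show "r = s" using w(1)[OF rs(2)] rs(3) by simp
  qed
  have "independent (w ` E)"
    unfolding independent_explicit_finite_subsets
  proof (intro allI impI ballI)
    fix T u v assume T: "finite T" "T \<subseteq> w ` E" "(\<Sum>v\<in>T. u v *\<^sub>R v) = 0" "v \<in> T"
    then obtain F where F: "F \<subseteq> E" "T = w ` F" "inj_on w F"
      unfolding subset_image_inj by blast
    have "finite F" using F(2,3) T(1) by (simp add: finite_image_iff)
    moreover have "(\<Sum>r\<in>F. u (w r) *\<^sub>R w r) = 0"
      using T(3) F by (simp add: sum.reindex)
    ultimately show "u v = 0"
      using indep[of F "\<lambda>r. u (w r)"] F(1,2) T(4) by blast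
  qed
  then have "finite (w ` E)" by (rule independent_imp_finite)
  then show ?thesis using inj by (simp add: finite_image_iff E_def)
qed

lemma matrix_vector_mult_mono:
  fixes M :: "real^'n^'n"
  assumes "\<And>i j. M $ i $ j \<ge> 0" "\<And>i. x $ i \<le> y $ i"
  shows "(M *v x) $ i \<le> (M *v y) $ i"
  using assms by (auto simp: matrix_vector_mult_def intro!: sum_mono mult_left_mono)

lemma matrix_vector_mult_pos:
  fixes M :: "real^'n^'n"
  assumes "\<And>i j. M $ i $ j > 0" "\<And>i. x $ i \<ge> 0" "x \<noteq> 0"
  shows "(M *v x) $ i > 0"
proof -
  obtain j where "x $ j \<noteq> 0" using assms(3) by (metis vec_eq_iff zero_index)
  with assms(2)[of j] have "x $ j > 0" by simp
  then show ?thesis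
    unfolding matrix_vector_mult_def vec_lambda_beta
    by (intro sum_pos2[where i=j]) (use assms in \<open>auto intro: mult_nonneg_nonneg less_imp_le\<close>)
qed

text \<open>Brouwer's theorem on the simplex slice \<open>{x \<ge> 0. \<Sum>x = 1 \<and> N x \<ge> d x}\<close>, which
  \<open>x \<mapsto> N x / \<Sum>(N x)\<close> maps to itself.\<close>

lemma nonnegative_matrix_eigenvalue_ge:
  fixes N :: "real^'n^'n"
  assumes N: "\<And>i j. N $ i $ j \<ge> 0" and d: "d > 0"
    and w: "\<And>i. w $ i \<ge> 0" "w \<noteq> 0" "\<And>i. (N *v w) $ i \<ge> d * w $ i"
  shows "\<exists>r v. r \<ge> d \<and> v \<noteq> 0 \<and> N *v v = r *\<^sub>R v"
proof -
  define s :: "real^'n \<Rightarrow> real" where "s x = (\<Sum>i\<in>UNIV. x $ i)" for x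
  have s_scale: "s (c *\<^sub>R x) = c * s x" for c x by (simp add: s_def sum_distrib_left)
  have s_add: "s (x + y) = s x + s y" for x y by (simp add: s_def sum.distrib)
  have s_pos: "s x > 0" if nn: "\<And>i. x $ i \<ge> 0" and nz: "x \<noteq> 0" for x
  proof -
    obtain j where "x $ j \<noteq> 0" using nz by (metis vec_eq_iff zero_index)
    then have "x $ j > 0" using nn[of j] by simp
    then show ?thesis
      unfolding s_def by (intro sum_pos2[where i=j]) (use nn in auto)
  qed
  define K where "K = {x. (\<forall>i. x $ i \<ge> 0) \<and> s x = 1 \<and> (\<forall>i. (N *v x) $ i \<ge> d * x $ i)}"
  have cont_N: "continuous_on A (\<lambda>x. N *v x)" for A
    by (intro linear_continuous_on) (simp add: linear_linear matrix_vector_mul_bounded_linear)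
  have cont_s: "continuous_on A s" for A
    unfolding s_def by (intro continuous_intros)
  have sK: "s (N *v x) \<ge> d" if "x \<in> K" for x
  proof -
    have "d * s x \<le> s (N *v x)"
      unfolding s_def sum_distrib_left using that by (intro sum_mono) (auto simp: K_def)
    then show ?thesis using that by (simp add: K_def)
  qed
  have "closed K"
    unfolding K_def Collect_conj_eq Collect_all_eq
    by (intro closed_Int closed_INT ballI closed_Collect_le closed_Collect_eq continuous_intros cont_s
        continuous_on_component cont_N)
  moreover have "bounded K"
  proof (rule boundedI)
    fix x assume x: "x \<in> K"
    have "norm x \<le> (\<Sum>i\<in>UNIV. \<bar>x $ i\<bar>)" by (rule norm_le_l1_cart)
    also have "\<dots> = 1" using x by (simp add: K_def s_def)
    finally show "norm x \<le> 1" .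
  qed
  ultimately have "compact K" by (simp add: compact_eq_bounded_closed)
  moreover have "convex K"
  proof (rule convexI)
    fix x y and u v :: real
    assume *: "x \<in> K" "y \<in> K" "0 \<le> u" "0 \<le> v" "u + v = 1"
    have "d * (u * x $ i + v * y $ i) \<le> u * (N *v x) $ i + v * (N *v y) $ i" for i
    proof -
      have "u * (d * x $ i) + v * (d * y $ i) \<le> u * (N *v x) $ i + v * (N *v y) $ i"
        using * by (intro add_mono mult_left_mono) (auto simp: K_def)
      then show ?thesis by (simp add: algebra_simps)
    qed
    with * show "u *\<^sub>R x + v *\<^sub>R y \<in> K"
      by (simp add: K_def s_add s_scale matrix_vector_right_distrib matrix_vector_mult_scaleR)
  qed
  moreover have "K \<noteq> {}"
  proof -
    have "(1 / s w) *\<^sub>R w \<in> K"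
      using s_pos[OF w(1,2)] w by (simp add: K_def s_scale matrix_vector_mult_scaleR divide_right_mono)
    then show ?thesis by blast
  qed
  moreover define f where "f x = (1 / s (N *v x)) *\<^sub>R (N *v x)" for x
  have "continuous_on K f"
    unfolding f_def using sK d
    by (intro continuous_intros cont_N continuous_on_compose2[OF cont_s[of UNIV]]) force+
  moreover have "f \<in> K \<rightarrow> K"
  proof
    fix x assume x: "x \<in> K"
    have pos: "s (N *v x) > 0" using sK[OF x] d by simp
    have nn: "(N *v x) $ i \<ge> 0" for i
      using x N by (auto simp: matrix_vector_mult_def K_def intro!: sum_nonneg mult_nonneg_nonneg)
    have "(N *v (d *\<^sub>R x)) $ i \<le> (N *v (N *v x)) $ i" for i
      using x by (intro matrix_vector_mult_mono N) (auto simp: K_def)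
    then have "d * (N *v x) $ i \<le> (N *v (N *v x)) $ i" for i
      by (simp add: matrix_vector_mult_scaleR)
    then show "f x \<in> K"
      using pos nn by (simp add: K_def f_def s_scale matrix_vector_mult_scaleR divide_right_mono)
  qed
  ultimately obtain x where x: "x \<in> K" "f x = x" by (rule brouwer)
  have pos: "s (N *v x) > 0" using sK[OF x(1)] d by simp
  then have "N *v x = s (N *v x) *\<^sub>R f x" by (simp add: f_def)
  moreover have "x \<noteq> 0" using x by (auto simp: K_def s_def)
  ultimately show ?thesis using x sK[OF x(1)] by metis
qed

text \<open>Adding a multiple of the identity makes all entries nonnegative and merely shifts the
  eigenvalues.\<close>

lemma metzler_eigenvalue_ge:
  fixes M :: "real^'n^'n"
  assumes M: "\<And>i j. i \<noteq> j \<Longrightarrow> M $ i $ j \<ge> 0"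
    and w: "\<And>i. w $ i \<ge> 0" "w \<noteq> 0" "\<And>i. (M *v w) $ i \<ge> d * w $ i"
  shows "\<exists>r v. r \<ge> d \<and> v \<noteq> 0 \<and> M *v v = r *\<^sub>R v"
proof -
  \<comment> \<open>The sum dominates every diagonal entry, and \<open>\<bar>d\<bar> + 1\<close>
    makes the shifted bound \<open>d + c\<close> positive, as the nonnegative case demands.\<close>
  define c where "c = \<bar>d\<bar> + 1 + (\<Sum>i\<in>UNIV. \<bar>M $ i $ i\<bar>)"
  define N where "N = M + c *\<^sub>R mat 1"
  have N: "N *v x = M *v x + c *\<^sub>R x" for x
    by (simp add: N_def matrix_vector_mult_add_rdistrib scaleR_matrix_vector_assoc[symmetric])
  have "c \<ge> \<bar>M $ i $ i\<bar>" for i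
    unfolding c_def using member_le_sum[of i UNIV "\<lambda>i. \<bar>M $ i $ i\<bar>"] by simp
  note c = this
  have "N $ i $ j \<ge> 0" for i j
    using M[of i j] c[of i] by (cases "i = j") (auto simp: N_def mat_def)
  moreover have "d + c > 0"
  proof -
    have "(\<Sum>i\<in>UNIV. \<bar>M $ i $ i\<bar>) \<ge> 0" by (intro sum_nonneg) simp
    then show ?thesis unfolding c_def by linarith
  qed
  moreover have "(d + c) * w $ i \<le> (N *v w) $ i" for i
    using w(3)[of i] by (simp add: N algebra_simps)
  ultimately obtain r v where "r \<ge> d + c" "v \<noteq> 0" "N *v v = r *\<^sub>R v"
    using nonnegative_matrix_eigenvalue_ge[of N "d + c" w] w(1,2) by blast
  then have "M *v v = (r - c) *\<^sub>R v" "r - c \<ge> d" "v \<noteq> 0"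
    by (auto simp: N algebra_simps)
  then show ?thesis by blast
qed

text \<open>The Collatz-Wielandt lower bound for the Perron root.\<close>

lemma max_eigenvalue_ge:
  fixes M :: "real^'n^'n"
  assumes "\<And>i j. i \<noteq> j \<Longrightarrow> M $ i $ j \<ge> 0"
    and "\<And>i. w $ i \<ge> 0" "w \<noteq> 0" "\<And>i. (M *v w) $ i \<ge> d * w $ i"
  shows "max_eigenvalue M \<ge> d"
proof -
  obtain r v where "r \<ge> d" "v \<noteq> 0" "M *v v = r *\<^sub>R v"
    using metzler_eigenvalue_ge[OF assms] by blast
  then have "r \<le> max_eigenvalue M"
    unfolding max_eigenvalue_def by (intro Max_ge finite_real_eigenvalues) auto
  with \<open>r \<ge> d\<close> show ?thesis by simp
qed

text \<open>The absolute values of an eigenvector form such a \<open>v\<close>: once the diagonal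
  term has been moved to the other side, the triangle inequality meets only nonnegative
  coefficients.\<close>

lemma max_eigenvalue_subvector:
  fixes M :: "real^'n^'n"
  assumes M: "\<And>i j. i \<noteq> j \<Longrightarrow> M $ i $ j \<ge> 0"
  obtains v where "\<And>i. v $ i \<ge> 0" "v \<noteq> 0" "\<And>i. (M *v v) $ i \<ge> max_eigenvalue M * v $ i"
proof -
  let ?E = "{r. \<exists>v. v \<noteq> 0 \<and> M *v v = r *\<^sub>R v}"
  \<comment> \<open>A crude bound for which the all-ones vector is a subvector. It shows that a real
    eigenvalue exists, so that the \<open>Max\<close> is attained.\<close>
  define d where "d = - (\<Sum>i\<in>UNIV. \<bar>M $ i $ i\<bar>)"
  have "d * 1 \<le> (M *v 1) $ i" for i
  proof -
    have "d \<le> - \<bar>M $ i $ i\<bar>"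
      unfolding d_def using member_le_sum[of i UNIV "\<lambda>i. \<bar>M $ i $ i\<bar>"] by simp
    also have "\<dots> \<le> M $ i $ i + (\<Sum>j\<in>UNIV - {i}. M $ i $ j)"
      using sum_nonneg[of "UNIV - {i}" "\<lambda>j. M $ i $ j"] M by auto
    also have "\<dots> = (M *v 1) $ i"
      by (simp add: matrix_vector_mult_def sum.remove[of UNIV i])
    finally show ?thesis by simp
  qed
  then have "?E \<noteq> {}"
    using metzler_eigenvalue_ge[OF M, of 1 d] by fastforce
  then have "max_eigenvalue M \<in> ?E"
    unfolding max_eigenvalue_def by (rule Max_in[OF finite_real_eigenvalues])
  then obtain v where v: "v \<noteq> 0" "M *v v = max_eigenvalue M *\<^sub>R v" by blast
  let ?r = "max_eigenvalue M"
  have "?r * \<bar>v $ i\<bar> \<le> (M *v (\<chi> i. \<bar>v $ i\<bar>)) $ i" for i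
  proof -
    have "(M *v v) $ i = M $ i $ i * v $ i + (\<Sum>j\<in>UNIV - {i}. M $ i $ j * v $ j)"
      by (simp add: matrix_vector_mult_def sum.remove[of UNIV i])
    then have "(?r - M $ i $ i) * v $ i = (\<Sum>j\<in>UNIV - {i}. M $ i $ j * v $ j)"
      using v(2) by (simp add: algebra_simps)
    then have eq: "\<bar>(?r - M $ i $ i) * v $ i\<bar> = \<bar>\<Sum>j\<in>UNIV - {i}. M $ i $ j * v $ j\<bar>"
      by simp
    have "\<bar>?r - M $ i $ i\<bar> * \<bar>v $ i\<bar> \<le> (\<Sum>j\<in>UNIV - {i}. M $ i $ j * \<bar>v $ j\<bar>)"
      unfolding abs_mult[symmetric] eq
      by (rule order_trans[OF sum_abs], rule sum_mono) (use M in \<open>auto simp: abs_mult\<close>)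
    moreover have "(?r - M $ i $ i) * \<bar>v $ i\<bar> \<le> \<bar>?r - M $ i $ i\<bar> * \<bar>v $ i\<bar>"
      by (intro mult_right_mono) auto
    moreover have "(M *v (\<chi> i. \<bar>v $ i\<bar>)) $ i = M $ i $ i * \<bar>v $ i\<bar> + (\<Sum>j\<in>UNIV - {i}. M $ i $ j * \<bar>v $ j\<bar>)"
      by (simp add: matrix_vector_mult_def sum.remove[of UNIV i])
    ultimately show ?thesis by (simp add: algebra_simps)
  qed
  moreover have "(\<chi> i. \<bar>v $ i\<bar>) \<noteq> 0" using v(1) by (auto simp: vec_eq_iff)
  ultimately show ?thesis using that[of "\<chi> i. \<bar>v $ i\<bar>"] by simp
qed

section \<open>Monomials and power series on the cube\<close>

definition vpow :: "real^'n \<Rightarrow> nat^'n \<Rightarrow> real" where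
  "vpow u m = (\<Prod>k\<in>UNIV. (u $ k) ^ (m $ k))"

lemma genfun_vpow: "genfun c u = (\<Sum>\<^sub>\<infinity>m. c m * vpow u m)"
  by (simp add: genfun_def vpow_def)

lemma cubeD: "(u :: real^'n) \<in> {0..1} \<Longrightarrow> 0 \<le> u $ k" "u \<in> {0..1} \<Longrightarrow> u $ k \<le> 1"
  by (auto simp: less_eq_vec_def)

lemma one_mem_cube [simp]: "(1 :: real^'n) \<in> {0..1}"
  by (auto simp: less_eq_vec_def)

lemma zero_le_one_vec [simp]: "(0 :: real^'n) \<le> 1"
  by (simp add: less_eq_vec_def)

lemma vpow_zero_right [simp]: "vpow u 0 = 1"
  by (simp add: vpow_def)

lemma vpow_one_left [simp]: "vpow 1 m = 1"
  by (simp add: vpow_def)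

lemma vpow_zero_left: "m \<noteq> 0 \<Longrightarrow> vpow 0 m = 0"
  by (auto simp: vpow_def vec_eq_iff)

lemma vpow_add: "vpow u (m + m') = vpow u m * vpow u m'"
  by (simp add: vpow_def power_add prod.distrib)

lemma vpow_axis [simp]: "vpow u (axis k 1) = u $ k"
proof -
  have "vpow u (axis k 1) = (\<Prod>l\<in>UNIV. if l = k then u $ k else 1)"
    unfolding vpow_def by (intro prod.cong) (auto simp: axis_def)
  then show ?thesis by simp
qed

lemma vpow_axis_Suc [simp]: "vpow u (axis k (Suc 0)) = u $ k"
  using vpow_axis[of u k] by simp

lemma vpow_nonneg: "u \<in> {0..1} \<Longrightarrow> vpow u m \<ge> 0"
  unfolding vpow_def by (intro prod_nonneg ballI zero_le_power cubeD)

lemma vpow_le_one: "u \<in> {0..1} \<Longrightarrow> vpow u m \<le> 1"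
  unfolding vpow_def by (intro prod_le_1 conjI power_le_one zero_le_power cubeD)

lemma vpow_mono: "0 \<le> u \<Longrightarrow> u \<le> v \<Longrightarrow> vpow u m \<le> vpow v m"
  unfolding vpow_def by (intro prod_mono) (auto simp: less_eq_vec_def intro: power_mono)

lemma continuous_on_vpow [continuous_intros]:
  "continuous_on S f \<Longrightarrow> continuous_on S (\<lambda>x. vpow (f x) m)"
  unfolding vpow_def by (intro continuous_intros)

text \<open>The bound is linear in the exponents, so summing it against offspring rates involves
  first moments only, and these are what (A-2) controls.\<close>

lemma vpow_lipschitz:
  assumes "u \<in> {0..1}" "v \<in> {0..1}"
  shows "\<bar>vpow u m - vpow v m\<bar> \<le> (\<Sum>k\<in>UNIV. real (m $ k) * \<bar>u $ k - v $ k\<bar>)"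
proof -
  have *: "norm (u $ k) \<le> 1" "norm (v $ k) \<le> 1" for k
    using cubeD[OF assms(1)] cubeD[OF assms(2)] by (auto simp: abs_le_iff intro: order_trans[of _ 0])
  have "norm (vpow u m - vpow v m) \<le> (\<Sum>k\<in>UNIV. norm (u $ k ^ m $ k - v $ k ^ m $ k))"
    unfolding vpow_def
    by (intro norm_prod_diff) (use * in \<open>auto simp: norm_power intro: power_le_one simp del: real_norm_def\<close>)
  also have "\<dots> \<le> (\<Sum>k\<in>UNIV. real (m $ k) * norm (u $ k - v $ k))"
    by (intro sum_mono norm_power_diff *)
  finally show ?thesis by simp
qed

lemma vpow_bernoulli:
  assumes "u \<in> {0..1}"
  shows "vpow u m \<ge> 1 - (\<Sum>k\<in>UNIV. real (m $ k) * (1 - u $ k))"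
proof -
  have "\<bar>1 - vpow u m\<bar> \<le> (\<Sum>k\<in>UNIV. real (m $ k) * \<bar>1 - u $ k\<bar>)"
    using vpow_lipschitz[OF one_mem_cube assms, of m] by simp
  also have "\<dots> = (\<Sum>k\<in>UNIV. real (m $ k) * (1 - u $ k))"
    using cubeD(2)[OF assms] by (intro sum.cong) auto
  finally show ?thesis by linarith
qed

lemma axis_decompose:
  fixes m :: "nat^'n"
  assumes "m $ k \<noteq> 0" shows "m = axis k 1 + (m - axis k 1)"
  using assms by (auto simp: vec_eq_iff axis_def)

lemma sum_axis: "(\<Sum>l\<in>UNIV. real (axis k 1 $ l) * f l) = f k"
proof -
  have "(\<Sum>l\<in>UNIV. real (axis k 1 $ l) * f l) = (\<Sum>l\<in>UNIV. if l = k then f k else 0)"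
    by (intro sum.cong) (auto simp: axis_def)
  then show ?thesis by simp
qed

lemma vpow_less_one:
  assumes "u \<in> {0..1}" "\<And>k. u $ k < 1" "m \<noteq> 0"
  shows "vpow u m < 1"
proof -
  obtain k where "m $ k \<noteq> 0" using assms(3) by (auto simp: vec_eq_iff)
  then have "vpow u m = u $ k * vpow u (m - axis k 1)"
    using axis_decompose[of m k] vpow_add[of u "axis k 1" "m - axis k 1"] by simp
  also have "\<dots> \<le> u $ k * 1"
    by (intro mult_left_mono vpow_le_one cubeD assms)
  finally show ?thesis using assms(2)[of k] by simp
qed

text \<open>Exponents \<open>axis k 1 + m\<close> with \<open>m \<noteq> 0\<close> are those of
  total degree at least two. In degrees zero and one Bernoulli's inequality is an equality.\<close>

lemma vpow_bernoulli_strict: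
  assumes u: "u \<in> {0..1}" "\<And>k. u $ k < 1" and m: "m \<noteq> 0"
  shows "vpow u (axis k 1 + m) > 1 - (\<Sum>l\<in>UNIV. real ((axis k 1 + m) $ l) * (1 - u $ l))"
proof -
  let ?S = "\<Sum>l\<in>UNIV. real (m $ l) * (1 - u $ l)"
  have S: "(\<Sum>l\<in>UNIV. real ((axis k 1 + m) $ l) * (1 - u $ l)) = (1 - u $ k) + ?S"
    unfolding sum_axis[of k "\<lambda>l. 1 - u $ l", symmetric] sum.distrib[symmetric]
    by (intro sum.cong refl) (simp only: vector_add_component of_nat_add ring_distribs)
  have "vpow u (axis k 1 + m) = vpow u m - (1 - u $ k) * vpow u m"
    by (simp add: vpow_add algebra_simps)
  moreover have "(1 - u $ k) * vpow u m < (1 - u $ k) * 1"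
    by (intro mult_strict_left_mono vpow_less_one) (use u m in auto)
  ultimately show ?thesis
    using vpow_bernoulli[OF u(1), of m] S by (simp del: vector_add_component)
qed

text \<open>Where \<open>m $ k = 0\<close>, the subtraction \<open>m - axis k 1\<close> is
  truncated, but its term carries the factor \<open>0\<close>.\<close>

lemma has_real_derivative_vpow:
  assumes "\<And>k. ((\<lambda>x. V x $ k) has_real_derivative V' k) (at x)"
  shows "((\<lambda>x. vpow (V x) m) has_real_derivative
    (\<Sum>k\<in>UNIV. real (m $ k) * vpow (V x) (m - axis k 1) * V' k)) (at x)"
proof -
  have "((\<lambda>x. vpow (V x) m) has_real_derivative
    (\<Sum>k\<in>UNIV. (real (m $ k) * (V x $ k ^ (m $ k - 1) * V' k)) * (\<Prod>l\<in>UNIV - {k}. V x $ l ^ m $ l))) (at x)"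
    unfolding vpow_def
    by (intro has_field_derivative_prod) (auto intro!: derivative_eq_intros assms)
  moreover have "vpow (V x) (m - axis k 1) = V x $ k ^ (m $ k - 1) * (\<Prod>l\<in>UNIV - {k}. V x $ l ^ m $ l)" for k
    unfolding vpow_def by (subst prod.remove[of UNIV k]) (auto simp: axis_def intro!: prod.cong)
  ultimately show ?thesis by (simp add: mult_ac)
qed

lemma summable_on_vpow:
  fixes c :: "nat^'n \<Rightarrow> real"
  assumes "(\<lambda>m. \<bar>c m\<bar>) summable_on UNIV" "u \<in> {0..1}"
  shows "(\<lambda>m. c m * vpow u m) summable_on UNIV"
proof -
  have "(\<lambda>m. norm (c m * vpow u m)) summable_on UNIV"
    by (rule summable_on_comparison_test[OF assms(1)])
       (use vpow_nonneg[OF assms(2)] vpow_le_one[OF assms(2)] in \<open>auto simp: abs_mult intro: mult_left_le\<close>)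
  then show ?thesis by (rule abs_summable_summable)
qed

lemma continuous_on_genfun:
  assumes "(\<lambda>m. \<bar>c m\<bar>) summable_on UNIV"
  shows "continuous_on {0..1} (genfun c)"
proof -
  have "uniform_limit {0..1} (\<lambda>X u. \<Sum>m\<in>X. c m * vpow u m) (\<lambda>u. \<Sum>\<^sub>\<infinity>m\<in>UNIV. c m * vpow u m)
      (finite_subsets_at_top UNIV)"
  proof (rule Weierstrass_m_test_general[where M="\<lambda>m. \<bar>c m\<bar>"])
    show "norm (c m * vpow u m) \<le> \<bar>c m\<bar>" if "u \<in> {0..1}" for m u
      using vpow_nonneg[OF that] vpow_le_one[OF that] by (auto simp: abs_mult intro: mult_left_le)
  qed (fact assms)
  then show ?thesis
    unfolding genfun_vpow
    by (rule uniform_limit_theorem[rotated]) (auto intro!: always_eventually continuous_intros continuous_on_id)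
qed

text \<open>Only a one-sided derivative is assumed, as in Abel's theorem; for nonnegative coefficients
  both inequalities come from \<open>1 - s ^ e \<le> e * (1 - s)\<close> and truncation to finite sums.\<close>

lemma has_sum_derivative_at_one:
  fixes p :: "'a \<Rightarrow> real" and e :: "'a \<Rightarrow> nat"
  assumes p: "\<And>m. p m \<ge> 0" "p summable_on UNIV"
    and F: "((\<lambda>s. \<Sum>\<^sub>\<infinity>m. p m * s ^ e m) has_real_derivative D) (at 1 within {0..1})"
  shows "((\<lambda>m. p m * real (e m)) has_sum D) UNIV"
proof -
  define G where "G s = (\<Sum>\<^sub>\<infinity>m. p m * s ^ e m)" for s :: real
  define Qt where "Qt s = (G s - G 1) / (s - 1)" for s
  have nontriv: "at (1::real) within {0..1} \<noteq> bot"
    by (simp add: at_within_Icc_at_left trivial_limit_at_left_real)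
  have lim: "(Qt \<longlongrightarrow> D) (at 1 within {0..1})"
    using F unfolding has_field_derivative_iff Qt_def[abs_def] G_def by simp
  have summ: "(\<lambda>m. p m * s ^ e m) summable_on UNIV" if "s \<in> {0..1}" for s
    using that p by (intro summable_on_comparison_test[OF p(2)])
      (auto intro: mult_left_le power_le_one simp: mult_left_le power_le_one)
  have Qt_eq: "(\<lambda>m. p m * ((1 - s ^ e m) / (1 - s))) summable_on UNIV"
      "Qt s = (\<Sum>\<^sub>\<infinity>m. p m * ((1 - s ^ e m) / (1 - s)))" if s: "s \<in> {0..<1}" for s
  proof -
    have "((\<lambda>m. (p m * 1 ^ e m + (-1) * (p m * s ^ e m)) * (1 / (1 - s))) has_sum ((G 1 + (-1) * G s) * (1 / (1 - s)))) UNIV"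
      unfolding G_def using s
      by (intro has_sum_cmult_left has_sum_add has_sum_cmult_right has_sum_infsum summ) auto
    moreover have "(\<lambda>m. (p m * 1 ^ e m + (-1) * (p m * s ^ e m)) * (1 / (1 - s))) = (\<lambda>m. p m * ((1 - s ^ e m) / (1 - s)))"
      by (auto simp: fun_eq_iff algebra_simps diff_divide_distrib)
    moreover have "(G 1 + (-1) * G s) * (1 / (1 - s)) = Qt s"
      using s by (simp add: Qt_def field_simps)
    ultimately have "((\<lambda>m. p m * ((1 - s ^ e m) / (1 - s))) has_sum Qt s) UNIV" by simp
    then show "(\<lambda>m. p m * ((1 - s ^ e m) / (1 - s))) summable_on UNIV"
      "Qt s = (\<Sum>\<^sub>\<infinity>m. p m * ((1 - s ^ e m) / (1 - s)))"
      by (auto simp: summable_on_def infsumI)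
  qed
  have ev: "eventually (\<lambda>s. s \<in> {0..<1}) (at 1 within {0..1::real})"
    unfolding eventually_at_filter by (auto intro!: always_eventually)
  have quot_nn: "(1 - s ^ n) / (1 - s) \<ge> 0" "(1 - s ^ n) / (1 - s) \<le> real n"
    if s: "s \<in> {0..<1}" for s :: real and n
  proof -
    show "(1 - s ^ n) / (1 - s) \<ge> 0" using s by (auto intro!: divide_nonneg_pos simp: power_le_one)
    have "norm (1 ^ n - s ^ n) \<le> real n * norm (1 - s)"
      by (intro norm_power_diff) (use s in auto)
    then show "(1 - s ^ n) / (1 - s) \<le> real n"
      using s by (simp add: divide_le_eq power_le_one)
  qed
  have upper: "(\<Sum>m\<in>T. p m * real (e m)) \<le> D" if T: "finite T" for T
  proof (rule tendsto_le[OF nontriv lim])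
    have "((\<lambda>s. \<Sum>m\<in>T. p m * s ^ e m) has_real_derivative (\<Sum>m\<in>T. p m * real (e m))) (at 1 within {0..1})"
      by (auto intro!: derivative_eq_intros sum.cong)
    then show "((\<lambda>s. ((\<Sum>m\<in>T. p m * s ^ e m) - (\<Sum>m\<in>T. p m * 1 ^ e m)) / (s - 1)) \<longlongrightarrow>
        (\<Sum>m\<in>T. p m * real (e m))) (at 1 within {0..1})"
      unfolding has_field_derivative_iff by simp
    show "eventually (\<lambda>s. ((\<Sum>m\<in>T. p m * s ^ e m) - (\<Sum>m\<in>T. p m * 1 ^ e m)) / (s - 1) \<le> Qt s) (at 1 within {0..1})"
      using ev
    proof eventually_elim
      case (elim s)
      have "((\<Sum>m\<in>T. p m * s ^ e m) - (\<Sum>m\<in>T. p m * 1 ^ e m)) / (s - 1)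
        = (\<Sum>m\<in>T. p m * ((1 - s ^ e m) / (1 - s)))"
        using elim by (simp add: sum_subtractf[symmetric] sum_divide_distrib)
          (intro sum.cong, auto simp: field_simps)
      also have "\<dots> \<le> Qt s"
        unfolding Qt_eq(2)[OF elim]
        by (intro finite_sum_le_infsum Qt_eq elim T) (use quot_nn[OF elim] p in \<open>auto simp del: times_divide_eq_right\<close>)
      finally show ?case .
    qed
  qed
  have sm: "(\<lambda>m. p m * real (e m)) summable_on UNIV"
    by (rule nonneg_bdd_above_summable_on) (use upper p in \<open>auto intro!: bdd_aboveI2[where M=D]\<close>)
  have "infsum (\<lambda>m. p m * real (e m)) UNIV \<le> D"
    by (rule infsum_le_finite_sums[OF sm]) (use upper in auto)
  moreover have "D \<le> infsum (\<lambda>m. p m * real (e m)) UNIV"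
  proof (rule tendsto_upperbound[OF lim _ nontriv])
    show "eventually (\<lambda>s. Qt s \<le> infsum (\<lambda>m. p m * real (e m)) UNIV) (at 1 within {0..1})"
      using ev
    proof eventually_elim
      case (elim s)
      show ?case
        unfolding Qt_eq(2)[OF elim]
        by (intro infsum_mono Qt_eq elim sm mult_left_mono quot_nn p)
    qed
  qed
  ultimately show ?thesis using has_sum_infsum[OF sm] by simp
qed

section \<open>The generator\<close>

text \<open>Scaling makes the defect at \<open>z\<close> equal to \<open>1\<close>; the scaled
  function then satisfies the hypothesis of \<open>green_least\<close> and is a finite
  bound.\<close>

lemma transient_if_supersolution:
  fixes Q :: "'s::countable \<Rightarrow> 's \<Rightarrow> real"
  assumes neg: "\<And>i. Q i i < 0" and nonneg: "\<And>i k. k \<noteq> i \<Longrightarrow> Q i k \<ge> 0"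
    and f: "\<And>k. f k \<ge> 0"
    and sum: "\<And>i. ((\<lambda>k. Q i k * f k) has_sum s i) (UNIV - {i})"
    and super: "\<And>i. i \<noteq> z \<Longrightarrow> s i \<le> - Q i i * f i" and strict: "s z < - Q z z * f z"
  shows "green Q z z \<noteq> \<infinity>"
proof -
  define C where "C = 1 / (- Q z z * f z - s z)"
  have C: "C > 0" using strict by (simp add: C_def)
  have s_nn: "s i \<ge> 0" for i
    using sum[of i] by (rule has_sum_nonneg) (use nonneg f in auto)
  have "green Q z z \<le> ennreal (C * f z)"
  proof (rule green_least[where g="\<lambda>i. ennreal (C * f i)", OF neg])
    fix i
    have "(\<integral>\<^sup>+k. ennreal (Q i k) * ennreal (C * f k) \<partial>count_space (UNIV - {i}))
       = (\<integral>\<^sup>+k. ennreal (C * (Q i k * f k)) \<partial>count_space (UNIV - {i}))"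
    proof (intro nn_integral_cong)
      fix k assume "k \<in> space (count_space (UNIV - {i}))"
      then have "ennreal (Q i k) * ennreal (C * f k) = ennreal (Q i k * (C * f k))"
        using nonneg[of k i] f[of k] C by (intro ennreal_mult[symmetric]) auto
      then show "ennreal (Q i k) * ennreal (C * f k) = ennreal (C * (Q i k * f k))"
        by (simp add: mult.left_commute)
    qed
    also have "\<dots> = ennreal (C * s i)"
      by (rule nn_integral_count_space_eq_has_sum[OF has_sum_cmult_right[OF sum]])
         (use nonneg f C in auto)
    finally have 1: "(\<integral>\<^sup>+k. ennreal (Q i k) * ennreal (C * f k) \<partial>count_space (UNIV - {i})) = ennreal (C * s i)" .
    have 2: "(if i = z then 1 else 0) + C * s i \<le> - Q i i * (C * f i)"
    proof (cases "i = z")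
      case True
      have "C * (- Q z z * f z - s z) = 1" using strict by (simp add: C_def)
      then show ?thesis using True by (simp add: algebra_simps)
    next
      case False
      have "C * s i \<le> C * (- Q i i * f i)" using super[OF False] C by (intro mult_left_mono) auto
      then show ?thesis using False by (simp add: algebra_simps)
    qed
    have "(if i = z then 1 else 0) + ennreal (C * s i) = ennreal ((if i = z then 1 else 0) + C * s i)"
      using C s_nn by (simp add: ennreal_plus)
    also have "\<dots> \<le> ennreal (- Q i i * (C * f i))" by (rule ennreal_leI[OF 2])
    also have "\<dots> = ennreal (- Q i i) * ennreal (C * f i)"
      using neg[of i] f C by (intro ennreal_mult) auto
    finally show "(if i = z then 1 else 0) + (\<integral>\<^sup>+k. ennreal (Q i k) * ennreal (C * f k) \<partial>count_space (UNIV - {i}))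
        \<le> ennreal (- Q i i) * ennreal (C * f i)"
      unfolding 1 .
  qed
  then show ?thesis by (auto simp: top_unique)
qed

lemma ex_pos_if_has_sum_pos:
  fixes f :: "'a \<Rightarrow> real"
  assumes "(f has_sum s) X" "s > 0"
  shows "\<exists>x\<in>X. f x > 0"
proof (rule ccontr)
  assume "\<not> ?thesis"
  then have "s \<le> 0" by (intro has_sum_le_finite_sums[OF assms(1)] sum_nonpos) (auto simp: not_less)
  with assms(2) show False by simp
qed

lemma has_sum_single_term:
  assumes "\<And>x. x \<noteq> k \<Longrightarrow> f x = 0"
  shows "(f has_sum f k) UNIV"
  using has_sum_cong_neutral[of UNIV "{k}" f f "f k"] has_sum_finite[of "{k}" f] assms by auto

lemma has_sum_sum:
  fixes f :: "'i \<Rightarrow> 'a \<Rightarrow> real"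
  assumes "\<And>i. i \<in> F \<Longrightarrow> (f i has_sum s i) X"
  shows "((\<lambda>x. \<Sum>i\<in>F. f i x) has_sum (\<Sum>i\<in>F. s i)) X"
  using assms by (induction F rule: infinite_finite_induct) (auto intro: has_sum_add)

lemma has_sum_vpow_shift:
  fixes i :: "nat^'n"
  assumes "(\<lambda>m. \<bar>c m\<bar>) summable_on UNIV" "u \<in> {0..1}"
  shows "((\<lambda>j. (if i \<le> j then c (j - i) else 0) * vpow u j) has_sum (vpow u i * genfun c u)) UNIV"
proof -
  have "((\<lambda>m. vpow u i * (c m * vpow u m)) has_sum (vpow u i * genfun c u)) UNIV"
    unfolding genfun_vpow by (intro has_sum_cmult_right has_sum_infsum summable_on_vpow assms)
  also have "(\<lambda>m. vpow u i * (c m * vpow u m)) =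
      (\<lambda>j. (if i \<le> j then c (j - i) else 0) * vpow u j) \<circ> (\<lambda>m. i + m)"
    by (auto simp: fun_eq_iff vpow_add less_eq_vec_def)
  finally have "((\<lambda>j. (if i \<le> j then c (j - i) else 0) * vpow u j) has_sum (vpow u i * genfun c u)) (range (\<lambda>m. i + m))"
    by (rule has_sum_reindex[THEN iffD2, rotated]) (auto simp: inj_on_def)
  also have "range (\<lambda>m. i + m) = {j. i \<le> j}"
  proof (intro equalityI subsetI)
    fix j assume "j \<in> {j. i \<le> j}"
    then have "j = i + (j - i)" by (auto simp: vec_eq_iff less_eq_vec_def)
    then show "j \<in> range (\<lambda>m. i + m)" by blast
  qed (auto simp: less_eq_vec_def)
  finally show ?thesis
    by (rule has_sum_cong_neutral[THEN iffD1, rotated -1]) auto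
qed

lemma genfun_split:
  assumes "(\<lambda>m. \<bar>c m\<bar>) summable_on UNIV" "u \<in> {0..1}"
  shows "genfun c u = genfun (\<lambda>m. if m = k then 0 else c m) u + c k * vpow u k"
proof -
  have *: "(\<lambda>m. \<bar>if m = k then 0 else c m\<bar>) summable_on UNIV"
    by (rule summable_on_comparison_test[OF assms(1)]) auto
  have "((\<lambda>m. (if m = k then 0 else c m) * vpow u m + (if m = k then c k * vpow u k else 0))
      has_sum (genfun (\<lambda>m. if m = k then 0 else c m) u + c k * vpow u k)) UNIV"
    unfolding genfun_vpow
    by (intro has_sum_add has_sum_infsum summable_on_vpow * assms)
       (use has_sum_single_term[of k "\<lambda>m. if m = k then c k * vpow u k else 0"] in auto)
  also have "(\<lambda>m. (if m = k then 0 else c m) * vpow u m + (if m = k then c k * vpow u k else 0)) = (\<lambda>m. c m * vpow u m)"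
    by auto
  finally show ?thesis unfolding genfun_vpow[of c] by (rule infsumI)
qed

lemma abs_summable_nonneg_except:
  fixes f :: "'a \<Rightarrow> real"
  assumes "(f has_sum s) (UNIV - {k})" "\<And>m. m \<noteq> k \<Longrightarrow> f m \<ge> 0"
  shows "(\<lambda>m. \<bar>f m\<bar>) summable_on UNIV"
    and "((\<lambda>m. if m = k then 0 else f m) has_sum s) UNIV"
proof -
  show *: "((\<lambda>m. if m = k then 0 else f m) has_sum s) UNIV"
    by (rule has_sum_cong_neutral[THEN iffD1, rotated -1, OF assms(1)]) auto
  have "((\<lambda>m. (if m = k then 0 else f m) + (if m = k then \<bar>f k\<bar> else 0)) has_sum (s + \<bar>f k\<bar>)) UNIV"
    by (intro has_sum_add *)
       (use has_sum_single_term[of k "\<lambda>m. if m = k then \<bar>f k\<bar> else 0"] in auto)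
  moreover have "(\<lambda>m. (if m = k then 0 else f m) + (if m = k then \<bar>f k\<bar> else 0)) = (\<lambda>m. \<bar>f m\<bar>)"
    using assms(2) by auto
  ultimately show "(\<lambda>m. \<bar>f m\<bar>) summable_on UNIV" by (auto simp: summable_on_def)
qed

section \<open>The q-matrix and its action on monomials\<close>

locale nTBI =
  fixes Q :: "nat^'n \<Rightarrow> nat^'n \<Rightarrow> real" and h a :: "nat^'n \<Rightarrow> real" and b :: "'n \<Rightarrow> nat^'n \<Rightarrow> real"
  assumes nTBI: "is_nTBI_qmatrix Q h a b"
begin

text \<open>\<open>B k u = R k u - c k * u $ k\<close>, where \<open>R k\<close> is a power series
  with nonnegative coefficients \<open>p k\<close> of total mass \<open>c k\<close>. Monotonicity
  arguments concern \<open>R k\<close>; in the flow the linear term is absorbed by the factor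
  \<open>exp (- c k * t)\<close>.\<close>

definition c :: "'n \<Rightarrow> real" where "c k = - b k (axis k 1)"

definition p :: "'n \<Rightarrow> nat^'n \<Rightarrow> real" where "p k m = (if m = axis k 1 then 0 else b k m)"

definition R :: "'n \<Rightarrow> real^'n \<Rightarrow> real" where "R k = genfun (p k)"

abbreviation B :: "'n \<Rightarrow> real^'n \<Rightarrow> real" where "B k \<equiv> genfun (b k)"

abbreviation A :: "real^'n \<Rightarrow> real" where "A \<equiv> genfun a"

lemma h: "\<And>j. j \<noteq> 0 \<Longrightarrow> h j \<ge> 0" "h 0 < 0" "(h has_sum (- h 0)) (UNIV - {0})"
  and a: "\<And>j. j \<noteq> 0 \<Longrightarrow> a j \<ge> 0" "a 0 < 0" "(a has_sum (- a 0)) (UNIV - {0})"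
  and b: "\<And>k j. j \<noteq> axis k 1 \<Longrightarrow> b k j \<ge> 0" "\<And>k. b k (axis k 1) < 0"
    "\<And>k. (b k has_sum (- b k (axis k 1))) (UNIV - {axis k 1})"
  and Q: "Q i j = (if i = 0 then h j
         else (\<Sum>k\<in>UNIV. real (i $ k) *
                 (if i \<le> j + axis k 1 then b k (j + axis k 1 - i) else 0))
              + (if i \<le> j then a (j - i) else 0))"
  using nTBI unfolding is_nTBI_qmatrix_def by blast+

lemmas a_summable = abs_summable_nonneg_except(1)[OF a(3,1)]
lemmas b_summable = abs_summable_nonneg_except(1)[OF b(3) b(1)]

lemma c_pos: "c k > 0" and p_nonneg: "p k m \<ge> 0" and p_has_sum: "(p k has_sum c k) UNIV"
  using b abs_summable_nonneg_except(2)[OF b(3)[of k] b(1)[of _ k]] by (auto simp: c_def p_def[abs_def])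

lemma p_summable: "(\<lambda>m. \<bar>p k m\<bar>) summable_on UNIV"
  using p_has_sum[of k] p_nonneg by (auto simp: summable_on_def)

lemma B_eq: "u \<in> {0..1} \<Longrightarrow> B k u = R k u - c k * u $ k"
  using genfun_split[OF b_summable[of k], of u "axis k 1"] by (simp add: R_def p_def[abs_def] c_def)

lemma R_has_sum: "u \<in> {0..1} \<Longrightarrow> ((\<lambda>m. p k m * vpow u m) has_sum R k u) UNIV"
  unfolding R_def genfun_vpow by (intro has_sum_infsum summable_on_vpow p_summable)

lemma R_one [simp]: "R k 1 = c k"
  using R_has_sum[of 1 k] p_has_sum[of k] by (auto intro: has_sum_unique)

lemma B_one [simp]: "B k 1 = 0"
  by (simp add: B_eq)

lemma R_nonneg: "u \<in> {0..1} \<Longrightarrow> R k u \<ge> 0"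
  by (rule has_sum_nonneg[OF R_has_sum]) (auto intro!: mult_nonneg_nonneg p_nonneg vpow_nonneg)

lemma R_mono: "0 \<le> u \<Longrightarrow> u \<le> v \<Longrightarrow> v \<le> 1 \<Longrightarrow> R k u \<le> R k v"
  by (rule has_sum_mono[OF R_has_sum R_has_sum]) (auto intro!: mult_left_mono p_nonneg vpow_mono)

lemma R_le: "u \<in> {0..1} \<Longrightarrow> R k u \<le> c k"
  using R_mono[of u 1 k] by simp

lemma continuous_on_R: "continuous_on {0..1} (R k)"
  unfolding R_def by (rule continuous_on_genfun[OF p_summable])

lemma continuous_on_B: "continuous_on {0..1} (B k)"
  by (rule continuous_on_genfun[OF b_summable])

lemma continuous_on_A: "continuous_on {0..1} A"
  by (rule continuous_on_genfun[OF a_summable])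

lemma R_zero: "R k 0 = b k 0"
proof -
  have "((\<lambda>m. p k m * vpow 0 m) has_sum p k 0) UNIV"
    using has_sum_single_term[of 0 "\<lambda>m. p k m * vpow 0 m"] by (auto simp: vpow_zero_left)
  with R_has_sum[of 0 k] have "R k 0 = p k 0" by (auto intro: has_sum_unique)
  then show ?thesis by (auto simp: p_def vec_eq_iff axis_def)
qed

lemma p_zero_pos: "B k 0 > 0 \<Longrightarrow> p k 0 > 0"
  by (simp add: B_eq R_zero p_def vec_eq_iff axis_def)

lemma ex_h_pos: "\<exists>m. m \<noteq> 0 \<and> h m > 0" and ex_a_pos: "\<exists>m. m \<noteq> 0 \<and> a m > 0"
  using ex_pos_if_has_sum_pos[OF h(3)] ex_pos_if_has_sum_pos[OF a(3)] h(2) a(2) by auto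

lemma A_one [simp]: "A 1 = 0"
  using genfun_split[OF a_summable, of 1 0] abs_summable_nonneg_except(2)[OF a(3,1)]
  by (simp add: genfun_vpow infsumI)

lemma A_nonpos: "u \<in> {0..1} \<Longrightarrow> A u \<le> 0"
proof -
  assume u: "u \<in> {0..1}"
  have *: "((\<lambda>m. if m = 0 then 0 else a m) has_sum - a 0) UNIV"
    by (rule abs_summable_nonneg_except(2)[OF a(3,1)])
  then have "(\<lambda>m. \<bar>if m = 0 then 0 else a m\<bar>) summable_on UNIV"
    using a(1) by (auto simp: summable_on_def cong: if_cong)
  from has_sum_infsum[OF summable_on_vpow[OF this u]] *
  have "genfun (\<lambda>m. if m = 0 then 0 else a m) u \<le> - a 0"
    unfolding genfun_vpow
    by (rule has_sum_mono) (use a(1) vpow_le_one[OF u] in \<open>auto intro: mult_left_le\<close>)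
  then show ?thesis using genfun_split[OF a_summable u, of 0] by simp
qed

lemma Q_genfun:
  assumes i: "i \<noteq> 0" and u: "u \<in> {0..1}"
  shows "((\<lambda>j. Q i j * vpow u j) has_sum
    ((\<Sum>k\<in>UNIV. real (i $ k) * vpow u (i - axis k 1) * B k u) + vpow u i * A u)) UNIV"
proof -
  have *: "((\<lambda>j. real (i $ k) * ((if i \<le> j + axis k 1 then b k (j + axis k 1 - i) else 0) * vpow u j))
    has_sum (real (i $ k) * (vpow u (i - axis k 1) * B k u))) UNIV" for k
  proof (cases "i $ k = 0")
    case False
    \<comment> \<open>Since \<open>i $ k \<noteq> 0\<close>, the subtraction
      \<open>i - axis k 1\<close> is not truncated, and the branching term is a plain shift by that
      vector.\<close>
    have "(if i \<le> j + axis k 1 then b k (j + axis k 1 - i) else 0) =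
      (if i - axis k 1 \<le> j then b k (j - (i - axis k 1)) else 0)" for j
    proof -
      have "i \<le> j + axis k 1 \<longleftrightarrow> i - axis k 1 \<le> j"
        by (simp add: less_eq_vec_def le_diff_conv)
      moreover have "j + axis k 1 - i = j - (i - axis k 1)"
        using False by (auto simp: vec_eq_iff axis_def)
      ultimately show ?thesis by simp
    qed
    note eq = this
    show ?thesis
      unfolding eq by (intro has_sum_cmult_right has_sum_vpow_shift b_summable u)
  qed simp
  have "((\<lambda>j. (\<Sum>k\<in>UNIV. real (i $ k) * ((if i \<le> j + axis k 1 then b k (j + axis k 1 - i) else 0) * vpow u j))
      + (if i \<le> j then a (j - i) else 0) * vpow u j) has_sum
    ((\<Sum>k\<in>UNIV. real (i $ k) * (vpow u (i - axis k 1) * B k u)) + vpow u i * A u)) UNIV"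
    by (intro has_sum_add has_sum_sum * has_sum_vpow_shift a_summable u)
  moreover have "(\<lambda>j. Q i j * vpow u j) = (\<lambda>j. (\<Sum>k\<in>UNIV. real (i $ k) * ((if i \<le> j + axis k 1 then b k (j + axis k 1 - i) else 0) * vpow u j))
      + (if i \<le> j then a (j - i) else 0) * vpow u j)"
    using i by (simp add: Q ring_distribs sum_distrib_right mult.assoc fun_eq_iff)
  ultimately show ?thesis by (simp add: mult.assoc)
qed

lemma Q_neg: "Q i i < 0"
proof (cases "i = 0")
  case False
  have "Q i i = (\<Sum>k\<in>UNIV. real (i $ k) * b k (axis k 1)) + a 0"
    using False by (simp add: Q less_eq_vec_def)
  moreover have "(\<Sum>k\<in>UNIV. real (i $ k) * b k (axis k 1)) \<le> 0"
    by (intro sum_nonpos mult_nonneg_nonpos) (use b(2) in \<open>auto intro: less_imp_le\<close>)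
  ultimately show ?thesis using a(2) by simp
qed (simp add: Q h)

lemma Q_nonneg: "k \<noteq> i \<Longrightarrow> Q i k \<ge> 0"
proof (cases "i = 0")
  case False
  assume "k \<noteq> i"
  have "(if i \<le> k + axis l 1 then b l (k + axis l 1 - i) else 0) \<ge> 0" for l
  proof (cases "i \<le> k + axis l 1 \<and> k + axis l 1 - i = axis l 1")
    case True
    have "k $ j = i $ j" for j
    proof -
      have "i $ j \<le> (k + axis l 1) $ j" "(k + axis l 1 - i) $ j = axis l 1 $ j"
        using True by (auto simp: less_eq_vec_def)
      then show ?thesis by simp
    qed
    then have "k = i" by (simp add: vec_eq_iff)
    with \<open>k \<noteq> i\<close> show ?thesis by simp
  qed (use b(1) in auto)
  moreover have "(if i \<le> k then a (k - i) else 0) \<ge> 0"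
  proof (cases "i \<le> k \<and> k - i = 0")
    case True
    then have "k = i" by (auto simp: vec_eq_iff less_eq_vec_def intro: antisym)
    with \<open>k \<noteq> i\<close> show ?thesis by simp
  qed (use a(1) in auto)
  ultimately show ?thesis
    using False by (auto simp: Q intro!: add_nonneg_nonneg sum_nonneg mult_nonneg_nonneg)
qed (use h in \<open>auto simp: Q\<close>)

lemma Q_vpow_off_diagonal:
  assumes i: "i \<noteq> 0" and u: "u \<in> {0..1}"
  shows "((\<lambda>j. Q i j * vpow u j) has_sum
    ((\<Sum>k\<in>UNIV. real (i $ k) * vpow u (i - axis k 1) * B k u) + vpow u i * A u
      + (- Q i i) * vpow u i)) (UNIV - {i})"
proof -
  have "((\<lambda>j. Q i j * vpow u j) has_sum (Q i i * vpow u i)) {i}"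
    using has_sum_finite[of "{i}" "\<lambda>j. Q i j * vpow u j"] by simp
  from has_sum_Diff[OF Q_genfun[OF assms] this] show ?thesis by simp
qed

text \<open>For \<open>i \<noteq> 0\<close> this is the monomial formula at \<open>u = 1\<close>,
  where \<open>A\<close> and all \<open>B k\<close> vanish.\<close>

lemma Q_conservative: "(Q i has_sum - Q i i) (UNIV - {i})"
proof (cases "i = 0")
  case True
  then have "Q i = h" by (auto simp: Q fun_eq_iff)
  then show ?thesis using h(3) True by simp
next
  case False
  from Q_vpow_off_diagonal[OF this, of 1] show ?thesis by simp
qed

end

section \<open>The mean matrix\<close>

lemma matrix_pow_commute: "matrix_pow M m ** M = M ** matrix_pow M m"
  by (induction m) (simp_all add: matrix_mul_assoc[symmetric])

lemma matrix_pow_vector_Suc: "matrix_pow M (Suc m) *v x = matrix_pow M m *v (M *v x)"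
  by (simp add: matrix_vector_mul_assoc matrix_pow_commute)

lemma matrix_pow_nonneg:
  fixes M :: "real^'n^'n"
  assumes "\<And>i j. M $ i $ j \<ge> 0" shows "matrix_pow M m $ i $ j \<ge> 0"
  using assms by (induction m arbitrary: i j)
    (auto simp: mat_def matrix_matrix_mult_def intro!: sum_nonneg mult_nonneg_nonneg)

lemma matrix_pow_superharmonic:
  fixes M :: "real^'n^'n"
  assumes "\<And>i j. M $ i $ j \<ge> 0" "\<And>i. (M *v x) $ i \<le> x $ i"
  shows "(matrix_pow M m *v x) $ i \<le> x $ i"
proof (induction m arbitrary: i)
  case (Suc m)
  have "(matrix_pow M (Suc m) *v x) $ i \<le> (matrix_pow M m *v x) $ i"
    unfolding matrix_pow_vector_Suc by (intro matrix_vector_mult_mono matrix_pow_nonneg assms)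
  with Suc[of i] show ?case by simp
qed simp

locale nTBI_mean = nTBI Q h a b
  for Q :: "nat^'n \<Rightarrow> nat^'n \<Rightarrow> real" and h a b +
  assumes finite_mean: "finite_mean_matrix b" and pos_regular: "positively_regular (Gmat b 1)"
begin

definition mu :: "'n \<Rightarrow> 'n \<Rightarrow> real" where "mu k l = (\<Sum>\<^sub>\<infinity>m. p k m * real (m $ l))"

abbreviation G :: "real^'n^'n" where "G \<equiv> Gmat b 1"

lemma mu_and_Bmat:
  shows mu_has_sum: "((\<lambda>m. p k m * real (m $ l)) has_sum mu k l) UNIV"
    and Bmat_one: "Bmat b 1 $ k $ l = mu k l - (if k = l then c k else 0)"
proof -
  define D where "D = partial_deriv (B k) l 1"
  \<comment> \<open>Only coordinate \<open>l\<close> varies on the slice, so the linear part of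
    \<open>B k\<close> is \<open>- c k * s\<close> if \<open>k = l\<close> and the constant
    \<open>- c k\<close> otherwise. Added back, it leaves a one-variable series with nonnegative
    coefficients, to which \<open>has_sum_derivative_at_one\<close> applies.\<close>
  have eq: "slice (B k) l 1 s + (if k = l then c k else 0) * s + (if k = l then 0 else c k) = (\<Sum>\<^sub>\<infinity>m. p k m * s ^ (m $ l))"
    if "s \<in> {0..1}" for s
  proof -
    let ?u = "(\<chi> l'. if l' = l then s else 1 $ l') :: real^'n"
    have "?u \<in> {0..1}" using that by (auto simp: less_eq_vec_def)
    moreover have "vpow ?u m = s ^ (m $ l)" for m
    proof -
      have "vpow ?u m = (\<Prod>l'\<in>UNIV. if l' = l then s ^ (m $ l) else 1)"
        unfolding vpow_def by (intro prod.cong) auto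
      then show ?thesis by simp
    qed
    ultimately have "B k ?u = (\<Sum>\<^sub>\<infinity>m. p k m * s ^ (m $ l)) - c k * ?u $ k"
      unfolding B_eq[OF \<open>?u \<in> {0..1}\<close>] R_def genfun_vpow[of "p k"] by simp
    then show ?thesis
      unfolding slice_def by simp
  qed
  have "(slice (B k) l 1 has_real_derivative D) (at 1 within {0..1})"
  proof -
    have "slice (B k) l 1 differentiable (at 1 within {0..1})"
      using finite_mean by (simp add: finite_mean_matrix_def partial_differentiable_def)
    then have "(slice (B k) l 1 has_vector_derivative D) (at 1 within {0..1})"
      unfolding D_def partial_deriv_def using vector_derivative_works by force
    then show ?thesis by (simp add: has_real_derivative_iff_has_vector_derivative)
  qed
  then have "((\<lambda>s. slice (B k) l 1 s + (if k = l then c k else 0) * s + (if k = l then 0 else c k))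
      has_real_derivative (D + (if k = l then c k else 0))) (at 1 within {0..1})"
    by (auto intro!: derivative_eq_intros)
  then have "((\<lambda>s. \<Sum>\<^sub>\<infinity>m. p k m * s ^ (m $ l)) has_real_derivative (D + (if k = l then c k else 0))) (at 1 within {0..1})"
    by (rule has_field_derivative_transform_within[where d=1]) (use eq in auto)
  moreover have "p k summable_on UNIV" using p_has_sum[of k] by (auto simp: summable_on_def)
  ultimately have *: "((\<lambda>m. p k m * real (m $ l)) has_sum (D + (if k = l then c k else 0))) UNIV"
    by (intro has_sum_derivative_at_one[OF p_nonneg])
  then have "mu k l = D + (if k = l then c k else 0)"
    by (simp add: mu_def infsumI)
  with * show "((\<lambda>m. p k m * real (m $ l)) has_sum mu k l) UNIV"
    and "Bmat b 1 $ k $ l = mu k l - (if k = l then c k else 0)"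
    by (simp_all add: Bmat_def D_def)
qed

lemma mu_nonneg: "mu k l \<ge> 0"
  by (rule has_sum_nonneg[OF mu_has_sum]) (use p_nonneg in auto)

lemma Gmat_one: "G $ k $ l = mu k l / c k"
  using c_pos[of k] by (simp add: Gmat_def Bmat_one c_def divide_simps)

lemma G_nonneg: "G $ k $ l \<ge> 0"
  unfolding Gmat_one using mu_nonneg c_pos[of k] by simp

lemma c_G: "c k * (G *v x) $ k = (\<Sum>l\<in>UNIV. mu k l * x $ l)"
  using c_pos[of k] by (simp add: matrix_vector_mult_def Gmat_one sum_distrib_left)

text \<open>Translates sign conditions on \<open>Bmat b 1\<close>, which govern \<open>rho\<close>,
  into comparisons of \<open>x\<close> with \<open>G *v x\<close>; \<open>G\<close> is nonnegative
  and has a power with positive entries.\<close>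

lemma Bmat_mult: "(Bmat b 1 *v x) $ k = c k * ((G *v x) $ k - x $ k)"
proof -
  have "(Bmat b 1 *v x) $ k = (\<Sum>l\<in>UNIV. mu k l * x $ l - (if l = k then c k * x $ k else 0))"
    unfolding matrix_vector_mult_def vec_lambda_beta by (intro sum.cong) (auto simp: Bmat_one algebra_simps)
  also have "\<dots> = (\<Sum>l\<in>UNIV. mu k l * x $ l) - c k * x $ k"
    by (simp add: sum_subtractf)
  finally show ?thesis using c_G[of k x] by (simp add: algebra_simps)
qed

lemma mu_weighted_has_sum:
  "((\<lambda>m. p k m * (\<Sum>l\<in>UNIV. real (m $ l) * x l)) has_sum (\<Sum>l\<in>UNIV. mu k l * x l)) UNIV"
proof -
  have "((\<lambda>m. \<Sum>l\<in>UNIV. p k m * real (m $ l) * x l) has_sum (\<Sum>l\<in>UNIV. mu k l * x l)) UNIV"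
    by (intro has_sum_sum has_sum_cmult_left mu_has_sum)
  then show ?thesis by (simp add: sum_distrib_left mult.assoc)
qed

lemma R_lipschitz:
  assumes "u \<in> {0..1}" "v \<in> {0..1}"
  shows "\<bar>R k u - R k v\<bar> \<le> (\<Sum>l\<in>UNIV. mu k l * \<bar>u $ l - v $ l\<bar>)"
proof -
  have le: "R k u - R k v \<le> (\<Sum>l\<in>UNIV. mu k l * \<bar>u $ l - v $ l\<bar>)"
    if uv: "u \<in> {0..1}" "v \<in> {0..1}" for u v
  proof -
    have "((\<lambda>m. p k m * vpow u m + (-1) * (p k m * vpow v m)) has_sum (R k u + (-1) * R k v)) UNIV"
      by (intro has_sum_add has_sum_cmult_right R_has_sum uv)
    then have "R k u + (-1) * R k v \<le> (\<Sum>l\<in>UNIV. mu k l * \<bar>u $ l - v $ l\<bar>)"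
    proof (rule has_sum_mono[OF _ mu_weighted_has_sum])
      fix m
      have "vpow u m - vpow v m \<le> (\<Sum>l\<in>UNIV. real (m $ l) * \<bar>u $ l - v $ l\<bar>)"
        using vpow_lipschitz[OF uv, of m] by linarith
      from mult_left_mono[OF this p_nonneg[of k m]]
      show "p k m * vpow u m + (-1) * (p k m * vpow v m) \<le> p k m * (\<Sum>l\<in>UNIV. real (m $ l) * \<bar>u $ l - v $ l\<bar>)"
        by (simp add: algebra_simps)
    qed
    then show ?thesis by simp
  qed
  from le[OF assms] le[OF assms(2,1)] show ?thesis
    by (simp add: abs_le_iff abs_minus_commute)
qed

lemma B_lipschitz:
  obtains L where "L > 0" "\<And>k u v. u \<in> {0..1} \<Longrightarrow> v \<in> {0..1} \<Longrightarrow> \<bar>B k u - B k v\<bar> \<le> L * norm (u - v)"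
proof -
  define L where "L = 1 + (\<Sum>k\<in>UNIV. (\<Sum>l\<in>UNIV. mu k l) + c k)"
  have nn: "(\<Sum>l\<in>UNIV. mu k l) + c k \<ge> 0" for k
    using mu_nonneg c_pos[of k] by (intro add_nonneg_nonneg sum_nonneg) auto
  have "\<bar>B k u - B k v\<bar> \<le> L * norm (u - v)" if uv: "u \<in> {0..1}" "v \<in> {0..1}" for k u v
  proof -
    have comp: "\<bar>u $ l - v $ l\<bar> \<le> norm (u - v)" for l
      using component_le_norm_cart[of "u - v" l] by simp
    have "\<bar>B k u - B k v\<bar> \<le> \<bar>R k u - R k v\<bar> + c k * \<bar>u $ k - v $ k\<bar>"
    proof -
      have "B k u - B k v = (R k u - R k v) - c k * (u $ k - v $ k)"
        by (simp add: B_eq[OF uv(1)] B_eq[OF uv(2)] algebra_simps)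
      then show ?thesis
        using abs_triangle_ineq4[of "R k u - R k v" "c k * (u $ k - v $ k)"] c_pos[of k] by (simp add: abs_mult)
    qed
    also have "\<dots> \<le> (\<Sum>l\<in>UNIV. mu k l * norm (u - v)) + c k * norm (u - v)"
      using c_pos[of k]
      by (intro add_mono order_trans[OF R_lipschitz[OF uv]] sum_mono mult_left_mono comp mu_nonneg) auto
    also have "\<dots> = ((\<Sum>l\<in>UNIV. mu k l) + c k) * norm (u - v)"
      by (simp add: sum_distrib_right ring_distribs)
    also have "\<dots> \<le> L * norm (u - v)"
    proof (rule mult_right_mono)
      show "(\<Sum>l\<in>UNIV. mu k l) + c k \<le> L"
        unfolding L_def using member_le_sum[of k UNIV "\<lambda>k. (\<Sum>l\<in>UNIV. mu k l) + c k"] nn by simp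
    qed simp
    finally show ?thesis .
  qed
  moreover have "L > 0" unfolding L_def using sum_nonneg[of UNIV "\<lambda>k. (\<Sum>l\<in>UNIV. mu k l) + c k"] nn by simp
  ultimately show ?thesis using that by blast
qed

lemma pos_power: "\<exists>m. \<forall>i j. matrix_pow G m $ i $ j > 0"
  using pos_regular unfolding positively_regular_def by blast

text \<open>A power of \<open>G\<close> with positive entries commutes with \<open>G\<close> and
  turns the nonzero nonnegative excess \<open>G *v v - v\<close> into one that is positive in every
  coordinate.\<close>

lemma strict_excess:
  assumes v: "\<And>k. v $ k \<ge> 0" and ge: "\<And>k. v $ k \<le> (G *v v) $ k" and ne: "G *v v \<noteq> v"
  obtains w where "\<And>k. w $ k > 0" "\<And>k. w $ k < (G *v w) $ k"
proof -
  obtain m where m: "\<And>i j. matrix_pow G m $ i $ j > 0" using pos_power by blast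
  define w where "w = matrix_pow G m *v v"
  have "v \<noteq> 0" using ne by auto
  then have "w $ k > 0" for k
    unfolding w_def by (intro matrix_vector_mult_pos m v)
  moreover have "w $ k < (G *v w) $ k" for k
  proof -
    have "(matrix_pow G m *v (G *v v - v)) $ k > 0"
      by (rule matrix_vector_mult_pos[OF m]) (use ge ne in auto)
    moreover have "matrix_pow G m *v (G *v v) = G *v w"
      unfolding w_def by (simp add: matrix_vector_mul_assoc matrix_pow_commute)
    ultimately show ?thesis
      by (simp add: matrix_vector_mult_diff_distrib w_def)
  qed
  ultimately show ?thesis using that by blast
qed

lemma Bmat_off_diagonal: "i \<noteq> j \<Longrightarrow> Bmat b 1 $ i $ j \<ge> 0"
  using mu_nonneg by (simp add: Bmat_one)

lemma rho_pos_excess: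
  assumes "rho b 1 > 0"
  obtains w where "\<And>k. w $ k > 0" "\<And>k. w $ k < (G *v w) $ k"
proof -
  obtain v where v: "\<And>i. v $ i \<ge> 0" "v \<noteq> 0" "\<And>i. (Bmat b 1 *v v) $ i \<ge> rho b 1 * v $ i"
    unfolding rho_def using max_eigenvalue_subvector[OF Bmat_off_diagonal] by metis
  have ge: "v $ k \<le> (G *v v) $ k" for k
  proof -
    have "0 \<le> rho b 1 * v $ k" using assms v(1)[of k] by simp
    also have "\<dots> \<le> c k * ((G *v v) $ k - v $ k)" using v(3)[of k] by (simp add: Bmat_mult)
    finally show ?thesis using c_pos[of k] by (simp add: zero_le_mult_iff)
  qed
  obtain k where k: "v $ k \<noteq> 0" using v(2) by (auto simp: vec_eq_iff)
  have "0 < rho b 1 * v $ k" using assms v(1)[of k] k by simp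
  also have "\<dots> \<le> c k * ((G *v v) $ k - v $ k)" using v(3)[of k] by (simp add: Bmat_mult)
  finally have "G *v v \<noteq> v" by auto
  from strict_excess[OF v(1) ge this] that show ?thesis by blast
qed

text \<open>Otherwise \<open>strict_excess\<close> would yield a positive \<open>w\<close> whose
  image under \<open>Bmat b 1\<close> is at least \<open>d *\<^sub>R w\<close> for some
  \<open>d > 0\<close>, and then \<open>rho b 1 \<ge> d\<close>. Positivity follows because
  \<open>v\<close> is its own image under a positive power of \<open>G\<close>.\<close>

lemma rho_nonpos_harmonic:
  assumes rho: "rho b 1 \<le> 0" and v: "\<And>k. v $ k \<ge> 0" "v \<noteq> 0" and ge: "\<And>k. v $ k \<le> (G *v v) $ k"
  shows "G *v v = v" "\<And>k. v $ k > 0"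
proof -
  show eq: "G *v v = v"
  proof (rule ccontr)
    assume "G *v v \<noteq> v"
    from strict_excess[OF v(1) ge this] obtain w where w: "\<And>k. w $ k > 0" "\<And>k. w $ k < (G *v w) $ k" by blast
    define d where "d = (MIN k. (Bmat b 1 *v w) $ k / w $ k)"
    have pos: "(Bmat b 1 *v w) $ k > 0" for k
      using w(2)[of k] c_pos[of k] by (simp add: Bmat_mult)
    have "d > 0" unfolding d_def using pos w(1) by (subst Min_gr_iff) auto
    moreover have "d * w $ k \<le> (Bmat b 1 *v w) $ k" for k
    proof -
      have "d \<le> (Bmat b 1 *v w) $ k / w $ k" unfolding d_def by (rule Min_le) auto
      then show ?thesis using w(1)[of k] by (simp add: pos_le_divide_eq)
    qed
    moreover have "w \<noteq> 0" using w(1) by (metis less_irrefl zero_index)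
    ultimately have "d \<le> rho b 1"
      unfolding rho_def using w(1) by (intro max_eigenvalue_ge[OF Bmat_off_diagonal, of w]) (auto intro: less_imp_le)
    with \<open>d > 0\<close> rho show False by simp
  qed
  obtain m where m: "\<And>i j. matrix_pow G m $ i $ j > 0" using pos_power by blast
  have "matrix_pow G m *v v = v"
    by (induction m) (simp_all add: matrix_pow_vector_Suc eq del: matrix_pow.simps(2))
  moreover have "(matrix_pow G m *v v) $ k > 0" for k
    by (rule matrix_vector_mult_pos[OF m v])
  ultimately show "v $ k > 0" for k by simp
qed

text \<open>The linearisation of \<open>B k\<close> at \<open>1\<close> is negative in the direction
  \<open>- w\<close>. Only a finite part \<open>T\<close> of the series, chosen to carry enough of
  the mean, is differentiated; the omitted terms can only lower the value, since monomials are at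
  most \<open>1\<close>.\<close>

lemma rho_pos_subsolution:
  assumes "rho b 1 > 0"
  obtains q where "q \<in> {0..1}" "\<And>k. q $ k < 1" "\<And>k. B k q \<le> 0"
proof -
  obtain w where w: "\<And>k. w $ k > 0" "\<And>k. w $ k < (G *v w) $ k"
    using rho_pos_excess[OF assms] by blast
  define u where "u e = (1 - e *\<^sub>R w :: real^'n)" for e
  have "\<forall>\<^sub>F e in at_right 0. u e \<in> {0..1}"
  proof -
    have "\<forall>\<^sub>F e in at_right 0. e * w $ k \<le> 1" for k
    proof -
      have "((\<lambda>e. e * w $ k) \<longlongrightarrow> 0 * w $ k) (at_right 0)" by (intro tendsto_intros)
      then have "\<forall>\<^sub>F e in at_right 0. e * w $ k < 1" by (rule order_tendstoD) simp
      then show ?thesis by eventually_elim simp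
    qed
    then have "\<forall>\<^sub>F e in at_right 0. \<forall>k. e * w $ k \<le> 1" by (rule eventually_all_finite)
    then show ?thesis
      using eventually_at_right_less[of 0]
      by eventually_elim (use w(1) in \<open>auto simp: u_def less_eq_vec_def intro!: mult_nonneg_nonneg less_imp_le\<close>)
  qed
  moreover have "\<forall>\<^sub>F e in at_right 0. u e \<in> {0..1} \<longrightarrow> B k (u e) \<le> 0" for k
  proof -
    define s where "s m = (\<Sum>l\<in>UNIV. real (m $ l) * w $ l)" for m
    have hs: "((\<lambda>m. p k m * s m) has_sum (c k * (G *v w) $ k)) UNIV"
      unfolding c_G s_def by (rule mu_weighted_has_sum)
    have "\<exists>T. finite T \<and> c k * w $ k < (\<Sum>m\<in>T. p k m * s m)"
    proof (rule ccontr)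
      assume "\<not> ?thesis"
      then have "c k * (G *v w) $ k \<le> c k * w $ k"
        by (intro has_sum_le_finite_sums[OF hs]) (auto simp: not_less)
      with w(2)[of k] c_pos[of k] show False by simp
    qed
    then obtain T where T: "finite T" "c k * w $ k < (\<Sum>m\<in>T. p k m * s m)" by blast
    \<comment> \<open>An upper bound for \<open>B k (u e)\<close> that vanishes at \<open>0\<close>
      and, by the choice of \<open>T\<close>, has a negative derivative there.\<close>
    define \<phi> where "\<phi> e = (\<Sum>m\<in>T. p k m * (vpow (u e) m - 1)) + c k * e * w $ k" for e
    have "((\<lambda>e. vpow (u e) m) has_real_derivative (\<Sum>l\<in>UNIV. real (m $ l) * vpow (u 0) (m - axis l 1) * (- w $ l))) (at 0)" for m
      by (rule has_real_derivative_vpow) (auto simp: u_def intro!: derivative_eq_intros)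
    then have dv: "((\<lambda>e. vpow (u e) m) has_real_derivative - s m) (at 0)" for m
      by (simp add: u_def s_def sum_negf)
    have "(\<phi> has_real_derivative ((\<Sum>m\<in>T. p k m * (- s m)) + c k * w $ k)) (at 0)"
      unfolding \<phi>_def by (auto intro!: derivative_eq_intros dv sum.cong)
    from DERIV_neg_dec_right[OF this] T(2)
    obtain d where d: "d > 0" "\<And>e. 0 < e \<Longrightarrow> e < d \<Longrightarrow> \<phi> e < \<phi> 0"
      by (auto simp: sum_negf)
    have "\<phi> 0 = 0" by (simp add: \<phi>_def u_def)
    have "B k (u e) \<le> 0" if e: "0 < e" "e < d" "u e \<in> {0..1}" for e
    proof -
      have "((\<lambda>m. p k m * 1 + (-1) * (p k m * vpow (u e) m)) has_sum (c k * 1 + (-1) * R k (u e))) UNIV"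
        by (intro has_sum_add has_sum_cmult_right has_sum_cmult_left R_has_sum e p_has_sum)
      from finite_sum_le_has_sum[OF this T(1)] have "(\<Sum>m\<in>T. p k m * 1 + (-1) * (p k m * vpow (u e) m)) \<le> c k - R k (u e)"
        using p_nonneg vpow_le_one[OF e(3)] by (auto intro!: mult_left_le)
      moreover have "(\<Sum>m\<in>T. p k m * 1 + (-1) * (p k m * vpow (u e) m)) = - (\<Sum>m\<in>T. p k m * (vpow (u e) m - 1))"
        by (simp add: sum_negf[symmetric] algebra_simps)
      ultimately have "R k (u e) \<le> c k + (\<Sum>m\<in>T. p k m * (vpow (u e) m - 1))" by simp
      also have "\<dots> \<le> c k - c k * e * w $ k"
        using d(2)[OF e(1,2)] \<open>\<phi> 0 = 0\<close> by (simp add: \<phi>_def)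
      also have "\<dots> = c k * u e $ k" by (simp add: u_def algebra_simps)
      finally show ?thesis by (simp add: B_eq[OF e(3)])
    qed
    then show ?thesis
      unfolding eventually_at_right_field using d(1) by (intro exI[of _ d]) auto
  qed
  then have "\<forall>\<^sub>F e in at_right 0. \<forall>k. u e \<in> {0..1} \<longrightarrow> B k (u e) \<le> 0"
    by (rule eventually_all_finite)
  ultimately have "\<forall>\<^sub>F e in at_right 0. u e \<in> {0..1} \<and> (\<forall>k. B k (u e) \<le> 0) \<and> e > 0"
    using eventually_at_right_less[of 0] by eventually_elim auto
  then obtain e where "u e \<in> {0..1}" "\<forall>k. B k (u e) \<le> 0" "e > 0"
    using eventually_happens'[OF trivial_limit_at_right_real] by blast
  with w(1) show ?thesis by (intro that[of "u e"]) (auto simp: u_def)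
qed

end

section \<open>Common zeros of the branching functions\<close>

context nTBI_mean
begin

text \<open>Bernoulli's inequality gives \<open>v \<le> G v\<close> for \<open>v = 1 - q\<close>,
  and \<open>rho b 1 \<le> 0\<close> turns this into an equality. Strict Bernoulli then rules out
  two or more children per individual. What remains is a substochastic \<open>G\<close> that loses
  mass at \<open>one\<close>, and a maximum principle excludes a positive harmonic
  \<open>v\<close>.\<close>

lemma no_fixed_point_below_one:
  assumes rho: "rho b 1 \<le> 0" and one: "B one 0 > 0"
    and q: "q \<in> {0..1}" "\<And>k. B k q = 0"
  shows "q = 1"
proof (rule ccontr)
  assume "q \<noteq> 1"
  define v where "v = 1 - q"
  have v: "v $ k \<ge> 0" "v \<noteq> 0" for k
    using cubeD(2)[OF q(1), of k] \<open>q \<noteq> 1\<close> by (auto simp: v_def)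
  have Rq: "R k q = c k - c k * v $ k" for k
    using q(2)[of k] by (simp add: B_eq[OF q(1)] v_def algebra_simps)
  have bern: "p k m * (vpow q m - 1 + (\<Sum>l\<in>UNIV. real (m $ l) * v $ l)) \<ge> 0" for k m
    using vpow_bernoulli[OF q(1), of m] p_nonneg[of k m] by (intro mult_nonneg_nonneg) (auto simp: v_def)
  have hs: "((\<lambda>m. p k m * (vpow q m - 1 + (\<Sum>l\<in>UNIV. real (m $ l) * v $ l))) has_sum
      (c k * ((G *v v) $ k - v $ k))) UNIV" for k
  proof -
    have "((\<lambda>m. p k m * vpow q m + (-1) * p k m + p k m * (\<Sum>l\<in>UNIV. real (m $ l) * v $ l)) has_sum
        (R k q + (-1) * c k + (\<Sum>l\<in>UNIV. mu k l * v $ l))) UNIV"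
      by (intro has_sum_add has_sum_cmult_right R_has_sum q p_has_sum mu_weighted_has_sum)
    moreover have "R k q + (-1) * c k + (\<Sum>l\<in>UNIV. mu k l * v $ l) = c k * ((G *v v) $ k - v $ k)"
      by (simp add: Rq c_G right_diff_distrib)
    moreover have "(\<lambda>m. p k m * vpow q m + (-1) * p k m + p k m * (\<Sum>l\<in>UNIV. real (m $ l) * v $ l))
       = (\<lambda>m. p k m * (vpow q m - 1 + (\<Sum>l\<in>UNIV. real (m $ l) * v $ l)))"
      by (simp add: fun_eq_iff ring_distribs)
    ultimately show ?thesis by (simp only:)
  qed
  have ge: "v $ k \<le> (G *v v) $ k" for k
    using has_sum_nonneg[OF hs[of k] bern] c_pos[of k] by (simp add: zero_le_mult_iff)
  note Gv = rho_nonpos_harmonic[OF rho v ge]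
  have q1: "q $ k < 1" for k using Gv(2)[of k] by (simp add: v_def)
  \<comment> \<open>The terms in \<open>hs\<close> are nonnegative and by harmonicity their sum is
    \<open>0\<close>; degree two or more would make the bracket positive.\<close>
  have small: "m = 0 \<or> (\<exists>l. m = axis l 1)" if "p k m \<noteq> 0" for k m
  proof (rule ccontr)
    assume *: "\<not> (m = 0 \<or> (\<exists>l. m = axis l 1))"
    then have "m \<noteq> 0" by blast
    then obtain l where "m $ l \<noteq> 0" unfolding vec_eq_iff by auto
    then have m: "m = axis l 1 + (m - axis l 1)" by (rule axis_decompose)
    have "m \<noteq> axis l 1" using * by blast
    then have "m - axis l 1 \<noteq> 0" using m by (metis add.right_neutral)
    from vpow_bernoulli_strict[OF q(1) q1 this, of l]
    have "vpow q m - 1 + (\<Sum>l\<in>UNIV. real (m $ l) * v $ l) > 0"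
      unfolding m[symmetric] by (simp add: v_def)
    moreover have "p k m * (vpow q m - 1 + (\<Sum>l\<in>UNIV. real (m $ l) * v $ l)) = 0"
      using nonneg_has_sum_le_0D[OF hs[of k] _ bern, of m] Gv(1) by simp
    ultimately show False using that by simp
  qed
  \<comment> \<open>With at most one child, row \<open>k\<close> of \<open>G\<close> sums to the
    probability of having a child at all.\<close>
  have G1: "(G *v 1) $ k = (c k - p k 0) / c k" for k
  proof -
    have "((\<lambda>m. p k m * (\<Sum>l\<in>UNIV. real (m $ l) * (1::real^'n) $ l)) has_sum (\<Sum>l\<in>UNIV. mu k l * (1::real^'n) $ l)) UNIV"
      by (rule mu_weighted_has_sum)
    moreover have "p k m * (\<Sum>l\<in>UNIV. real (m $ l) * (1::real^'n) $ l) = p k m + (-1) * (if m = 0 then p k 0 else 0)" for m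
    proof (cases "p k m = 0 \<or> m = 0")
      case False
      with small obtain l where "m = axis l 1" by blast
      then show ?thesis using False sum_axis[of l "\<lambda>_. 1"] by simp
    qed auto
    moreover have "((\<lambda>m. p k m + (-1) * (if m = 0 then p k 0 else 0)) has_sum (c k + (-1) * p k 0)) UNIV"
      using has_sum_single_term[of 0 "\<lambda>m::nat^'n. if m = 0 then p k 0 else 0"]
      by (intro has_sum_add p_has_sum has_sum_cmult_right) auto
    ultimately have "(\<Sum>l\<in>UNIV. mu k l * (1::real^'n) $ l) = c k + (-1) * p k 0"
      by (simp only:) (rule has_sum_unique)
    then have "(\<Sum>l\<in>UNIV. mu k l * (1::real^'n) $ l) = c k - p k 0" by linarith
    then show ?thesis using c_G[of k 1] c_pos[of k] by (simp add: field_simps)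
  qed
  have G1_le: "(G *v 1) $ k \<le> 1" for k
    using p_nonneg[of k 0] c_pos[of k] by (simp add: G1)
  have p_one: "p one 0 > 0" by (rule p_zero_pos[OF one])
  define d where "d = (MAX k. v $ k)"
  have d: "v $ k \<le> d" for k unfolding d_def by (rule Max_ge) auto
  have "d \<in> range (($) v)" unfolding d_def by (rule Max_in) auto
  then obtain k0 where k0: "v $ k0 = d" by blast
  have "d > 0" using Gv(2)[of k0] k0 by simp
  \<comment> \<open>The distance of \<open>v\<close> from its maximum. It is superharmonic and zero
    at \<open>k0\<close>; if it were nonzero, a positive power of \<open>G\<close> would make it
    positive at \<open>k0\<close>. Hence \<open>v\<close> is constant.\<close>
  define y where "y = d *\<^sub>R 1 - v"
  have y: "y $ k \<ge> 0" for k using d by (simp add: y_def)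
  have Gy: "(G *v y) $ k = d * (G *v 1) $ k - v $ k" for k
    unfolding y_def by (simp add: matrix_vector_mult_diff_distrib matrix_vector_mult_scaleR Gv(1))
  have "(G *v y) $ k \<le> y $ k" for k
    unfolding Gy using mult_left_mono[OF G1_le[of k], of d] \<open>d > 0\<close> by (simp add: y_def)
  then have super: "(matrix_pow G m *v y) $ k \<le> y $ k" for m k
    by (rule matrix_pow_superharmonic[OF G_nonneg])
  obtain m where m: "\<And>i j. matrix_pow G m $ i $ j > 0" using pos_power by blast
  have "y = 0"
  proof (rule ccontr)
    assume "y \<noteq> 0"
    from matrix_vector_mult_pos[OF m y this, of k0] super[of m k0] k0 show False by (simp add: y_def)
  qed
  then have "v $ one = d" unfolding y_def vec_eq_iff by auto
  moreover have "(G *v y) $ one = 0" using \<open>y = 0\<close> by simp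
  ultimately have "d * (G *v 1) $ one = d" using Gy[of one] by simp
  then have "(G *v 1) $ one = 1"
    using \<open>d > 0\<close> by simp
  with p_one c_pos[of one] show False by (simp add: G1 field_simps)
qed

section \<open>Irreducibility\<close>

definition reach :: "nat^'n \<Rightarrow> nat^'n \<Rightarrow> bool" where "reach = (q_edge Q)\<^sup>*\<^sup>*"

lemma reach_refl: "reach i i" and reach_trans: "reach i j \<Longrightarrow> reach j k \<Longrightarrow> reach i k"
  by (auto simp: reach_def)

text \<open>No summand of an off-diagonal entry of \<open>Q\<close> is negative, so the one for
  offspring \<open>m\<close> of type \<open>k\<close> makes the entry positive.\<close>

lemma reach_branch:
  assumes "p k m > 0"
  shows "reach (i + axis k 1) (i + m)"
proof -
  have m: "m \<noteq> axis k 1" "b k m > 0" using assms by (auto simp: p_def split: if_splits)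
  let ?i = "i + axis k 1" and ?j = "i + m"
  have ne: "?i \<noteq> ?j" using m by auto
  have nn: "(if ?i \<le> ?j + axis l 1 then b l (?j + axis l 1 - ?i) else 0) \<ge> 0" for l
  proof (cases "?i \<le> ?j + axis l 1 \<and> ?j + axis l 1 - ?i = axis l 1")
    case True
    have "?j $ x = ?i $ x" for x
    proof -
      have "?i $ x \<le> (?j + axis l 1) $ x" "(?j + axis l 1 - ?i) $ x = axis l 1 $ x"
        using True by (auto simp: less_eq_vec_def)
      then show ?thesis by simp
    qed
    with ne show ?thesis by (simp add: vec_eq_iff)
  qed (use b(1) in auto)
  have nn_a: "(if ?i \<le> ?j then a (?j - ?i) else 0) \<ge> 0"
  proof (cases "?i \<le> ?j \<and> ?j - ?i = 0")
    case True
    then have "?i = ?j" by (auto simp: vec_eq_iff less_eq_vec_def intro: antisym)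
    with ne show ?thesis by simp
  qed (use a(1) in auto)
  have i_k: "?i $ k > 0" by (simp add: axis_def)
  then have "?i \<noteq> 0" by (metis less_irrefl zero_index)
  have "?j + axis k 1 - ?i = m" "?i \<le> ?j + axis k 1" by (auto simp: vec_eq_iff less_eq_vec_def)
  then have "0 < real (?i $ k) * (if ?i \<le> ?j + axis k 1 then b k (?j + axis k 1 - ?i) else 0)"
    using m(2) i_k by simp
  then have "0 < (\<Sum>l\<in>UNIV. real (?i $ l) * (if ?i \<le> ?j + axis l 1 then b l (?j + axis l 1 - ?i) else 0))"
    by (intro sum_pos2[where i=k] mult_nonneg_nonneg nn) auto
  from add_pos_nonneg[OF this nn_a] have "Q ?i ?j > 0"
    unfolding Q[of ?i ?j] if_not_P[OF \<open>?i \<noteq> 0\<close>] .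
  with ne show ?thesis unfolding reach_def by (intro r_into_rtranclp) (simp add: q_edge_def)
qed

lemma reach_immigration:
  assumes "i \<noteq> 0" "m \<noteq> 0" "a m > 0"
  shows "reach i (i + m)"
proof -
  have ne: "i \<noteq> i + m" using assms(2) by simp
  have nn: "(if i \<le> i + m + axis l 1 then b l (i + m + axis l 1 - i) else 0) \<ge> 0" for l
  proof -
    have "i + m + axis l 1 - i = m + axis l 1" by (auto simp: vec_eq_iff)
    moreover have "m + axis l 1 \<noteq> axis l 1" using assms(2) by simp
    ultimately show ?thesis using b(1) by simp
  qed
  have "i \<le> i + m" "i + m - i = m" by (auto simp: vec_eq_iff less_eq_vec_def)
  then have pos: "0 < (if i \<le> i + m then a (i + m - i) else 0)" using assms(3) by simp
  have "0 \<le> (\<Sum>l\<in>UNIV. real (i $ l) * (if i \<le> i + m + axis l 1 then b l (i + m + axis l 1 - i) else 0))"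
    by (intro sum_nonneg mult_nonneg_nonneg nn) auto
  from add_nonneg_pos[OF this pos] have "Q i (i + m) > 0"
    unfolding Q[of i "i + m"] if_not_P[OF assms(1)] .
  with ne show ?thesis unfolding reach_def by (intro r_into_rtranclp) (simp add: q_edge_def)
qed

lemma reach_resurrection: "m \<noteq> 0 \<Longrightarrow> h m > 0 \<Longrightarrow> reach 0 m"
  unfolding reach_def by (intro r_into_rtranclp) (simp add: q_edge_def Q)

lemma vec_nat_induct [case_names zero add]:
  fixes m :: "nat^'n"
  assumes "P 0" "\<And>m k. P m \<Longrightarrow> P (m + axis k 1)"
  shows "P m"
proof (induction "\<Sum>k\<in>UNIV. m $ k" arbitrary: m)
  case 0
  then have "m = 0" by (auto simp: vec_eq_iff)
  then show ?case using assms(1) by simp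
next
  case (Suc n)
  then obtain k where k: "m $ k \<noteq> 0"
    by (metis sum.neutral nat.distinct(1))
  from axis_decompose[OF this] have m: "m = (m - axis k 1) + axis k 1" by (simp add: add.commute)
  have "(\<Sum>l\<in>UNIV. m $ l) = (\<Sum>l\<in>UNIV. (m - axis k 1) $ l) + (\<Sum>l\<in>UNIV. axis k 1 $ l)"
    unfolding sum.distrib[symmetric] by (intro sum.cong refl) (metis m vector_add_component)
  moreover have "(\<Sum>l\<in>UNIV. axis k 1 $ l) = (1::nat)" by (simp add: axis_def)
  ultimately have "(\<Sum>l\<in>UNIV. (m - axis k 1) $ l) = n" using Suc.hyps(2) by linarith
  from Suc.hyps(1)[OF this[symmetric]] have "P (m - axis k 1)" .
  from assms(2)[OF this, of k] m show ?case by simp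
qed

text \<open>Quantifying over all \<open>i\<close> allows individuals to be removed one after another
  from any population.\<close>

definition killable :: "'n \<Rightarrow> bool" where
  "killable k \<longleftrightarrow> (\<forall>i. reach (i + axis k 1) i)"

lemma reach_kill:
  assumes "\<And>k. m $ k \<noteq> 0 \<Longrightarrow> killable k"
  shows "reach (i + m) i"
  using assms
proof (induction m arbitrary: i rule: vec_nat_induct)
  case (add m k)
  have "killable k" by (rule add.prems) (simp add: axis_def)
  then have "reach (i + m + axis k 1) (i + m)" by (simp add: killable_def)
  moreover have "reach (i + m) i" by (rule add.IH, rule add.prems) simp
  ultimately show ?case using reach_trans by (simp add: add.assoc)
qed (simp add: reach_refl)

text \<open>Let \<open>v\<close> indicate the types that are not killable. Every possible offspring
  of such an individual contains another one of this kind, so \<open>v \<le> G v\<close>; if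
  \<open>v\<close> is nonzero it is then positive everywhere. But \<open>one\<close> can die
  childless.\<close>

lemma all_killable:
  assumes rho: "rho b 1 \<le> 0" and one: "B one 0 > 0"
  shows "killable k"
proof (rule ccontr)
  assume nk: "\<not> killable k"
  define v :: "real^'n" where "v = (\<chi> k. if killable k then 0 else 1)"
  have v: "v $ k \<ge> 0" "v \<noteq> 0" for k
    using nk by (auto simp: v_def vec_eq_iff)
  have ge: "v $ k \<le> (G *v v) $ k" for k
  proof (cases "killable k")
    case True
    have "0 \<le> (G *v v) $ k"
      unfolding matrix_vector_mult_def vec_lambda_beta by (intro sum_nonneg mult_nonneg_nonneg G_nonneg v)
    with True show ?thesis by (simp add: v_def)
  next
    case False
    have "p k m \<le> p k m * (\<Sum>l\<in>UNIV. real (m $ l) * v $ l)" for m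
    proof (cases "p k m = 0")
      case ne: False
      then have pos: "p k m > 0" using p_nonneg[of k m] by simp
      have "\<exists>l. m $ l \<noteq> 0 \<and> \<not> killable l"
      proof (rule ccontr)
        assume "\<not> ?thesis"
        then have "reach (i + axis k 1) i" for i
          using reach_trans[OF reach_branch[OF pos] reach_kill] by blast
        with False show False by (simp add: killable_def)
      qed
      then obtain l where l: "m $ l \<noteq> 0" "\<not> killable l" by blast
      have "1 \<le> real (m $ l) * v $ l" using l by (simp add: v_def)
      also have "\<dots> \<le> (\<Sum>l\<in>UNIV. real (m $ l) * v $ l)"
        by (rule member_le_sum) (use v in auto)
      finally show ?thesis using mult_left_mono[of 1 _ "p k m"] pos by simp
    qed simp
    then have "c k \<le> c k * (G *v v) $ k"
      unfolding c_G by (rule has_sum_mono[OF p_has_sum mu_weighted_has_sum])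
    with False c_pos[of k] show ?thesis by (simp add: v_def)
  qed
  have "killable one"
    using reach_branch[OF p_zero_pos[OF one]] by (simp add: killable_def)
  with rho_nonpos_harmonic(2)[OF rho v ge, of one] show False by (simp add: v_def)
qed

lemma irreducible:
  assumes rho: "rho b 1 \<le> 0" and one: "B one 0 > 0"
  shows "(q_edge Q)\<^sup>*\<^sup>* i j"
proof -
  note kill = all_killable[OF assms]
  have down: "reach (i + m) i" for i m by (rule reach_kill) (rule kill)
  \<comment> \<open>A positive entry of \<open>G\<close> means that a child of type \<open>l\<close>
    is possible; its siblings are removed by \<open>down\<close>.\<close>
  have step: "reach (i + axis k 1) (i + axis l 1)" if "G $ k $ l > 0" for i k l
  proof -
    have "mu k l \<noteq> 0" using that by (auto simp: Gmat_one)
    have "\<exists>m. p k m * real (m $ l) \<noteq> 0"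
    proof (rule ccontr)
      assume "\<not> ?thesis"
      then have "mu k l = 0" unfolding mu_def by (intro infsum_0) auto
      with \<open>mu k l \<noteq> 0\<close> show False by simp
    qed
    then obtain m where m: "p k m * real (m $ l) \<noteq> 0" by blast
    then have pm: "p k m \<noteq> 0" and ml: "m $ l \<noteq> 0" by auto
    have "p k m > 0" using pm p_nonneg[of k m] by linarith
    moreover from ml have "i + m = i + axis l 1 + (m - axis l 1)"
      by (metis add.assoc axis_decompose)
    ultimately have "reach (i + axis k 1) (i + axis l 1 + (m - axis l 1))"
      using reach_branch[of k m i] by simp
    then show ?thesis using down reach_trans by blast
  qed
  have path: "reach (i + axis k 1) (i + axis l 1)" if "matrix_pow G n $ k $ l > 0" for i k l n
    using that
  proof (induction n arbitrary: k)
    case 0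
    then have "k = l" by (auto simp: mat_def split: if_splits)
    then show ?case by (simp add: reach_refl)
  next
    case (Suc n)
    then have "(\<Sum>x\<in>UNIV. G $ k $ x * matrix_pow G n $ x $ l) > 0"
      by (simp add: matrix_matrix_mult_def)
    then obtain x where "G $ k $ x * matrix_pow G n $ x $ l > 0"
      by (meson not_le sum_nonpos)
    then have "G $ k $ x > 0" "matrix_pow G n $ x $ l > 0"
      using G_nonneg[of k x] matrix_pow_nonneg[of G n x l, OF G_nonneg] by (auto simp: zero_less_mult_iff)
    then show ?case using step Suc.IH reach_trans by blast
  qed
  obtain n where n: "\<And>i j. matrix_pow G n $ i $ j > 0" using pos_power by blast
  \<comment> \<open>A nonempty group becomes one individual of type \<open>l\<close>: all but one
    are removed, and the survivor changes type along a path of \<open>G\<close>.\<close>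
  have swap: "reach (i + m) (i + axis l 1)" if ne: "m \<noteq> 0" for i m l
  proof -
    obtain k where "m $ k \<noteq> 0" using ne unfolding vec_eq_iff by auto
    then have "i + m = i + axis k 1 + (m - axis k 1)" by (metis add.assoc axis_decompose)
    then have "reach (i + m) (i + axis k 1)" using down by metis
    then show ?thesis using path[OF n] reach_trans by blast
  qed
  have to_zero: "reach i 0" for i using down[of 0 i] by simp
  obtain mh ma where mh: "mh \<noteq> 0" "h mh > 0" and ma: "ma \<noteq> 0" "a ma > 0"
    using ex_h_pos ex_a_pos by blast
  \<comment> \<open>The target is built one individual at a time. Resurrection supplies the first,
    immigration the later ones, and \<open>swap\<close> reduces each arriving group to one
    individual of the wanted type.\<close>
  have from_zero: "reach 0 j" for j
  proof (induction j rule: vec_nat_induct)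
    case (add j k)
    show ?case
    proof (cases "j = 0")
      case True
      then show ?thesis using reach_trans[OF reach_resurrection[OF mh]] swap[OF mh(1), of 0 k] by simp
    next
      case False
      from reach_trans[OF add reach_immigration[OF this ma]] show ?thesis
        using reach_trans swap[OF ma(1), of j k] by blast
    qed
  qed (simp add: reach_refl)
  from reach_trans[OF to_zero from_zero] show ?thesis by (simp add: reach_def)
qed

end

section \<open>The flow of the branching mechanism\<close>

text \<open>The solution of \<open>x' = f - c * x\<close> with \<open>x(0) = 0\<close>, by variation
  of constants.\<close>

definition exp_avg :: "real \<Rightarrow> (real \<Rightarrow> real) \<Rightarrow> real \<Rightarrow> real" where
  "exp_avg c f t = exp (- c * t) * integral {0..t} (\<lambda>s. exp (c * s) * f s)"

lemma continuous_on_atLeastI: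
  fixes f :: "real \<Rightarrow> 'a::topological_space"
  assumes "\<And>T. continuous_on {a..T} f"
  shows "continuous_on {a..} f"
  unfolding continuous_on_eq_continuous_within
proof
  fix x assume "x \<in> {a..}"
  then have "continuous (at x within {a..x + 1}) f"
    using assms[of "x + 1"] by (simp add: continuous_on_eq_continuous_within)
  also have "at x within {a..x + 1} = at x within {a..}"
    by (rule at_within_nhd[of _ "{..<x + 1}"]) auto
  finally show "continuous (at x within {a..}) f" .
qed

lemma has_integral_exp:
  fixes c s t :: real
  assumes "c > 0" "s \<le> t"
  shows "((\<lambda>r. exp (c * r)) has_integral ((exp (c * t) - exp (c * s)) / c)) {s..t}"
proof -
  have "((\<lambda>r. exp (c * r)) has_integral (exp (c * t) / c - exp (c * s) / c)) {s..t}"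
    by (rule fundamental_theorem_of_calculus[of s t "\<lambda>r. exp (c * r) / c" "\<lambda>r. exp (c * r)"])
       (use assms in \<open>auto intro!: derivative_eq_intros simp: has_real_derivative_iff_has_vector_derivative[symmetric]\<close>)
  then show ?thesis by (simp add: diff_divide_distrib)
qed

text \<open>The factor \<open>1 - exp (- c * t)\<close> in the upper bound is slack that is needed
  later: it keeps the flow below \<open>1\<close> and \<open>B k\<close> positive along it.\<close>

lemma
  fixes f :: "real \<Rightarrow> real"
  assumes c: "c > 0" and cont: "continuous_on {0..} f" and mono: "\<And>s t. 0 \<le> s \<Longrightarrow> s \<le> t \<Longrightarrow> f s \<le> f t"
    and nonneg: "f 0 \<ge> 0"
  shows continuous_on_exp_avg: "continuous_on {0..} (exp_avg c f)"
    and exp_avg_nonneg: "\<And>t. 0 \<le> t \<Longrightarrow> exp_avg c f t \<ge> 0"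
    and exp_avg_le: "\<And>t. 0 \<le> t \<Longrightarrow> c * exp_avg c f t \<le> f t * (1 - exp (- c * t))"
    and exp_avg_mono: "\<And>s t. 0 \<le> s \<Longrightarrow> s \<le> t \<Longrightarrow> exp_avg c f s \<le> exp_avg c f t"
proof -
  define F where "F s = exp (c * s) * f s" for s
  have f_nn: "f s \<ge> 0" if "0 \<le> s" for s using mono[of 0 s] that nonneg by simp
  have contF: "continuous_on {s..t} F" if "0 \<le> s" for s t
    unfolding F_def using that by (intro continuous_intros continuous_on_subset[OF cont]) auto
  have intF: "F integrable_on {s..t}" if "0 \<le> s" for s t
    by (rule integrable_continuous_real[OF contF[OF that]])
  have eq: "exp_avg c f t = exp (- c * t) * integral {0..t} F" for t
    unfolding exp_avg_def F_def[abs_def] ..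
  show "continuous_on {0..} (exp_avg c f)"
    unfolding eq[abs_def]
    by (intro continuous_intros continuous_on_atLeastI indefinite_integral_continuous_1 intF) simp
  show nn: "exp_avg c f t \<ge> 0" if "0 \<le> t" for t
    unfolding eq by (intro mult_nonneg_nonneg integral_nonneg intF) (auto simp: F_def f_nn)
  \<comment> \<open>Here \<open>f\<close> is replaced by its final value \<open>f t\<close>. The
    proof of monotonicity below also replaces it by its initial value \<open>f s\<close>, on
    \<open>{s..t}\<close>.\<close>
  have I_le: "c * integral {0..t} F \<le> f t * (exp (c * t) - 1)" if "0 \<le> t" for t
  proof -
    have "integral {0..t} F \<le> f t * ((exp (c * t) - exp (c * 0)) / c)"
    proof (rule has_integral_le[OF integrable_integral[OF intF] has_integral_mult_right[OF has_integral_exp[OF c that]]])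
      fix r assume "r \<in> {0..t}"
      then show "F r \<le> f t * exp (c * r)" unfolding F_def using mono[of r t] by (simp add: mult.commute)
    qed simp
    from mult_left_mono[OF this, of c] c show ?thesis by simp
  qed
  show "c * exp_avg c f t \<le> f t * (1 - exp (- c * t))" if "0 \<le> t" for t
  proof -
    have "c * exp_avg c f t = exp (- c * t) * (c * integral {0..t} F)" unfolding eq by simp
    also have "\<dots> \<le> exp (- c * t) * (f t * (exp (c * t) - 1))"
      by (intro mult_left_mono I_le that) simp
    also have "\<dots> = f t * (1 - exp (- c * t))"
      by (simp add: exp_minus field_simps)
    finally show ?thesis .
  qed
  show "exp_avg c f s \<le> exp_avg c f t" if st: "0 \<le> s" "s \<le> t" for s t
  proof -
    have "f s * ((exp (c * t) - exp (c * s)) / c) \<le> integral {s..t} F"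
    proof (rule has_integral_le[OF has_integral_mult_right[OF has_integral_exp[OF c st(2)]] integrable_integral[OF intF[OF st(1)]]])
      fix r assume "r \<in> {s..t}"
      then show "f s * exp (c * r) \<le> F r" unfolding F_def using mono[of s r] st by (simp add: mult.commute)
    qed
    then have J: "f s * (exp (c * t) - exp (c * s)) \<le> c * integral {s..t} F"
      using c by (simp add: field_simps)
    have "(exp (c * t - c * s) - 1) * (c * integral {0..s} F) \<le> (exp (c * t - c * s) - 1) * (f s * exp (c * s))"
    proof (rule mult_left_mono)
      show "c * integral {0..s} F \<le> f s * exp (c * s)"
        using I_le[OF st(1)] f_nn[OF st(1)] by (simp add: algebra_simps)
      show "0 \<le> exp (c * t - c * s) - 1" using c st by simp
    qed
    also have "\<dots> = f s * (exp (c * t) - exp (c * s))"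
      by (simp add: exp_diff field_simps)
    also note J
    finally have "c * (exp (c * t - c * s) * integral {0..s} F) \<le> c * (integral {0..s} F + integral {s..t} F)"
      by (simp add: algebra_simps)
    then have "exp (c * t - c * s) * integral {0..s} F \<le> integral {0..t} F"
      using c Henstock_Kurzweil_Integration.integral_combine[OF st intF[of 0 t, simplified]] by simp
    from mult_left_mono[OF this, of "exp (- c * t)"]
    show ?thesis unfolding eq by (simp add: mult.assoc[symmetric] exp_add[symmetric])
  qed
qed

lemma exp_avg_mono_fun:
  assumes c: "c > 0" and cont: "continuous_on {0..} f" "continuous_on {0..} g"
    and le: "\<And>s. 0 \<le> s \<Longrightarrow> f s \<le> g s" and t: "0 \<le> t"
  shows "exp_avg c f t \<le> exp_avg c g t"
proof -
  have "(\<lambda>s. exp (c * s) * f s) integrable_on {0..t}" "(\<lambda>s. exp (c * s) * g s) integrable_on {0..t}"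
    by (intro integrable_continuous_real continuous_on_mult continuous_on_subset[OF cont(1)]
        continuous_on_subset[OF cont(2)] continuous_intros, auto)+
  then show ?thesis
    unfolding exp_avg_def by (intro mult_left_mono integral_le) (auto intro: le)
qed

context nTBI
begin

text \<open>Picard iteration for \<open>u_k' = R k u - c k * u_k\<close>, \<open>u(0) = 0\<close>,
  in variation-of-constants form. As \<open>R k\<close> is monotone, the iterates increase both in
  \<open>m\<close> and in time and converge without a contraction argument.\<close>

primrec flow_iter :: "nat \<Rightarrow> real \<Rightarrow> real^'n" where
  "flow_iter 0 = (\<lambda>t. 0)"
| "flow_iter (Suc m) = (\<lambda>t. \<chi> k. exp_avg (c k) (\<lambda>s. R k (flow_iter m s)) t)"

lemma continuous_on_R_compose:
  assumes "continuous_on S v" "\<And>t. t \<in> S \<Longrightarrow> v t \<in> {0..1}"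
  shows "continuous_on S (\<lambda>t. R k (v t))"
  by (rule continuous_on_compose2[OF continuous_on_R assms(1)]) (use assms(2) in auto)

lemma flow_iter:
  shows flow_iter_continuous: "continuous_on {0..} (flow_iter m)"
    and flow_iter_cube: "\<And>t. 0 \<le> t \<Longrightarrow> flow_iter m t \<in> {0..1}"
    and flow_iter_mono: "\<And>s t. 0 \<le> s \<Longrightarrow> s \<le> t \<Longrightarrow> flow_iter m s \<le> flow_iter m t"
proof -
  have "continuous_on {0..} (flow_iter m) \<and> (\<forall>t\<ge>0. flow_iter m t \<in> {0..1}) \<and>
    (\<forall>s t. 0 \<le> s \<longrightarrow> s \<le> t \<longrightarrow> flow_iter m s \<le> flow_iter m t)"
  proof (induction m)
    case (Suc m)
    let ?f = "\<lambda>k s. R k (flow_iter m s)"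
    have cont: "continuous_on {0..} (?f k)" for k
      by (rule continuous_on_R_compose) (use Suc in auto)
    have mono: "?f k s \<le> ?f k t" if "0 \<le> s" "s \<le> t" for k s t
      by (rule R_mono) (use Suc that in auto)
    have nn: "?f k t \<ge> 0" "?f k t \<le> c k" if "0 \<le> t" for k t
      using Suc that by (auto intro!: R_nonneg R_le)
    note ex = continuous_on_exp_avg[OF c_pos cont mono nn(1)] exp_avg_nonneg[OF c_pos cont mono nn(1)]
      exp_avg_le[OF c_pos cont mono nn(1)] exp_avg_mono[OF c_pos cont mono nn(1)]
    have "exp_avg (c k) (?f k) t \<le> 1" if "0 \<le> t" for k t
    proof -
      have "c k * exp_avg (c k) (?f k) t \<le> ?f k t * (1 - exp (- c k * t))" by (rule ex(3)) (use that in auto)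
      also have "\<dots> \<le> c k * 1"
        using c_pos[of k] that by (intro mult_mono nn) auto
      finally show ?thesis using c_pos[of k] by simp
    qed
    then show ?case
      using ex by (auto simp: less_eq_vec_def continuous_on_vec_lambda)
  qed auto
  then show "continuous_on {0..} (flow_iter m)" "\<And>t. 0 \<le> t \<Longrightarrow> flow_iter m t \<in> {0..1}"
    "\<And>s t. 0 \<le> s \<Longrightarrow> s \<le> t \<Longrightarrow> flow_iter m s \<le> flow_iter m t" by auto
qed

lemma flow_iter_incseq: "0 \<le> t \<Longrightarrow> flow_iter m t \<le> flow_iter (Suc m) t"
proof (induction m arbitrary: t)
  case 0
  from flow_iter_cube[OF this, of "Suc 0"] show ?case by simp
next
  case (Suc m)
  have "exp_avg (c k) (\<lambda>s. R k (flow_iter m s)) t \<le> exp_avg (c k) (\<lambda>s. R k (flow_iter (Suc m) s)) t" for k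
  proof (rule exp_avg_mono_fun[OF c_pos _ _ _ Suc.prems])
    show "R k (flow_iter m s) \<le> R k (flow_iter (Suc m) s)" if "0 \<le> s" for s
      by (rule R_mono[OF _ Suc.IH]) (use flow_iter_cube[OF that] that in \<open>auto simp del: flow_iter.simps\<close>)
  qed (auto intro!: continuous_on_R_compose flow_iter_continuous flow_iter_cube simp del: flow_iter.simps)
  then show ?case by (subst (1 2) flow_iter.simps) (simp add: less_eq_vec_def)
qed

definition flow :: "real \<Rightarrow> real^'n" where
  "flow t = (\<chi> k. SUP m. flow_iter m t $ k)"

lemma flow_iter_tendsto_component:
  assumes "0 \<le> t"
  shows "(\<lambda>m. flow_iter m t $ k) \<longlonglongrightarrow> flow t $ k"
proof -
  have "bdd_above (range (\<lambda>m. flow_iter m t $ k))"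
    using cubeD(2)[OF flow_iter_cube[OF assms]] by (intro bdd_aboveI2)
  moreover have "incseq (\<lambda>m. flow_iter m t $ k)"
    using flow_iter_incseq[OF assms] by (auto simp: incseq_Suc_iff less_eq_vec_def simp del: flow_iter.simps)
  ultimately show ?thesis
    unfolding flow_def vec_lambda_beta by (rule LIMSEQ_incseq_SUP)
qed

lemma flow_iter_tendsto: "0 \<le> t \<Longrightarrow> (\<lambda>m. flow_iter m t) \<longlonglongrightarrow> flow t"
  by (rule vec_tendstoI) (rule flow_iter_tendsto_component)

lemma flow_cube:
  assumes "0 \<le> t" shows "flow t \<in> {0..1}"
proof -
  have "0 \<le> flow t $ k" for k
    by (rule LIMSEQ_le_const[OF flow_iter_tendsto_component[OF assms]])
       (intro exI allI impI cubeD flow_iter_cube assms)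
  moreover have "flow t $ k \<le> 1" for k
    by (rule LIMSEQ_le_const2[OF flow_iter_tendsto_component[OF assms]])
       (intro exI allI impI cubeD flow_iter_cube assms)
  ultimately show ?thesis by (simp add: less_eq_vec_def)
qed

lemma flow_mono:
  assumes "0 \<le> s" "s \<le> t" shows "flow s \<le> flow t"
proof -
  have "0 \<le> t" using assms by simp
  have "flow s $ k \<le> flow t $ k" for k
    by (rule LIMSEQ_le[OF flow_iter_tendsto_component[OF assms(1)] flow_iter_tendsto_component[OF \<open>0 \<le> t\<close>]])
       (use flow_iter_mono[OF assms] in \<open>auto simp: less_eq_vec_def\<close>)
  then show ?thesis by (simp add: less_eq_vec_def)
qed

lemma R_flow_iter_tendsto:
  assumes "0 \<le> t"
  shows "(\<lambda>m. R k (flow_iter m t)) \<longlonglongrightarrow> R k (flow t)"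
  by (rule continuous_on_tendsto_compose[OF continuous_on_R flow_iter_tendsto])
     (use assms in \<open>auto intro!: always_eventually flow_cube flow_iter_cube simp del: atLeastAtMost_iff\<close>)

text \<open>A pointwise monotone limit need not be continuous in time, so integrability of the limit
  is taken from dominated convergence; continuity of \<open>flow\<close> is read off the equation
  afterwards.\<close>

lemma flow_integral_equation:
  assumes t: "0 \<le> t"
  shows "(\<lambda>s. exp (c k * s) * R k (flow s)) integrable_on {0..t}"
    and "flow t $ k = exp_avg (c k) (\<lambda>s. R k (flow s)) t"
proof -
  let ?f = "\<lambda>m s. exp (c k * s) * R k (flow_iter m s)"
  have int: "?f m integrable_on {0..t}" for m
    by (intro integrable_continuous_real continuous_intros continuous_on_R_compose flow_iter_cube
        continuous_on_subset[OF flow_iter_continuous]) auto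
  have bound: "(\<lambda>s. exp (c k * s) * c k) integrable_on {0..t}"
    by (intro integrable_continuous_real continuous_intros)
  have le: "norm (?f m s) \<le> exp (c k * s) * c k" if "s \<in> {0..t}" for m s
    using that R_nonneg[OF flow_iter_cube, of s k m] R_le[OF flow_iter_cube, of s k m]
    by (simp add: abs_mult)
  have conv: "(\<lambda>m. ?f m s) \<longlonglongrightarrow> exp (c k * s) * R k (flow s)" if "s \<in> {0..t}" for s
    using that by (intro tendsto_intros R_flow_iter_tendsto) auto
  note dc = dominated_convergence[OF int bound le conv]
  show "(\<lambda>s. exp (c k * s) * R k (flow s)) integrable_on {0..t}" by (rule dc)
  have "(\<lambda>m. exp (- c k * t) * integral {0..t} (?f m)) \<longlonglongrightarrow> exp_avg (c k) (\<lambda>s. R k (flow s)) t"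
    unfolding exp_avg_def by (intro tendsto_mult tendsto_const dc)
  moreover have "exp (- c k * t) * integral {0..t} (?f m) = flow_iter (Suc m) t $ k" for m
    by (simp add: exp_avg_def)
  ultimately have "(\<lambda>m. flow_iter (Suc m) t $ k) \<longlonglongrightarrow> exp_avg (c k) (\<lambda>s. R k (flow s)) t"
    by simp
  from LIMSEQ_unique[OF this LIMSEQ_Suc[OF flow_iter_tendsto_component[OF t]]]
  show "flow t $ k = exp_avg (c k) (\<lambda>s. R k (flow s)) t" by simp
qed

lemma continuous_on_flow: "continuous_on {0..} flow"
proof -
  have "continuous_on {0..} (\<lambda>t. flow t $ k)" for k
  proof -
    have "continuous_on {0..} (\<lambda>t. exp_avg (c k) (\<lambda>s. R k (flow s)) t)"
      unfolding exp_avg_def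
    proof (intro continuous_intros continuous_on_atLeastI)
      fix T :: real
      show "continuous_on {0..T} (\<lambda>x. integral {0..x} (\<lambda>s. exp (c k * s) * R k (flow s)))"
        by (cases "0 \<le> T") (auto intro: indefinite_integral_continuous_1 flow_integral_equation)
    qed
    then show ?thesis
      by (rule continuous_on_cong[THEN iffD1, rotated -1]) (auto simp: flow_integral_equation(2))
  qed
  then have "continuous_on {0..} (\<lambda>t. \<chi> k. flow t $ k)" by (intro continuous_on_vec_lambda)
  then show ?thesis by simp
qed

lemma continuous_on_R_flow: "continuous_on {0..} (\<lambda>s. R k (flow s))"
  by (intro continuous_on_R_compose continuous_on_flow flow_cube) auto

lemma flow_zero: "flow 0 = 0"
  by (simp add: vec_eq_iff flow_integral_equation(2) exp_avg_def)

lemma c_flow_le: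
  assumes "0 \<le> t" shows "c k * flow t $ k \<le> R k (flow t) * (1 - exp (- c k * t))"
  unfolding flow_integral_equation(2)[OF assms]
  by (intro exp_avg_le[OF c_pos continuous_on_R_flow _ _ assms] R_mono flow_mono R_nonneg flow_cube)
     (use flow_cube in auto)

lemma flow_less_one:
  assumes "0 \<le> t" shows "flow t $ k < 1"
proof -
  have "c k * flow t $ k \<le> R k (flow t) * (1 - exp (- c k * t))" by (rule c_flow_le[OF assms])
  also have "\<dots> \<le> c k * (1 - exp (- c k * t))"
    using R_le[OF flow_cube[OF assms], of k] c_pos[of k] assms by (intro mult_right_mono) auto
  also have "\<dots> < c k * 1" using c_pos[of k] by (intro mult_strict_left_mono) auto
  finally show ?thesis using c_pos[of k] by simp
qed

text \<open>The slack in \<open>c_flow_le\<close> leaves a share \<open>exp (- c k * t)\<close> of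
  \<open>R k (flow t)\<close>. So no \<open>B k\<close> becomes negative along the flow, and one
  that is positive at the start remains so at every finite time.\<close>

lemma B_flow_ge:
  assumes "0 \<le> t" shows "B k (flow t) \<ge> exp (- c k * t) * B k 0"
proof -
  have "exp (- c k * t) * B k 0 = exp (- c k * t) * R k 0" by (simp add: B_eq)
  also have "\<dots> \<le> exp (- c k * t) * R k (flow t)"
    using flow_cube[OF assms] by (intro mult_left_mono R_mono) auto
  also have "\<dots> \<le> R k (flow t) - c k * flow t $ k"
    using c_flow_le[OF assms, of k] by (simp add: algebra_simps)
  finally show ?thesis by (simp add: B_eq[OF flow_cube[OF assms]])
qed

text \<open>The components of the flow, continued to times in \<open>(-1, 0)\<close> by freezing the inhomogeneity at
  time \<open>0\<close>; this makes all derivatives two-sided.\<close>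

definition flow_ext :: "'n \<Rightarrow> real \<Rightarrow> real" where
  "flow_ext k t = exp (- c k * t) * (integral {-1..t} (\<lambda>s. exp (c k * s) * R k (flow (max 0 s)))
     - integral {-1..0} (\<lambda>s. exp (c k * s) * R k (flow (max 0 s))))"

lemma continuous_on_flow_ext_integrand:
  "continuous_on S (\<lambda>s. exp (c k * s) * R k (flow (max 0 s)))"
  by (intro continuous_intros continuous_on_compose2[OF continuous_on_R_flow]) auto

lemma flow_ext_eq:
  assumes "0 \<le> t" shows "flow_ext k t = flow t $ k"
proof -
  let ?F = "\<lambda>s. exp (c k * s) * R k (flow (max 0 s))"
  have "integral {-1..0} ?F + integral {0..t} ?F = integral {-1..t} ?F"
    by (rule Henstock_Kurzweil_Integration.integral_combine)
       (use assms in \<open>auto intro!: integrable_continuous_real continuous_on_flow_ext_integrand\<close>)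
  moreover have "integral {0..t} ?F = integral {0..t} (\<lambda>s. exp (c k * s) * R k (flow s))"
    by (rule integral_cong) auto
  ultimately show ?thesis
    unfolding flow_ext_def flow_integral_equation(2)[OF assms] exp_avg_def by simp
qed

lemma flow_ext_has_derivative:
  assumes "- 1 < t"
  shows "(flow_ext k has_real_derivative (R k (flow (max 0 t)) - c k * flow_ext k t)) (at t)"
proof -
  let ?F = "\<lambda>s. exp (c k * s) * R k (flow (max 0 s))"
  have "((\<lambda>x. integral {-1..x} ?F) has_real_derivative ?F t) (at t within {-1..t + 1})"
    by (rule integral_has_real_derivative) (use assms in \<open>auto intro!: continuous_on_flow_ext_integrand\<close>)
  moreover have "at t within {-1..t + 1} = at t"
    using assms by (intro at_within_interior) (auto simp: interior_atLeastAtMost_real)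
  ultimately have I: "((\<lambda>x. integral {-1..x} ?F) has_real_derivative ?F t) (at t)" by simp
  define I where "I x = integral {-1..x} ?F" for x
  have I': "(I has_real_derivative ?F t) (at t)" using I by (simp add: I_def[abs_def])
  have eq: "flow_ext k = (\<lambda>x. exp (- c k * x) * (I x - I 0))"
    unfolding flow_ext_def[abs_def] I_def ..
  have "((\<lambda>x. exp (- c k * x) * (I x - I 0)) has_real_derivative
      (exp (- c k * t) * (- c k)) * (I t - I 0) + ?F t * exp (- c k * t)) (at t)"
    by (rule DERIV_mult) (auto intro!: derivative_eq_intros I')
  moreover have "?F t * exp (- c k * t) = (exp (c k * t) * exp (- c k * t)) * R k (flow (max 0 t))"
    by (simp only: mult_ac)
  then have "?F t * exp (- c k * t) = R k (flow (max 0 t))"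
    by (simp add: exp_add[symmetric])
  then have "(exp (- c k * t) * (- c k)) * (I t - I 0) + ?F t * exp (- c k * t)
      = R k (flow (max 0 t)) - c k * (exp (- c k * t) * (I t - I 0))"
    by simp
  ultimately show ?thesis unfolding eq by (simp only:)
qed

lemma flow_ext_neg: "t \<le> 0 \<Longrightarrow> flow_ext k t \<le> 0"
proof -
  assume t: "t \<le> 0"
  let ?F = "\<lambda>s. exp (c k * s) * R k (flow (max 0 s))"
  have "integral {-1..t} ?F \<le> integral {-1..0} ?F"
    by (rule integral_subset_le)
       (use t in \<open>auto intro!: integrable_continuous_real continuous_on_flow_ext_integrand mult_nonneg_nonneg R_nonneg flow_cube simp del: atLeastAtMost_iff\<close>)
  then show ?thesis by (simp add: flow_ext_def mult_nonneg_nonpos)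
qed

text \<open>For negative times \<open>R k\<close> is frozen at its positive value at
  \<open>0\<close>, while \<open>flow_ext k\<close> itself is nonpositive.\<close>

lemma flow_ext_derivative_pos:
  assumes "- 1 < t" "B k 0 > 0"
  shows "R k (flow (max 0 t)) - c k * flow_ext k t > 0"
proof (cases "0 \<le> t")
  case True
  have "0 < exp (- c k * t) * B k 0" using assms(2) by simp
  also have "\<dots> \<le> B k (flow t)" by (rule B_flow_ge[OF True])
  finally show ?thesis using True by (simp add: B_eq[OF flow_cube[OF True]] flow_ext_eq)
next
  case False
  have "c k * flow_ext k t \<le> 0" using flow_ext_neg[of t k] False c_pos[of k] by (simp add: mult_nonneg_nonpos)
  moreover have "R k 0 > 0" using assms(2) by (simp add: B_eq)
  ultimately show ?thesis using False by (simp add: flow_zero)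
qed

lemma flow_ext_strict_mono:
  assumes "B k 0 > 0" "- 1 < s" "s < t"
  shows "flow_ext k s < flow_ext k t"
  by (rule DERIV_pos_imp_increasing[OF assms(3)])
     (use assms in \<open>auto intro!: exI flow_ext_has_derivative flow_ext_derivative_pos\<close>)

end

text \<open>A bounded monotone flow has a limit, and a positive \<open>B k\<close> at the limit
  would keep a component growing out of the cube. So the limit is a common zero, which
  \<open>no_fixed_point_below_one\<close> identifies.\<close>

lemma (in nTBI_mean) flow_tendsto_one:
  assumes rho: "rho b 1 \<le> 0" and one: "B one 0 > 0"
  shows "(flow \<longlongrightarrow> 1) at_top"
proof -
  define q where "q = (\<chi> k. SUP t\<in>{0..}. flow t $ k)"
  have bdd: "bdd_above ((\<lambda>t. flow t $ k) ` {0..})" for k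
    using cubeD(2)[OF flow_cube] by (intro bdd_aboveI2[where M=1]) auto
  have le_q: "flow t $ k \<le> q $ k" if "0 \<le> t" for t k
    unfolding q_def vec_lambda_beta by (intro cSUP_upper bdd) (use that in auto)
  have lim_k: "((\<lambda>t. flow t $ k) \<longlongrightarrow> q $ k) at_top" for k
  proof (rule order_tendstoI)
    fix y assume "y < q $ k"
    then obtain T where T: "0 \<le> T" "y < flow T $ k"
      unfolding q_def vec_lambda_beta by (subst (asm) less_cSUP_iff) (use bdd in auto)
    then have "y < flow t $ k" if "T \<le> t" for t
      using flow_mono[OF T(1) that] by (auto simp: less_eq_vec_def intro: less_le_trans)
    then show "\<forall>\<^sub>F t in at_top. y < flow t $ k"
      using eventually_at_top_linorder by blast
  next
    fix y assume "q $ k < y"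
    then have "flow t $ k < y" if "0 \<le> t" for t using le_q[OF that, of k] by simp
    then show "\<forall>\<^sub>F t in at_top. flow t $ k < y"
      using eventually_at_top_linorder by blast
  qed
  then have lim: "(flow \<longlongrightarrow> q) at_top" by (rule vec_tendstoI)
  have q: "q \<in> {0..1}"
  proof -
    have "0 \<le> q $ k \<and> q $ k \<le> 1" for k
      using le_q[of 0 k] flow_zero
      by (auto simp: q_def intro!: cSUP_least cubeD(2)[OF flow_cube])
    then show ?thesis by (auto simp: less_eq_vec_def)
  qed
  have B_lim: "((\<lambda>t. B k (flow t)) \<longlongrightarrow> B k q) at_top" for k
    by (rule continuous_on_tendsto_compose[OF continuous_on_B lim q])
       (auto simp: eventually_at_top_linorder intro!: exI[of _ 0] flow_cube simp del: atLeastAtMost_iff)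
  have B_nn: "B k (flow t) \<ge> 0" if "0 \<le> t" for k t
  proof -
    have "B k 0 \<ge> 0" using R_nonneg[of 0 k] by (simp add: B_eq)
    then have "0 \<le> exp (- c k * t) * B k 0" by simp
    also note B_flow_ge[OF that, of k]
    finally show ?thesis .
  qed
  have "B k q = 0" for k
  proof (rule ccontr)
    assume ne: "B k q \<noteq> 0"
    have "B k q \<ge> 0"
      by (rule tendsto_lowerbound[OF B_lim]) (auto simp: eventually_at_top_linorder intro!: exI[of _ 0] B_nn)
    with ne have pos: "B k q > 0" by simp
    define d where "d = B k q / 2"
    have d: "d > 0" "d < B k q" using pos by (auto simp: d_def)
    from order_tendstoD(1)[OF B_lim d(2)] obtain T where T: "\<And>t. T \<le> t \<Longrightarrow> d < B k (flow t)"
      by (auto simp: eventually_at_top_linorder)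
    define s where "s = max 0 T"
    \<comment> \<open>At a speed of at least \<open>d\<close>, a time span of \<open>2 / d\<close>
      moves the component by \<open>2\<close>, more than the width of the cube.\<close>
    define t where "t = s + 2 / d"
    have st: "0 \<le> s" "s < t" "T \<le> s" using d by (auto simp: s_def t_def)
    have "\<exists>z. s < z \<and> z < t \<and> flow_ext k t - flow_ext k s = (t - s) * (R k (flow (max 0 z)) - c k * flow_ext k z)"
      by (rule MVT2[OF st(2)], rule flow_ext_has_derivative) (use st in linarith)
    then obtain z where z: "s < z" "z < t" "flow_ext k t - flow_ext k s = (t - s) * (R k (flow (max 0 z)) - c k * flow_ext k z)"
      by blast
    have "flow t $ k - flow s $ k = (t - s) * B k (flow z)"
      using z st by (simp add: flow_ext_eq B_eq[OF flow_cube[of z]])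
    also have "\<dots> \<ge> (t - s) * d" using T[of z] z st by (intro mult_left_mono) auto
    finally have "flow t $ k - flow s $ k \<ge> 2" using d by (simp add: t_def)
    moreover have "flow t $ k \<le> 1" "flow s $ k \<ge> 0" using st by (auto intro!: cubeD flow_cube)
    ultimately show False by linarith
  qed
  from no_fixed_point_below_one[OF rho one q this] lim show ?thesis by simp
qed

section \<open>The branching curve\<close>

context nTBI_mean
begin

text \<open>Coordinate \<open>one\<close> of the flow increases strictly from \<open>0\<close>
  towards \<open>1\<close>. Its inverse \<open>\<tau>\<close> is the clock that turns the flow into
  the curve, and the chain rule produces the quotient \<open>B k / B one\<close>.\<close>

lemma ex_branching_curve:
  assumes rho: "rho b 1 \<le> 0" and one: "B one 0 > 0"
  obtains V where "branching_curve b one V"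
    "\<And>x k. 0 \<le> x \<Longrightarrow> x < 1 \<Longrightarrow> V x $ k < 1" "\<And>x. 0 \<le> x \<Longrightarrow> x < 1 \<Longrightarrow> B one (V x) > 0"
proof -
  let ?f = "flow_ext one"
  let ?f' = "\<lambda>t. R one (flow (max 0 t)) - c one * ?f t"
  have lim: "((\<lambda>t. flow t $ k) \<longlongrightarrow> 1) at_top" for k
    using tendsto_vec_nth[OF flow_tendsto_one[OF assms], of k] by simp
  have inc: "?f s < ?f t \<longleftrightarrow> s < t" if "- 1 < s" "- 1 < t" for s t
    using flow_ext_strict_mono[OF one] that by (metis less_asym' linorder_neqE_linordered_idom less_irrefl)
  have inj: "inj_on ?f {-1<..}"
    by (rule inj_onI) (use inc in \<open>metis greaterThan_iff less_irrefl linorder_neqE_linordered_idom\<close>)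
  define \<tau> where "\<tau> = inv_into {-1<..} ?f"
  have \<tau>_f: "\<tau> (?f t) = t" if "- 1 < t" for t
    unfolding \<tau>_def by (rule inv_into_f_f[OF inj]) (use that in simp)
  have cont: "isCont ?f t" if "- 1 < t" for t
    using flow_ext_has_derivative[OF that] DERIV_isCont by blast
  have f0: "?f 0 = 0" by (simp add: flow_ext_eq flow_zero)
  \<comment> \<open>The time \<open>- 1/2\<close> stands for any time in \<open>(-1, 0)\<close>. It
    makes \<open>x = 0\<close> an interior point, so that the two-sided inverse function rules apply
    there.\<close>
  have f_half: "?f (- 1/2) < 0" using inc[of "- 1/2" 0] f0 by simp
  have f_\<tau>: "?f (\<tau> x) = x \<and> - 1 < \<tau> x" if "?f (- 1/2) < x" "x < 1" for x
  proof -
    have "\<forall>\<^sub>F t in at_top. x < flow t $ one \<and> 0 \<le> t"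
      using order_tendstoD(1)[OF lim that(2)] eventually_ge_at_top[of 0] by eventually_elim auto
    then obtain T where T: "x < flow T $ one" "0 \<le> T"
      unfolding eventually_at_top_linorder by (meson order_refl)
    have "\<exists>t\<ge>- 1/2. t \<le> T \<and> ?f t = x"
      by (rule IVT) (use that T cont in \<open>auto simp: flow_ext_eq\<close>)
    then obtain t where t: "- 1 < t" "?f t = x" by force
    with \<tau>_f[OF t(1)] show ?thesis by simp
  qed
  have \<tau>_nn: "0 \<le> \<tau> x" if "0 \<le> x" "x < 1" for x
    using f_\<tau>[of x] inc[of "\<tau> x" 0] f0 f_half that by force
  have \<tau>_0: "\<tau> 0 = 0" using \<tau>_f[of 0] f0 by simp
  have \<tau>_cont: "isCont \<tau> x" if x: "?f (- 1/2) < x" "x < 1" for x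
  proof -
    have 1: "- 1 < \<tau> x" "?f (\<tau> x) = x" using f_\<tau>[OF x] by auto
    define d where "d = (\<tau> x + 1) / 2"
    have d: "d > 0" "- 1 < \<tau> x - d" using 1(1) by (auto simp: d_def field_simps)
    have "isCont \<tau> (?f (\<tau> x))"
      by (rule isCont_inverse_function[OF d(1)]) (use d in \<open>auto intro!: \<tau>_f cont simp: abs_le_iff\<close>)
    with 1 show ?thesis by simp
  qed
  have \<tau>_deriv: "(\<tau> has_real_derivative inverse (?f' (\<tau> x))) (at x)" if x: "?f (- 1/2) < x" "x < 1" for x
  proof (rule DERIV_inverse_function[where f="?f" and a="?f (- 1/2)" and b=1])
    have "- 1 < \<tau> x" using f_\<tau>[OF x] by simp
    then show "(?f has_real_derivative ?f' (\<tau> x)) (at (\<tau> x))" "?f' (\<tau> x) \<noteq> 0"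
      using flow_ext_has_derivative flow_ext_derivative_pos[of "\<tau> x" one] one by auto
  qed (use x f_\<tau> \<tau>_cont in auto)
  define V where "V x = (if x < 1 then flow (\<tau> x) else 1)" for x
  have V_k: "V x $ k = flow_ext k (\<tau> x)" if "0 \<le> x" "x < 1" for x k
    using that \<tau>_nn by (simp add: V_def flow_ext_eq)
  have V_deriv: "((\<lambda>y. V y $ k) has_real_derivative B k (V x) / B one (V x)) (at x within {0..1})"
    if x: "0 \<le> x" "x < 1" for x k
  proof -
    have x': "?f (- 1/2) < x" "- 1 < \<tau> x" "0 \<le> \<tau> x" using x f_half \<tau>_nn[OF x] by auto
    have e: "R l (flow (max 0 (\<tau> x))) - c l * flow_ext l (\<tau> x) = B l (V x)" for l
      using x x'(3) by (simp add: V_def flow_ext_eq B_eq[OF flow_cube[OF x'(3)]])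
    have "((\<lambda>y. flow_ext k (\<tau> y)) has_real_derivative
        (R k (flow (max 0 (\<tau> x))) - c k * flow_ext k (\<tau> x)) * inverse (?f' (\<tau> x))) (at x)"
      by (rule DERIV_chain2[OF flow_ext_has_derivative[OF x'(2)] \<tau>_deriv[OF x'(1) x(2)]])
    then have "((\<lambda>y. flow_ext k (\<tau> y)) has_real_derivative B k (V x) / B one (V x)) (at x within {0..1})"
      unfolding e by (simp add: divide_inverse has_field_derivative_at_within)
    then show ?thesis
      by (rule has_field_derivative_transform_within[where d="1 - x"]) (use x in \<open>auto simp: V_k dist_real_def\<close>)
  qed
  have V_one: "V x $ one = x" if "0 \<le> x" "x \<le> 1" for x
  proof (cases "x < 1")
    case True
    then show ?thesis using V_k[OF that(1) True] f_\<tau>[of x] f_half that by simp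
  qed (use that in \<open>simp add: V_def\<close>)
  have V_cube: "V x \<in> {0..1}" if "0 \<le> x" "x \<le> 1" for x
    using that flow_cube[OF \<tau>_nn[of x]] by (cases "x < 1") (auto simp: V_def)
  \<comment> \<open>Continuity at \<open>1\<close> comes from monotonicity: once \<open>x\<close>
    exceeds \<open>flow T $ one\<close> the clock has passed \<open>T\<close>, so
    \<open>V x $ k\<close> is at least \<open>flow T $ k\<close>.\<close>
  have "((\<lambda>y. V y $ k) \<longlongrightarrow> 1) (at 1 within {0..1})" for k
  proof (rule order_tendstoI)
    fix y :: real assume "y < 1"
    then have "\<forall>\<^sub>F t in at_top. y < flow t $ k \<and> 0 \<le> t"
      using order_tendstoD(1)[OF lim, of y k] eventually_ge_at_top[of 0] by (intro eventually_conj) auto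
    then obtain T where T: "y < flow T $ k" "0 \<le> T"
      unfolding eventually_at_top_linorder by (meson order_refl)
    have "flow T $ one < 1" by (rule flow_less_one[OF T(2)])
    then have "\<forall>\<^sub>F x in at 1 within {0..1}. flow T $ one < x"
      by (intro order_tendstoD(1)[OF tendsto_ident_at])
    moreover have "\<forall>\<^sub>F x in at 1 within {0..1}. x \<in> {0..<1::real}"
      unfolding eventually_at_filter by (auto intro!: always_eventually)
    ultimately show "\<forall>\<^sub>F x in at 1 within {0..1}. y < V x $ k"
    proof eventually_elim
      case (elim x)
      then have x: "0 \<le> x" "x < 1" by auto
      have "?f T < ?f (\<tau> x)"
        using elim f_\<tau>[of x] f_half x T(2) by (simp add: flow_ext_eq)
      then have "T < \<tau> x" using inc[of T "\<tau> x"] T(2) \<tau>_nn[OF x] by simp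
      then have "flow T $ k \<le> flow (\<tau> x) $ k" using flow_mono[OF T(2)] by (auto simp: less_eq_vec_def)
      with T(1) x show ?case by (simp add: V_def)
    qed
  next
    fix y :: real assume "1 < y"
    moreover have "\<forall>\<^sub>F x in at 1 within {0..1}. x \<in> {0..1::real}"
      by (auto simp: eventually_at_filter)
    then show "\<forall>\<^sub>F x in at 1 within {0..1}. V x $ k < y"
    proof eventually_elim
      case (elim x)
      then have "V x $ k \<le> 1" by (intro cubeD V_cube) auto
      with \<open>1 < y\<close> show ?case by simp
    qed
  qed
  then have V_lim: "(V \<longlongrightarrow> 1) (at 1 within {0..1})"
    by (intro vec_tendstoI) simp
  have "continuous_on {0..1} V"
    unfolding continuous_on_def
  proof
    fix x :: real assume x: "x \<in> {0..1}"
    show "(V \<longlongrightarrow> V x) (at x within {0..1})"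
    proof (cases "x = 1")
      case False
      then have "((\<lambda>y. V y $ k) \<longlongrightarrow> V x $ k) (at x within {0..1})" for k
        using has_field_derivative_imp_has_derivative[OF V_deriv[of x k], THEN has_derivative_continuous] x
        by (simp add: continuous_within)
      then show ?thesis by (rule vec_tendstoI)
    qed (use V_lim in \<open>simp add: V_def\<close>)
  qed
  then have "branching_curve b one V"
    unfolding branching_curve_def
    using V_one V_cube V_deriv by (auto simp: V_def \<tau>_0 flow_zero)
  moreover have "V x $ k < 1" if "0 \<le> x" "x < 1" for x k
    using that by (simp add: V_def flow_less_one \<tau>_nn)
  moreover have "B one (V x) > 0" if "0 \<le> x" "x < 1" for x
  proof -
    have "0 < exp (- c one * \<tau> x) * B one 0" using one by simp
    also have "\<dots> \<le> B one (flow (\<tau> x))" by (rule B_flow_ge[OF \<tau>_nn[OF that]])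
    finally show ?thesis using that by (simp add: V_def)
  qed
  ultimately show ?thesis using that by blast
qed

section \<open>Uniqueness of the branching curve\<close>

lemma B_bounded:
  assumes "u \<in> {0..1}" shows "\<bar>B k u\<bar> \<le> c k"
proof -
  have "0 \<le> c k * u $ k" "c k * u $ k \<le> c k"
    using cubeD[OF assms, of k] c_pos[of k] by (auto intro: mult_left_le)
  then show ?thesis using R_nonneg[OF assms, of k] R_le[OF assms, of k] by (simp add: B_eq[OF assms])
qed

lemma branching_curve_D:
  assumes "branching_curve b one U" "0 \<le> x" "x \<le> 1"
  shows "U x \<in> {0..1}" "U x $ one = x"
  using assms unfolding branching_curve_def by auto

text \<open>For \<open>k = one\<close> the coordinate is the parameter and the quotient is
  \<open>1\<close>, provided the denominator is nonzero. All coordinates can then be treated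
  alike.\<close>

lemma branching_curve_derivative:
  assumes U: "branching_curve b one U" and x: "0 \<le> x" "x < 1" and ne: "B one (U x) \<noteq> 0"
  shows "((\<lambda>y. U y $ k) has_real_derivative B k (U x) / B one (U x)) (at x within {0..1})"
proof (cases "k = one")
  case True
  have "((\<lambda>y. y) has_real_derivative 1) (at x within {0..1})" by (rule DERIV_ident)
  then have "((\<lambda>y. U y $ one) has_real_derivative 1) (at x within {0..1})"
    by (rule has_field_derivative_transform_within[where d=1])
       (use x branching_curve_D[OF U] in auto)
  then show ?thesis using ne True by simp
next
  case False
  then show ?thesis using U x unfolding branching_curve_def by auto
qed

text \<open>Gronwall's argument. Positivity of \<open>B one\<close> is given only at the common
  point; continuity keeps both denominators above \<open>m\<close> for a short while, and there the
  right-hand side is Lipschitz.\<close>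

lemma branching_curve_unique_local:
  assumes U: "branching_curve b one U" and V: "branching_curve b one V"
    and s: "0 \<le> s" "s < x1" "x1 < 1" "U s = V s" and pos: "B one (V s) > 0"
  obtains x where "s < x" "x \<le> x1" "U x = V x"
proof -
  define m where "m = B one (V s) / 2"
  have m: "m > 0" "m < B one (V s)" using pos by (auto simp: m_def)
  have ev: "\<forall>\<^sub>F y in at s within {0..1}. m < B one (W y)" if W: "branching_curve b one W" "W s = V s" for W
  proof -
    have "continuous_on {0..1} (\<lambda>y. B one (W y))"
      by (rule continuous_on_compose2[OF continuous_on_B])
         (use W(1) in \<open>auto simp: branching_curve_def\<close>)
    then have "((\<lambda>y. B one (W y)) \<longlongrightarrow> B one (V s)) (at s within {0..1})"
      unfolding continuous_on_def W(2)[symmetric] by (rule bspec) (use s in auto)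
    then show ?thesis by (rule order_tendstoD(1)) (rule m(2))
  qed
  have "\<forall>\<^sub>F y in at s within {0..1}. m < B one (U y) \<and> m < B one (V y)"
    by (intro eventually_conj ev U V s) simp
  then obtain d where d: "d > 0" "\<And>y. y \<in> {0..1} \<Longrightarrow> y \<noteq> s \<Longrightarrow> dist y s < d \<Longrightarrow> m < B one (U y) \<and> m < B one (V y)"
    unfolding eventually_at by blast
  define x where "x = min x1 (s + d / 2)"
  have x: "s < x" "x \<le> x1" using d(1) s by (auto simp: x_def)
  have big: "m < B one (U y)" "m < B one (V y)" if "s \<le> y" "y \<le> x" for y
    using that d(2)[of y] d(1) m(2) s x by (cases "y = s"; auto simp: x_def dist_real_def)+
  have I: "0 \<le> y" "y < 1" "y \<le> 1" if "s \<le> y" "y \<le> x" for y using that s x by auto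
  obtain L where L: "L > 0" "\<And>k u v. u \<in> {0..1} \<Longrightarrow> v \<in> {0..1} \<Longrightarrow> \<bar>B k u - B k v\<bar> \<le> L * norm (u - v)"
    using B_lipschitz by blast
  define C where "C = (\<Sum>k\<in>UNIV. c k)"
  have C: "\<bar>B k u\<bar> \<le> C" if "u \<in> {0..1}" for k u
    using B_bounded[OF that, of k] member_le_sum[of k UNIV c] c_pos unfolding C_def
    by (auto intro: order_trans less_imp_le)
  have "C \<ge> 0" unfolding C_def by (intro sum_nonneg) (use c_pos in \<open>auto intro: less_imp_le\<close>)
  define K where "K = L / m + C * L / (m * m)"
  define F where "F k u = B k u / B one u" for k u
  have F: "\<bar>F k (U y) - F k (V y)\<bar> \<le> K * norm (U y - V y)" if y: "s \<le> y" "y \<le> x" for k y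
  proof -
    let ?N = "norm (U y - V y)"
    have u: "U y \<in> {0..1}" and v: "V y \<in> {0..1}"
      using branching_curve_D(1)[OF U] branching_curve_D(1)[OF V] I[OF y] by auto
    define p where "p = B one (U y)"
    define r where "r = B one (V y)"
    have pr: "m < p" "m < r" using big[OF y] by (auto simp: p_def r_def)
    \<comment> \<open>Separating the change of the numerator from that of the denominator gives the
      two summands of \<open>K\<close>.\<close>
    have "F k (U y) - F k (V y) = (B k (U y) - B k (V y)) / p + B k (V y) * (r - p) / (p * r)"
      using pr m(1) by (simp add: F_def p_def[symmetric] r_def[symmetric] field_simps)
    also have "\<bar>\<dots>\<bar> \<le> \<bar>(B k (U y) - B k (V y)) / p\<bar> + \<bar>B k (V y) * (r - p) / (p * r)\<bar>"
      by (rule abs_triangle_ineq)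
    also have "\<dots> \<le> L * ?N / m + C * (L * ?N) / (m * m)"
    proof (rule add_mono)
      have "\<bar>(B k (U y) - B k (V y)) / p\<bar> = \<bar>B k (U y) - B k (V y)\<bar> / p"
        using pr m(1) by (simp add: abs_divide)
      also have "\<dots> \<le> L * ?N / m"
        using pr m(1) L(1) L(2)[OF u v, of k] by (intro frac_le) auto
      finally show "\<bar>(B k (U y) - B k (V y)) / p\<bar> \<le> L * ?N / m" .
      have "\<bar>r - p\<bar> \<le> L * ?N" using L(2)[OF v u, of one] by (simp add: p_def r_def norm_minus_commute)
      then have "\<bar>B k (V y)\<bar> * \<bar>r - p\<bar> \<le> C * (L * ?N)"
        using C[OF v, of k] \<open>C \<ge> 0\<close> by (intro mult_mono) auto
      moreover have "m * m \<le> p * r" using pr m(1) by (intro mult_mono) auto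
      moreover have "0 \<le> C * (L * ?N)" using \<open>C \<ge> 0\<close> L(1) by simp
      ultimately have "\<bar>B k (V y)\<bar> * \<bar>r - p\<bar> / (p * r) \<le> C * (L * ?N) / (m * m)"
        using m(1) by (intro frac_le) auto
      then show "\<bar>B k (V y) * (r - p) / (p * r)\<bar> \<le> C * (L * ?N) / (m * m)"
        using pr m(1) by (simp add: abs_mult abs_divide)
    qed
    also have "\<dots> = K * ?N" by (simp add: K_def algebra_simps add_divide_distrib)
    finally show ?thesis .
  qed
  define E where "E y = (\<Sum>k\<in>UNIV. (U y $ k - V y $ k)\<^sup>2)" for y
  have E_norm: "E y = (norm (U y - V y))\<^sup>2" for y
    by (simp add: E_def norm_vec_def L2_set_def real_sqrt_pow2 sum_nonneg)
  define E1 where "E1 y = (\<Sum>k\<in>UNIV. 2 * (U y $ k - V y $ k) * (F k (U y) - F k (V y)))" for y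
  define M where "M = 2 * real CARD('n) * K"
  have E_deriv: "(E has_real_derivative E1 y) (at y within {0..1})"
    if y: "s \<le> y" "y \<le> x" for y
  proof -
    have "((\<lambda>z. U z $ k) has_real_derivative F k (U y)) (at y within {0..1})"
      "((\<lambda>z. V z $ k) has_real_derivative F k (V y)) (at y within {0..1})" for k
      unfolding F_def using big[OF y] m(1) I[OF y]
      by (auto intro!: branching_curve_derivative U V)
    then show ?thesis unfolding E_def E1_def
      by (auto intro!: derivative_eq_intros sum.cong simp: power2_eq_square algebra_simps)
  qed
  have E_le: "E1 y \<le> M * E y"
    if y: "s \<le> y" "y \<le> x" for y
  proof -
    have "2 * (U y $ k - V y $ k) * (F k (U y) - F k (V y)) \<le> 2 * K * E y" for k
    proof -
      have "(U y $ k - V y $ k) * (F k (U y) - F k (V y)) \<le> \<bar>U y $ k - V y $ k\<bar> * \<bar>F k (U y) - F k (V y)\<bar>"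
        by (metis abs_ge_self abs_mult)
      also have "\<dots> \<le> norm (U y - V y) * (K * norm (U y - V y))"
        using component_le_norm_cart[of "U y - V y" k] by (intro mult_mono F[OF y]) auto
      also have "\<dots> = K * E y" unfolding E_norm by (simp add: power2_eq_square)
      finally have "2 * ((U y $ k - V y $ k) * (F k (U y) - F k (V y))) \<le> 2 * (K * E y)"
        by (rule mult_left_mono) simp
      then show ?thesis by (simp only: mult.assoc)
    qed
    then have "E1 y \<le> (\<Sum>k::'n\<in>UNIV. 2 * K * E y)"
      unfolding E1_def by (intro sum_mono)
    also have "\<dots> = M * E y" by (simp add: M_def)
    finally show ?thesis .
  qed
  \<comment> \<open>The differential inequality \<open>E1 y \<le> M * E y\<close> says that
    \<open>H\<close> does not increase, and \<open>H\<close> starts at \<open>0\<close>.\<close>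
  define H where "H y = exp (- M * y) * E y" for y
  have "H x \<le> H s"
  proof (rule DERIV_nonpos_imp_decreasing_open[where f=H and a=s and b=x])
    show "s \<le> x" using x by simp
    show "\<exists>z. (H has_real_derivative z) (at y) \<and> z \<le> 0" if y: "s < y" "y < x" for y
    proof -
      have "at y within {0..1} = at y"
        using y s x by (intro at_within_interior) (auto simp: interior_atLeastAtMost_real)
      then have E': "(E has_real_derivative E1 y) (at y)"
        using E_deriv[of y] y by simp
      have "(H has_real_derivative (exp (- M * y) * (- M)) * E y
          + E1 y * exp (- M * y)) (at y)"
        unfolding H_def by (rule DERIV_mult) (auto intro!: derivative_eq_intros E')
      moreover have "(exp (- M * y) * (- M)) * E y
          + E1 y * exp (- M * y) \<le> 0"
        using mult_right_mono[OF E_le[of y], of "exp (- M * y)"] y by (simp add: algebra_simps)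
      ultimately show ?thesis by blast
    qed
    have "continuous_on {s..x} U" "continuous_on {s..x} V"
      by (rule continuous_on_subset[of "{0..1}"], use U V s x in \<open>auto simp: branching_curve_def\<close>)+
    then show "continuous_on {s..x} H"
      unfolding H_def[abs_def] E_def by (intro continuous_intros continuous_on_component)
  qed
  also have "H s = 0" by (simp add: H_def E_norm s(4))
  finally have "E x \<le> 0" by (simp add: H_def mult_le_0_iff)
  then have "U x = V x" by (simp add: E_norm)
  with x that show ?thesis by blast
qed

text \<open>The local lemma would extend agreement beyond the last point of agreement before
  \<open>x\<close>. Positivity is asked of \<open>V\<close> alone, so that \<open>U\<close> may be
  an arbitrary solution.\<close>

lemma branching_curve_unique:
  assumes U: "branching_curve b one U" and V: "branching_curve b one V"
    and pos: "\<And>x. 0 \<le> x \<Longrightarrow> x < 1 \<Longrightarrow> B one (V x) > 0"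
    and x: "0 \<le> x" "x \<le> 1"
  shows "U x = V x"
proof (cases "x = 1")
  case True
  then show ?thesis using U V by (simp add: branching_curve_def)
next
  case False
  show ?thesis
  proof (rule ccontr)
    assume ne: "U x \<noteq> V x"
    define S where "S = {y \<in> {0..x}. U y = V y}"
    have "continuous_on {0..x} U" "continuous_on {0..x} V"
      by (rule continuous_on_subset[of "{0..1}"], use U V x in \<open>auto simp: branching_curve_def\<close>)+
    then have "closed {y \<in> {0..x}. U y - V y = 0}"
      by (intro continuous_closed_preimage_constant continuous_intros) auto
    then have "closed S" by (simp add: S_def)
    moreover have "bounded S" by (rule bounded_subset[of "{0..x}"]) (auto simp: S_def)
    moreover have "0 \<in> S" using U V x by (auto simp: S_def branching_curve_def)
    ultimately obtain s where s: "s \<in> S" "\<And>y. y \<in> S \<Longrightarrow> y \<le> s"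
      using compact_attains_sup[of S] by (auto simp: compact_eq_bounded_closed)
    have "s < x" using s(1) ne by (auto simp: S_def less_le)
    obtain y where "s < y" "y \<le> x" "U y = V y"
      by (rule branching_curve_unique_local[OF U V, of s x])
         (use s(1) \<open>s < x\<close> x False pos in \<open>auto simp: S_def\<close>)
    with s(2)[of y] s(1) show False by (auto simp: S_def)
  qed
qed

end

section \<open>The integral J\<close>

lemma nn_integral_eq_integral_Icc:
  fixes g :: "real \<Rightarrow> real"
  assumes "continuous_on {a..b} g" "\<And>x. x \<in> {a..b} \<Longrightarrow> g x \<ge> 0"
  shows "(\<integral>\<^sup>+x\<in>{a..b}. ennreal (g x) \<partial>lborel) = ennreal (integral {a..b} g)"
  by (rule nn_integral_has_integral_lebesgue'[OF assms(2)])
     (use assms(1) in \<open>auto intro: integrable_integral integrable_continuous_real\<close>)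

lemma has_sum_if_nn_integral_count_space:
  fixes f :: "'s \<Rightarrow> real"
  assumes "(\<integral>\<^sup>+k. ennreal (f k) \<partial>count_space A) = ennreal x" "x \<ge> 0" "\<And>k. k \<in> A \<Longrightarrow> f k \<ge> 0"
  shows "(f has_sum x) A"
proof -
  have s: "f summable_on A"
    by (rule summable_on_if_nn_integral_count_space_le(1)[where x=x]) (use assms in auto)
  have "ennreal (infsum f A) = ennreal x"
    using nn_integral_count_space_eq_has_sum[OF has_sum_infsum[OF s] assms(3)] assms(1) by simp
  then have "infsum f A = x"
    using assms(2) infsum_nonneg[of A f] assms(3) by simp
  with has_sum_infsum[OF s] show ?thesis by simp
qed

lemma finite_bounded_nat_vec: "finite {m :: nat^'n. \<forall>l. m $ l < N}"
proof (rule finite_subset)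
  show "{m :: nat^'n. \<forall>l. m $ l < N} \<subseteq> vec_lambda ` (UNIV \<rightarrow>\<^sub>E {..<N})"
  proof
    fix m :: "nat^'n" assume "m \<in> {m. \<forall>l. m $ l < N}"
    then have "(\<lambda>l. m $ l) \<in> UNIV \<rightarrow>\<^sub>E {..<N}" by auto
    moreover have "m = vec_lambda (\<lambda>l. m $ l)" by simp
    ultimately show "m \<in> vec_lambda ` (UNIV \<rightarrow>\<^sub>E {..<N})" by blast
  qed
  show "finite (vec_lambda ` (UNIV \<rightarrow>\<^sub>E {..<N}) :: (nat^'n) set)"
    by (intro finite_imageI finite_PiE) auto
qed

locale nTBI_curve = nTBI_mean Q h a b
  for Q :: "nat^'n \<Rightarrow> nat^'n \<Rightarrow> real" and h a b +
  fixes one :: 'n and V :: "real \<Rightarrow> real^'n"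
  assumes V: "branching_curve b one V"
    and V_less_one: "\<And>x k. 0 \<le> x \<Longrightarrow> x < 1 \<Longrightarrow> V x $ k < 1"
    and B_V_pos: "\<And>x. 0 \<le> x \<Longrightarrow> x < 1 \<Longrightarrow> B one (V x) > 0"
begin

definition \<Phi> :: "real \<Rightarrow> real" where
  "\<Phi> y = exp (integral {0..y} (\<lambda>x. A (V x) / B one (V x)))"

definition \<psi> :: "real \<Rightarrow> real" where "\<psi> y = 1 / B one (V y) * \<Phi> y"

definition I :: "real \<Rightarrow> nat^'n \<Rightarrow> real" where
  "I y m = integral {0..y} (\<lambda>x. vpow (V x) m * \<psi> x)"

lemma V_cube: "0 \<le> x \<Longrightarrow> x \<le> 1 \<Longrightarrow> V x \<in> {0..1}"
  and V_one: "0 \<le> x \<Longrightarrow> x \<le> 1 \<Longrightarrow> V x $ one = x"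
  by (rule branching_curve_D[OF V], assumption, assumption)+

lemma V_zero: "V 0 = 0" and V_at_one: "V 1 = 1" and continuous_on_V: "continuous_on {0..1} V"
  using V unfolding branching_curve_def by auto

lemma continuous_on_V_compose:
  assumes "continuous_on {0..1} f" "y < 1"
  shows "continuous_on {0..y} (\<lambda>x. f (V x))"
  by (rule continuous_on_compose2[OF assms(1) continuous_on_subset[OF continuous_on_V]])
     (use assms(2) V_cube in \<open>auto simp del: atLeastAtMost_iff simp: atLeastAtMost_iff[of _ 0]\<close>)

lemma continuous_on_ratio: "y < 1 \<Longrightarrow> continuous_on {0..y} (\<lambda>x. A (V x) / B one (V x))"
  using B_V_pos
  by (intro continuous_on_divide continuous_on_V_compose continuous_on_A continuous_on_B) force+

lemma continuous_on_\<Phi>: "y < 1 \<Longrightarrow> continuous_on {0..y} \<Phi>"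
  unfolding \<Phi>_def[abs_def]
  by (intro continuous_intros indefinite_integral_continuous_1 integrable_continuous_real continuous_on_ratio)

lemma continuous_on_\<psi>: "y < 1 \<Longrightarrow> continuous_on {0..y} \<psi>"
  unfolding \<psi>_def[abs_def] using B_V_pos
  by (intro continuous_on_mult continuous_on_divide continuous_on_const continuous_on_\<Phi>
      continuous_on_V_compose continuous_on_B) force+

lemma \<Phi>_pos: "\<Phi> y > 0" by (simp add: \<Phi>_def)

lemma \<psi>_pos: "0 \<le> y \<Longrightarrow> y < 1 \<Longrightarrow> \<psi> y > 0"
  unfolding \<psi>_def by (intro mult_pos_pos divide_pos_pos B_V_pos \<Phi>_pos) auto

lemma vpow_V: "0 \<le> x \<Longrightarrow> x < 1 \<Longrightarrow> 0 \<le> vpow (V x) m" "0 \<le> x \<Longrightarrow> x < 1 \<Longrightarrow> vpow (V x) m \<le> 1"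
  using vpow_nonneg[OF V_cube] vpow_le_one[OF V_cube] by auto

lemma continuous_on_integrand: "y < 1 \<Longrightarrow> continuous_on {0..y} (\<lambda>x. vpow (V x) m * \<psi> x)"
  by (intro continuous_intros continuous_on_\<psi> continuous_on_subset[OF continuous_on_V]) auto

lemma integrable_integrand: "y < 1 \<Longrightarrow> (\<lambda>x. vpow (V x) m * \<psi> x) integrable_on {0..y}"
  by (intro integrable_continuous_real continuous_on_integrand)

lemma integrand_nonneg: "0 \<le> x \<Longrightarrow> x < 1 \<Longrightarrow> 0 \<le> vpow (V x) m * \<psi> x"
  using vpow_V \<psi>_pos by (intro mult_nonneg_nonneg) (auto intro: less_imp_le)

lemma I_nonneg: "y < 1 \<Longrightarrow> 0 \<le> I y m"
  unfolding I_def by (intro integral_nonneg integrable_integrand integrand_nonneg) auto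

lemma I_combine:
  assumes "0 \<le> x" "x \<le> y" "y < 1"
  shows "I y m = I x m + integral {x..y} (\<lambda>x. vpow (V x) m * \<psi> x)"
  unfolding I_def using Henstock_Kurzweil_Integration.integral_combine[OF assms(1,2) integrable_integrand[OF assms(3)]] by simp

lemma I_le_I_zero: "y < 1 \<Longrightarrow> I y m \<le> I y 0"
  unfolding I_def
  by (intro integral_le integrable_integrand mult_right_mono) (use vpow_V \<psi>_pos in \<open>auto intro: less_imp_le\<close>)

text \<open>The second claim says that the gap to the value at \<open>0\<close> only widens with
  \<open>y\<close>, so that a strict gap at one \<open>y\<close> survives the limit.\<close>

lemma I_diff_mono:
  assumes "0 \<le> x" "x \<le> y" "y < 1"
  shows "I x m \<le> I y m" "I x 0 - I x m \<le> I y 0 - I y m"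
proof -
  have int: "(\<lambda>x. vpow (V x) m * \<psi> x) integrable_on {x..y}" for m
    by (rule integrable_subinterval_real[OF integrable_integrand[OF assms(3)]]) (use assms in auto)
  have "0 \<le> integral {x..y} (\<lambda>x. vpow (V x) m * \<psi> x)"
    by (intro integral_nonneg int integrand_nonneg) (use assms in auto)
  moreover have "integral {x..y} (\<lambda>x. vpow (V x) m * \<psi> x) \<le> integral {x..y} (\<lambda>x. vpow (V x) 0 * \<psi> x)"
    by (intro integral_le int mult_right_mono) (use vpow_V \<psi>_pos assms in \<open>auto intro: less_imp_le\<close>)
  ultimately show "I x m \<le> I y m" "I x 0 - I x m \<le> I y 0 - I y m"
    by (auto simp: I_combine[OF assms])
qed

definition drift :: "nat^'n \<Rightarrow> real^'n \<Rightarrow> real" where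
  "drift i u = (\<Sum>k\<in>UNIV. real (i $ k) * vpow u (i - axis k 1) * B k u) + vpow u i * A u"

text \<open>The integrand is the derivative of \<open>vpow (V x) i * \<Phi> x\<close>, since
  \<open>V' = B / B one\<close> and \<open>\<Phi>' = \<Phi> * A / B one\<close>. The boundary term
  at \<open>0\<close> vanishes because \<open>V 0 = 0\<close> and
  \<open>i \<noteq> 0\<close>.\<close>

lemma has_integral_drift:
  assumes i: "i \<noteq> 0" and y: "0 \<le> y" "y < 1"
  shows "((\<lambda>x. drift i (V x) * \<psi> x) has_integral (vpow (V y) i * \<Phi> y)) {0..y}"
proof -
  have "((\<lambda>x. drift i (V x) * \<psi> x) has_integral (vpow (V y) i * \<Phi> y - vpow (V 0) i * \<Phi> 0)) {0..y}"
  proof (rule fundamental_theorem_of_calculus_interior[OF y(1)])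
    show "continuous_on {0..y} (\<lambda>x. vpow (V x) i * \<Phi> x)"
      by (intro continuous_intros continuous_on_\<Phi> continuous_on_subset[OF continuous_on_V] y) (use y in auto)
    fix x assume x: "x \<in> {0<..<y}"
    have at: "at x within {0..1} = at x" "at x within {0..y} = at x"
      using x y by (intro at_within_interior; auto simp: interior_atLeastAtMost_real)+
    have pos: "B one (V x) > 0" using x y B_V_pos by auto
    have dV: "((\<lambda>z. V z $ k) has_real_derivative B k (V x) / B one (V x)) (at x)" for k
      using branching_curve_derivative[OF V, of x k] x y pos at(1) by auto
    have "((\<lambda>z. integral {0..z} (\<lambda>x. A (V x) / B one (V x))) has_real_derivative A (V x) / B one (V x)) (at x)"
      using integral_has_real_derivative[OF continuous_on_ratio[OF y(2)], of x] x at(2) by auto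
    then have d\<Phi>: "(\<Phi> has_real_derivative \<Phi> x * (A (V x) / B one (V x))) (at x)"
      unfolding \<Phi>_def[abs_def] by (rule DERIV_fun_exp)
    have "((\<lambda>x. vpow (V x) i * \<Phi> x) has_real_derivative
        (\<Sum>k\<in>UNIV. real (i $ k) * vpow (V x) (i - axis k 1) * (B k (V x) / B one (V x))) * \<Phi> x
        + (\<Phi> x * (A (V x) / B one (V x))) * vpow (V x) i) (at x)"
      by (rule DERIV_mult[OF has_real_derivative_vpow[OF dV] d\<Phi>])
    moreover have "(\<Sum>k\<in>UNIV. real (i $ k) * vpow (V x) (i - axis k 1) * (B k (V x) / B one (V x)))
        = (\<Sum>k\<in>UNIV. real (i $ k) * vpow (V x) (i - axis k 1) * B k (V x)) / B one (V x)"
      by (simp add: sum_divide_distrib)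
    then have "(\<Sum>k\<in>UNIV. real (i $ k) * vpow (V x) (i - axis k 1) * (B k (V x) / B one (V x))) * \<Phi> x
        + (\<Phi> x * (A (V x) / B one (V x))) * vpow (V x) i = drift i (V x) * \<psi> x"
      unfolding drift_def \<psi>_def by (simp add: add_divide_distrib ring_distribs)
    ultimately show "((\<lambda>x. vpow (V x) i * \<Phi> x) has_vector_derivative drift i (V x) * \<psi> x) (at x)"
      by (simp add: has_real_derivative_iff_has_vector_derivative)
  qed
  then show ?thesis using i by (simp add: V_zero vpow_zero_left)
qed

text \<open>Sum over states and integral are exchanged by Tonelli. This is why the diagonal is left
  out: the remaining terms are nonnegative.\<close>

lemma Q_I_has_sum:
  assumes i: "i \<noteq> 0" and y: "0 \<le> y" "y < 1"
  shows "((\<lambda>k. Q i k * I y k) has_sum (vpow (V y) i * \<Phi> y + (- Q i i) * I y i)) (UNIV - {i})"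
proof (rule has_sum_if_nn_integral_count_space)
  let ?C = "count_space (UNIV - {i})"
  let ?g = "\<lambda>x. drift i (V x) * \<psi> x + (- Q i i) * (vpow (V x) i * \<psi> x)"
  have cont: "continuous_on {0..y} (\<lambda>x. Q i k * (vpow (V x) k * \<psi> x))" for k
    by (intro continuous_intros continuous_on_integrand[OF y(2)])
  have "(\<integral>\<^sup>+k. ennreal (Q i k * I y k) \<partial>?C)
      = (\<integral>\<^sup>+k. \<integral>\<^sup>+x. ennreal (Q i k * (vpow (V x) k * \<psi> x)) * indicator {0..y} x \<partial>lborel \<partial>?C)"
  proof (intro nn_integral_cong)
    fix k assume "k \<in> space ?C"
    then have "Q i k \<ge> 0" using Q_nonneg by simp
    then have "(\<integral>\<^sup>+x. ennreal (Q i k * (vpow (V x) k * \<psi> x)) * indicator {0..y} x \<partial>lborel)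
       = ennreal (integral {0..y} (\<lambda>x. Q i k * (vpow (V x) k * \<psi> x)))"
      using y by (intro nn_integral_eq_integral_Icc cont mult_nonneg_nonneg[of "Q i k"] integrand_nonneg) auto
    then show "ennreal (Q i k * I y k) = (\<integral>\<^sup>+x. ennreal (Q i k * (vpow (V x) k * \<psi> x)) * indicator {0..y} x \<partial>lborel)"
      by (simp add: I_def)
  qed
  also have "\<dots> = (\<integral>\<^sup>+x. \<integral>\<^sup>+k. ennreal (Q i k * (vpow (V x) k * \<psi> x)) * indicator {0..y} x \<partial>?C \<partial>lborel)"
  proof (rule nn_integral_count_space_nn_integral[symmetric])
    fix k
    have "(\<lambda>x. indicator {0..y} x *\<^sub>R (Q i k * (vpow (V x) k * \<psi> x))) \<in> borel_measurable borel"
      by (intro borel_measurable_continuous_on_indicator cont) simp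
    then have "(\<lambda>x. ennreal (indicator {0..y} x *\<^sub>R (Q i k * (vpow (V x) k * \<psi> x)))) \<in> borel_measurable borel"
      by measurable
    also have "(\<lambda>x. ennreal (indicator {0..y} x *\<^sub>R (Q i k * (vpow (V x) k * \<psi> x))))
      = (\<lambda>x. ennreal (Q i k * (vpow (V x) k * \<psi> x)) * indicator {0..y} x)"
      by (auto simp: fun_eq_iff indicator_def)
    finally show "(\<lambda>x. ennreal (Q i k * (vpow (V x) k * \<psi> x)) * indicator {0..y} x) \<in> borel_measurable lborel"
      by simp
  qed simp
  also have "\<dots> = (\<integral>\<^sup>+x. ennreal (?g x) * indicator {0..y} x \<partial>lborel)"
  proof (intro nn_integral_cong)
    fix x :: real
    show "(\<integral>\<^sup>+k. ennreal (Q i k * (vpow (V x) k * \<psi> x)) * indicator {0..y} x \<partial>?C) = ennreal (?g x) * indicator {0..y} x"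
    proof (cases "x \<in> {0..y}")
      case True
      then have x: "0 \<le> x" "x < 1" "x \<le> 1" using y by auto
      have "((\<lambda>k. (Q i k * vpow (V x) k) * \<psi> x) has_sum ((drift i (V x) + (- Q i i) * vpow (V x) i) * \<psi> x)) (UNIV - {i})"
        unfolding drift_def by (intro has_sum_cmult_left Q_vpow_off_diagonal i V_cube x)
      then have "((\<lambda>k. Q i k * (vpow (V x) k * \<psi> x)) has_sum ?g x) (UNIV - {i})"
        by (simp add: mult.assoc ring_distribs)
      from nn_integral_count_space_eq_has_sum[OF this] True show ?thesis
        using Q_nonneg integrand_nonneg[OF x(1,2)] by auto
    qed simp
  qed
  also have "\<dots> = ennreal (vpow (V y) i * \<Phi> y + (- Q i i) * I y i)"
  proof (rule nn_integral_has_integral_lebesgue')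
    show "(?g has_integral (vpow (V y) i * \<Phi> y + (- Q i i) * I y i)) {0..y}"
      unfolding I_def
      by (intro has_integral_add has_integral_drift i y has_integral_mult_right integrable_integral integrable_integrand)
    show "0 \<le> ?g x" if "x \<in> {0..y}" for x
    proof -
      have x: "0 \<le> x" "x < 1" "x \<le> 1" using y that by auto
      have "((\<lambda>k. Q i k * vpow (V x) k) has_sum (drift i (V x) + (- Q i i) * vpow (V x) i)) (UNIV - {i})"
        unfolding drift_def by (intro Q_vpow_off_diagonal i V_cube x)
      then have "0 \<le> drift i (V x) + (- Q i i) * vpow (V x) i"
        by (rule has_sum_nonneg) (use Q_nonneg vpow_V x in auto)
      from mult_nonneg_nonneg[OF this less_imp_le[OF \<psi>_pos[OF x(1,2)]]] show ?thesis
        by (simp add: ring_distribs mult.assoc)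
    qed
  qed
  finally show "(\<integral>\<^sup>+k. ennreal (Q i k * I y k) \<partial>?C) = ennreal (vpow (V y) i * \<Phi> y + (- Q i i) * I y i)" .
  have "vpow (V y) i * \<Phi> y \<ge> 0" using vpow_V(1)[OF y] \<Phi>_pos[of y] by simp
  moreover have "(- Q i i) * I y i \<ge> 0" using Q_neg[of i] I_nonneg[OF y(2)] by (intro mult_nonneg_nonneg) auto
  ultimately show "0 \<le> vpow (V y) i * \<Phi> y + (- Q i i) * I y i" by simp
  show "0 \<le> Q i k * I y k" if "k \<in> UNIV - {i}" for k
    using that Q_nonneg I_nonneg[OF y(2)] by simp
qed

text \<open>The shift by \<open>2\<close> gives \<open>t 0 > 0\<close>, so that
  \<open>I (t n) 0\<close> is a positive denominator from the first index on.\<close>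

definition t :: "nat \<Rightarrow> real" where "t n = 1 - 1 / (real n + 2)"

lemma t: "0 < t n" "t n < 1" and t_mono: "m \<le> n \<Longrightarrow> t m \<le> t n" and t_lim: "t \<longlonglongrightarrow> 1"
proof -
  show "0 < t n" "t n < 1" by (auto simp: t_def field_simps)
  show "m \<le> n \<Longrightarrow> t m \<le> t n" by (auto simp: t_def frac_le)
  have "(\<lambda>n. 1 - 1 / real (n + 2)) \<longlonglongrightarrow> 1 - 0"
    by (intro tendsto_diff tendsto_const LIMSEQ_ignore_initial_segment[OF lim_1_over_n])
  then show "t \<longlonglongrightarrow> 1" by (simp add: t_def[abs_def] add.commute)
qed

lemma nn_integral_\<psi>: "(\<integral>\<^sup>+x\<in>{0<..<1}. ennreal (\<psi> x) \<partial>lborel) = (SUP n. ennreal (I (t n) 0))"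
proof -
  have "(\<integral>\<^sup>+x\<in>{0<..<1}. ennreal (\<psi> x) \<partial>lborel) = (\<integral>\<^sup>+x. (SUP n. ennreal (\<psi> x) * indicator {0..t n} x) \<partial>lborel)"
  proof (rule nn_integral_cong_AE)
    \<comment> \<open>The closed intervals contain \<open>0\<close> and the open one does not, hence
      equality only almost everywhere.\<close>
    show "AE x in lborel. ennreal (\<psi> x) * indicator {0<..<1} x = (SUP n. ennreal (\<psi> x) * indicator {0..t n} x)"
      using AE_lborel_singleton[of 0]
    proof eventually_elim
      case (elim x)
      show ?case
      proof (cases "0 < x \<and> x < 1")
        case True
        then have "\<forall>\<^sub>F n in sequentially. x < t n" using order_tendstoD(1)[OF t_lim] by blast
        then obtain n where "x < t n" unfolding eventually_sequentially by blast
        with True have "ennreal (\<psi> x) \<le> (SUP n. ennreal (\<psi> x) * indicator {0..t n} x)"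
          by (intro SUP_upper2[of n]) auto
        moreover have "(SUP n. ennreal (\<psi> x) * indicator {0..t n} x) \<le> ennreal (\<psi> x)"
          by (intro SUP_least) (auto simp: indicator_def)
        ultimately show ?thesis using True by (simp add: antisym)
      next
        case False
        have "x \<notin> {0..t n}" for n using False elim t(2)[of n] by auto
        then have ind: "indicator {0..t n} x = (0 :: ennreal)" for n by simp
        show ?thesis unfolding ind using False by simp
      qed
    qed
  qed
  also have "\<dots> = (SUP n. \<integral>\<^sup>+x. ennreal (\<psi> x) * indicator {0..t n} x \<partial>lborel)"
  proof (rule nn_integral_monotone_convergence_SUP)
    show "incseq (\<lambda>n x. ennreal (\<psi> x) * indicator {0..t n} x)"
      using t_mono by (auto simp: incseq_def le_fun_def indicator_def intro: order_trans)
    fix n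
    have "(\<lambda>x. indicator {0..t n} x *\<^sub>R \<psi> x) \<in> borel_measurable borel"
      by (intro borel_measurable_continuous_on_indicator continuous_on_\<psi> t) simp
    then have "(\<lambda>x. ennreal (indicator {0..t n} x *\<^sub>R \<psi> x)) \<in> borel_measurable borel"
      by measurable
    also have "(\<lambda>x. ennreal (indicator {0..t n} x *\<^sub>R \<psi> x)) = (\<lambda>x. ennreal (\<psi> x) * indicator {0..t n} x)"
      by (auto simp: fun_eq_iff indicator_def)
    finally show "(\<lambda>x. ennreal (\<psi> x) * indicator {0..t n} x) \<in> borel_measurable lborel" by simp
  qed
  also have "(\<lambda>n. \<integral>\<^sup>+x. ennreal (\<psi> x) * indicator {0..t n} x \<partial>lborel) = (\<lambda>n. ennreal (I (t n) 0))"
  proof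
    fix n
    show "(\<integral>\<^sup>+x. ennreal (\<psi> x) * indicator {0..t n} x \<partial>lborel) = ennreal (I (t n) 0)"
      unfolding I_def vpow_zero_right mult_1
      using t[of n] by (intro nn_integral_eq_integral_Icc continuous_on_\<psi> less_imp_le[OF \<psi>_pos]) auto
  qed
  finally show ?thesis .
qed

end

section \<open>Recurrence and transience\<close>

context nTBI_curve
begin

lemma vpow_V_le_power:
  assumes "0 \<le> x" "x < 1" "V x $ l \<le> r"
  shows "vpow (V x) m \<le> r ^ (m $ l)"
proof -
  have cube: "0 \<le> V x $ k \<and> V x $ k \<le> 1" for k using cubeD[OF V_cube[of x], of k] assms by auto
  have "vpow (V x) m = V x $ l ^ (m $ l) * (\<Prod>k\<in>UNIV - {l}. V x $ k ^ m $ k)"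
    unfolding vpow_def by (rule prod.remove) auto
  also have "\<dots> \<le> V x $ l ^ (m $ l) * 1"
    using cube by (intro mult_left_mono prod_le_1 conjI zero_le_power power_le_one) auto
  also have "\<dots> \<le> r ^ (m $ l)" using cube assms(3) by (simp add: power_mono)
  finally show ?thesis .
qed

lemma I_zero_pos: "0 < y \<Longrightarrow> y < 1 \<Longrightarrow> I y 0 > 0"
proof -
  assume y: "0 < y" "y < 1"
  have "integral {0..y} (\<lambda>_. 0) < integral {0..y} (\<lambda>x. vpow (V x) 0 * \<psi> x)"
    by (rule integral_less_real) (use y \<psi>_pos in \<open>auto intro: continuous_on_\<psi>\<close>)
  then show ?thesis by (simp add: I_def)
qed

text \<open>On \<open>{0..y}\<close> all coordinates of the curve stay below a common
  \<open>\<rho> < 1\<close>, so the ratio is at most \<open>\<rho>\<close> to the power of any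
  coordinate of \<open>m\<close>.\<close>

lemma I_decay:
  assumes y: "0 < y" "y < 1" and e: "e > 0"
  shows "finite {m. I y m / I y 0 > e}"
proof -
  have "\<exists>r. r < 1 \<and> (\<forall>x\<in>{0..y}. V x $ l \<le> r)" for l
  proof -
    have "\<exists>x\<in>{0..y}. \<forall>z\<in>{0..y}. V z $ l \<le> V x $ l"
      by (rule continuous_attains_sup)
         (use y in \<open>auto intro!: continuous_on_component continuous_on_subset[OF continuous_on_V]\<close>)
    then obtain x where x: "x \<in> {0..y}" "\<forall>z\<in>{0..y}. V z $ l \<le> V x $ l" by blast
    moreover have "V x $ l < 1" using x(1) y by (intro V_less_one) auto
    ultimately show ?thesis by blast
  qed
  then obtain r where r: "\<And>l. r l < 1" "\<And>l x. x \<in> {0..y} \<Longrightarrow> V x $ l \<le> r l" by metis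
  define \<rho> where "\<rho> = (MAX l. r l)"
  have \<rho>_ge: "r l \<le> \<rho>" for l unfolding \<rho>_def by (rule Max_ge) auto
  have \<rho>: "\<rho> < 1" unfolding \<rho>_def using r(1) by (subst Max_less_iff) auto
  have "0 \<le> V 0 $ one" by (simp add: V_zero)
  also have "\<dots> \<le> \<rho>" using r(2)[of 0 one] \<rho>_ge[of one] y by simp
  finally have \<rho>0: "0 \<le> \<rho>" .
  have le: "I y m / I y 0 \<le> \<rho> ^ (m $ l)" for m l
  proof -
    have "I y m \<le> integral {0..y} (\<lambda>x. \<rho> ^ (m $ l) * (vpow (V x) 0 * \<psi> x))"
      unfolding I_def
    proof (rule integral_le)
      fix x assume x: "x \<in> {0..y}"
      have "vpow (V x) m * \<psi> x \<le> \<rho> ^ (m $ l) * \<psi> x"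
        by (rule mult_right_mono[OF vpow_V_le_power]) (use x y r(2)[of x l] \<rho>_ge[of l] \<psi>_pos[of x] in auto)
      then show "vpow (V x) m * \<psi> x \<le> \<rho> ^ (m $ l) * (vpow (V x) 0 * \<psi> x)" by simp
    qed (use y in \<open>auto intro!: integrable_integrand integrable_on_mult_right simp del: vpow_zero_right\<close>)
    also have "\<dots> = \<rho> ^ (m $ l) * I y 0" by (simp add: I_def)
    finally show ?thesis using I_zero_pos[OF y] by (simp add: divide_le_eq)
  qed
  obtain N where N: "\<rho> ^ N < e" using real_arch_pow_inv[OF e \<rho>] by blast
  have "{m. I y m / I y 0 > e} \<subseteq> {m. \<forall>l. m $ l < N}"
  proof (clarify, rule ccontr)
    fix m l assume *: "e < I y m / I y 0" "\<not> m $ l < N"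
    have "\<rho> ^ (m $ l) \<le> \<rho> ^ N" using * \<rho> \<rho>0 by (intro power_decreasing) auto
    with le[of m l] N *(1) show False by simp
  qed
  then show ?thesis using finite_bounded_nat_vec finite_subset by blast
qed

text \<open>Infinite mass of \<open>\<psi>\<close> must accumulate at the endpoint, where the
  monomial tends to \<open>1\<close>; the bounded mass before \<open>x0\<close> becomes
  negligible.\<close>

lemma I_ratio_tendsto:
  assumes inf: "filterlim (\<lambda>n. I (t n) 0) at_top sequentially"
  shows "(\<lambda>n. I (t n) m / I (t n) 0) \<longlonglongrightarrow> 1"
proof (rule order_tendstoI)
  fix z :: real assume "1 < z"
  have "I (t n) m / I (t n) 0 \<le> 1" for n
    using I_le_I_zero[OF t(2)] I_zero_pos[OF t] by simp
  with \<open>1 < z\<close> show "\<forall>\<^sub>F n in sequentially. I (t n) m / I (t n) 0 < z"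
    by (intro always_eventually allI) (meson le_less_trans)
next
  fix z :: real assume z: "z < 1"
  \<comment> \<open>One \<open>e\<close> pays for the deviation of the monomial from
    \<open>1\<close> beyond \<open>x0\<close>, the other for the mass before
    \<open>x0\<close>.\<close>
  define e where "e = (1 - z) / 2"
  have e: "0 < e" "2 * e = 1 - z" using z by (auto simp: e_def)
  have "continuous_on {0..1} (\<lambda>x. vpow (V x) m)"
    by (intro continuous_intros continuous_on_V)
  then have "((\<lambda>x. vpow (V x) m) \<longlongrightarrow> vpow (V 1) m) (at 1 within {0..1})"
    by (simp add: continuous_on_def)
  then have "\<forall>\<^sub>F x in at 1 within {0..1}. 1 - e < vpow (V x) m"
    by (rule order_tendstoD) (use e in \<open>simp add: V_at_one\<close>)
  then obtain d where d: "d > 0" "\<And>x. x \<in> {0..1} \<Longrightarrow> x \<noteq> 1 \<Longrightarrow> dist x 1 < d \<Longrightarrow> 1 - e < vpow (V x) m"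
    unfolding eventually_at by blast
  define x0 where "x0 = max 0 (1 - d / 2)"
  have x0: "0 \<le> x0" "x0 < 1" using d(1) by (auto simp: x0_def)
  have near: "1 - e < vpow (V x) m" if "x0 \<le> x" "x < 1" for x
    by (rule d(2)) (use that d(1) in \<open>auto simp: x0_def dist_real_def\<close>)
  have bound: "I y 0 - I y m \<le> I x0 0 + e * I y 0" if y: "x0 \<le> y" "y < 1" for y
  proof -
    have int: "(\<lambda>x. vpow (V x) m * \<psi> x) integrable_on {x0..y}" for m
      by (rule integrable_subinterval_real[OF integrable_integrand[OF y(2)]]) (use x0 in auto)
    have "integral {x0..y} (\<lambda>x. (1 - e) * (vpow (V x) 0 * \<psi> x)) \<le> integral {x0..y} (\<lambda>x. vpow (V x) m * \<psi> x)"
    proof (rule integral_le)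
      fix x assume "x \<in> {x0..y}"
      then have "(1 - e) * \<psi> x \<le> vpow (V x) m * \<psi> x"
        using near[of x] \<psi>_pos[of x] y x0 by (intro mult_right_mono) auto
      then show "(1 - e) * (vpow (V x) 0 * \<psi> x) \<le> vpow (V x) m * \<psi> x" by simp
    qed (intro int integrable_on_mult_right)+
    then have "(1 - e) * integral {x0..y} (\<lambda>x. vpow (V x) 0 * \<psi> x) \<le> integral {x0..y} (\<lambda>x. vpow (V x) m * \<psi> x)"
      by (simp only: integral_mult_right)
    then have "(1 - e) * (I y 0 - I x0 0) \<le> I y m - I x0 m"
      using I_combine[OF x0(1) y, of m] I_combine[OF x0(1) y, of 0] by simp
    moreover have "I x0 m \<ge> 0" "e * I x0 0 \<ge> 0" using I_nonneg[OF x0(2)] e(1) by auto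
    ultimately show ?thesis by (simp add: algebra_simps)
  qed
  have "\<forall>\<^sub>F n in sequentially. x0 < t n \<and> I x0 0 / e < I (t n) 0"
    by (intro eventually_conj order_tendstoD(1)[OF t_lim x0(2)] filterlim_at_top_dense[THEN iffD1, OF inf, rule_format])
  then show "\<forall>\<^sub>F n in sequentially. z < I (t n) m / I (t n) 0"
  proof eventually_elim
    case (elim n)
    have "I x0 0 < e * I (t n) 0" using elim e(1) by (simp add: divide_less_eq mult.commute)
    then have "I (t n) 0 - I (t n) m < 2 * e * I (t n) 0"
      using bound[of "t n"] elim t(2)[of n] by simp
    moreover have "2 * e * I (t n) 0 = (1 - z) * I (t n) 0" by (simp only: e(2))
    ultimately have "z * I (t n) 0 < I (t n) m" by (simp add: algebra_simps)
    then show ?case using I_zero_pos[OF t, of n] by (simp add: less_divide_eq)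
  qed
qed

lemma recurrent_if_J_infinite:
  assumes rho: "rho b 1 \<le> 0" and one: "B one 0 > 0"
    and J: "(\<integral>\<^sup>+x\<in>{0<..<1}. ennreal (\<psi> x) \<partial>lborel) = \<infinity>"
  shows "green Q j j = \<infinity>"
proof (rule recurrent_if_subharmonic_family[OF Q_neg Q_nonneg Q_conservative irreducible[OF rho one],
      where z=0 and f="\<lambda>n m. I (t n) m / I (t n) 0"])
  show "I (t n) 0 / I (t n) 0 = 1" for n using I_zero_pos[OF t, of n] by simp
  show "finite {m. e < I (t n) m / I (t n) 0}" if "e > 0" for e n
    by (rule I_decay[OF t that])
  have "filterlim (\<lambda>n. I (t n) 0) at_top sequentially"
    unfolding filterlim_at_top
  proof
    fix Z :: real
    have "ennreal (max 0 Z) < (SUP n. ennreal (I (t n) 0))"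
      unfolding nn_integral_\<psi>[symmetric] J by simp
    then obtain n where n: "ennreal (max 0 Z) < ennreal (I (t n) 0)" by (auto simp: less_SUP_iff)
    then have "Z \<le> I (t n) 0" by (auto simp: ennreal_less_iff)
    then have "Z \<le> I (t m) 0" if "n \<le> m" for m
      using I_diff_mono(1)[of "t n" "t m" 0] t_mono[OF that] t by (meson less_imp_le order_trans)
    then show "\<forall>\<^sub>F n in sequentially. Z \<le> I (t n) 0" unfolding eventually_sequentially by blast
  qed
  then show "(\<lambda>n. I (t n) k / I (t n) 0) \<longlonglongrightarrow> 1" for k by (rule I_ratio_tendsto)
  fix n and i :: "nat^'n" assume i: "i \<noteq> 0"
  have y: "0 \<le> t n" "t n < 1" using t[of n] by auto
  from has_sum_cmult_left[OF Q_I_has_sum[OF i y], of "1 / I (t n) 0"]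
  have "((\<lambda>k. Q i k * (I (t n) k / I (t n) 0)) has_sum
      (vpow (V (t n)) i * \<Phi> (t n) / I (t n) 0 + - Q i i * (I (t n) i / I (t n) 0))) (UNIV - {i})"
    by (simp add: add_divide_distrib diff_divide_distrib)
  moreover have "0 \<le> vpow (V (t n)) i * \<Phi> (t n) / I (t n) 0"
    using vpow_V(1)[OF y] \<Phi>_pos I_zero_pos[OF t, of n] by (simp add: less_imp_le)
  ultimately show "\<exists>s. ((\<lambda>k. Q i k * (I (t n) k / I (t n) 0)) has_sum s) (UNIV - {i}) \<and>
      - Q i i * (I (t n) i / I (t n) 0) \<le> s"
    by (intro exI conjI) auto
qed

section \<open>Transience when J is finite\<close>

lemma \<Phi>_mono:
  assumes "0 \<le> x" "x \<le> y" "y < 1" shows "\<Phi> y \<le> \<Phi> x"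
proof -
  have "integral {x..y} (\<lambda>x. A (V x) / B one (V x)) \<le> 0"
  proof (rule has_integral_le[OF integrable_integral, OF _ has_integral_0])
    show "(\<lambda>x. A (V x) / B one (V x)) integrable_on {x..y}"
      by (rule integrable_subinterval_real[OF integrable_continuous_real[OF continuous_on_ratio[OF assms(3)]]])
         (use assms in auto)
    show "A (V z) / B one (V z) \<le> 0" if "z \<in> {x..y}" for z
      using A_nonpos[OF V_cube[of z]] B_V_pos[of z] that assms by (intro divide_nonpos_pos) auto
  qed
  moreover have "integral {0..x} (\<lambda>x. A (V x) / B one (V x)) + integral {x..y} (\<lambda>x. A (V x) / B one (V x))
      = integral {0..y} (\<lambda>x. A (V x) / B one (V x))"
    by (rule Henstock_Kurzweil_Integration.integral_combine[OF assms(1,2)])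
       (intro integrable_continuous_real continuous_on_ratio assms)
  ultimately show ?thesis by (simp add: \<Phi>_def)
qed

text \<open>Since \<open>B one (V x) \<le> c one * (1 - x)\<close>, the curve needs infinite time to reach \<open>1\<close>; so if J is
  finite then \<open>\<Phi>\<close> must vanish in the limit.\<close>

lemma \<Phi>_ln_le:
  assumes y: "0 \<le> y" "y < 1"
  shows "\<Phi> y * (- ln (1 - y)) \<le> c one * I y 0"
proof -
  have int: "((\<lambda>x. 1 / (1 - x)) has_integral (- ln (1 - y) - (- ln (1 - 0)))) {0..y}"
    by (rule fundamental_theorem_of_calculus[OF y(1)])
       (use y in \<open>auto intro!: derivative_eq_intros simp: has_real_derivative_iff_has_vector_derivative[symmetric] divide_simps\<close>)
  have "\<Phi> y / c one * (- ln (1 - y) - (- ln (1 - 0))) \<le> I y 0"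
    unfolding I_def
  proof (rule has_integral_le[OF has_integral_mult_right[OF int] integrable_integral[OF integrable_integrand[OF y(2)]]])
    fix x assume "x \<in> {0..y}"
    then have x: "0 \<le> x" "x \<le> y" "x < 1" "x \<le> 1" using y by auto
    have "B one (V x) \<le> c one * (1 - x)"
      using R_le[OF V_cube[OF x(1,4)], of one] V_one[OF x(1,4)] by (simp add: B_eq[OF V_cube[OF x(1,4)]] algebra_simps)
    then have "\<Phi> y / (c one * (1 - x)) \<le> \<Phi> x / B one (V x)"
      using \<Phi>_mono[OF x(1,2) y(2)] B_V_pos[OF x(1,3)] \<Phi>_pos[of x] by (intro frac_le) auto
    then show "\<Phi> y / c one * (1 / (1 - x)) \<le> vpow (V x) 0 * \<psi> x" by (simp add: \<psi>_def)
  qed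
  then show ?thesis using c_pos[of one] by (simp add: field_simps)
qed

text \<open>Off \<open>0\<close> the limit \<open>f\<close> of the \<open>I (t n)\<close> is a
  supersolution, because the boundary term dies with \<open>\<Phi>\<close>. The row of
  \<open>0\<close> is the resurrection law, for which no formula along the curve is available; there
  it suffices that \<open>f\<close> is largest at \<open>0\<close> and strictly smaller at some
  \<open>m\<close> with \<open>h m > 0\<close>.\<close>

lemma transient_if_J_finite:
  assumes J: "(\<integral>\<^sup>+x\<in>{0<..<1}. ennreal (\<psi> x) \<partial>lborel) \<noteq> \<infinity>"
  shows "green Q 0 0 \<noteq> \<infinity>"
proof -
  define K where "K = enn2real (\<integral>\<^sup>+x\<in>{0<..<1}. ennreal (\<psi> x) \<partial>lborel)"
  have K: "ennreal K = (\<integral>\<^sup>+x\<in>{0<..<1}. ennreal (\<psi> x) \<partial>lborel)"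
    unfolding K_def by (rule ennreal_enn2real) (use J in \<open>simp add: less_top\<close>)
  have "ennreal (I (t n) 0) \<le> ennreal K" for n
    unfolding K nn_integral_\<psi> by (rule SUP_upper) simp
  moreover have "0 \<le> K" by (simp add: K_def)
  ultimately have I0_le: "I (t n) 0 \<le> K" for n by (simp add: ennreal_le_iff)
  have le_K: "I (t n) m \<le> K" for n m
    using I_le_I_zero[OF t(2)] I0_le order_trans by blast
  have t_le: "t m \<le> t n" "0 \<le> t m" "t n < 1" if "m \<le> n" for m n
    using t_mono[OF that] t[of n] t[of m] by auto
  define f where "f m = (SUP n. I (t n) m)" for m
  have inc: "incseq (\<lambda>n. I (t n) m)" for m
    unfolding incseq_def using I_diff_mono(1) t_le by blast
  have lim: "(\<lambda>n. I (t n) m) \<longlonglongrightarrow> f m" for m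
    unfolding f_def by (intro LIMSEQ_incseq_SUP inc bdd_aboveI2[where M=K] le_K)
  have f_nn: "f m \<ge> 0" for m
    by (rule LIMSEQ_le_const[OF lim]) (use I_nonneg[OF t(2)] in auto)
  have f_diff: "I (t n) 0 - I (t n) m \<le> f 0 - f m" for n m
    by (rule LIMSEQ_le_const[OF tendsto_diff[OF lim lim]])
       (use I_diff_mono(2) t_le in blast)
  have f_le: "f m \<le> f 0" for m
    using f_diff[of 0 m] I_le_I_zero[OF t(2), of 0 m] by simp
  \<comment> \<open>At \<open>y = t n\<close> the logarithm in \<open>\<Phi>_ln_le\<close> is
    \<open>ln (n + 2)\<close>, since \<open>1 - t n = 1 / (n + 2)\<close>.\<close>
  have \<Phi>_lim: "(\<lambda>n. \<Phi> (t n)) \<longlonglongrightarrow> 0"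
  proof (rule tendsto_sandwich[of "\<lambda>_. 0" _ _ "\<lambda>n. c one * K / ln (real (n + 2))"])
    have "filterlim (\<lambda>n. ln (real (n + 2))) at_top sequentially"
      by (rule filterlim_compose[OF ln_at_top])
         (rule filterlim_compose[OF filterlim_real_sequentially filterlim_add_const_nat_at_top])
    then show "(\<lambda>n. c one * K / ln (real (n + 2))) \<longlonglongrightarrow> 0"
      by (rule real_tendsto_divide_at_top[OF tendsto_const])
    have "\<Phi> (t n) \<le> c one * K / ln (real (n + 2))" for n
    proof -
      have "1 - t n = inverse (real (n + 2))" by (simp add: t_def divide_inverse add.commute)
      then have "- ln (1 - t n) = ln (real (n + 2))" by (simp add: ln_inverse)
      moreover have "\<Phi> (t n) * (- ln (1 - t n)) \<le> c one * K"
        by (rule order_trans[OF \<Phi>_ln_le mult_left_mono[OF I0_le]])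
           (use t[of n] c_pos[of one] in auto)
      moreover have "ln (real (n + 2)) > 0" by (rule ln_gt_zero) simp
      ultimately show ?thesis by (simp add: le_divide_eq)
    qed
    then show "\<forall>\<^sub>F n in sequentially. \<Phi> (t n) \<le> c one * K / ln (real (n + 2))" by simp
  qed (auto simp: less_imp_le[OF \<Phi>_pos])
  \<comment> \<open>As in Fatou's lemma, only finite partial sums are passed to the limit;
    nonnegativity of the terms then gives the whole sum.\<close>
  have fin: "(\<Sum>k\<in>T. Q i k * f k) \<le> - Q i i * f i"
    if i: "i \<noteq> 0" and T: "finite T" "T \<subseteq> UNIV - {i}" for i T
  proof (rule LIMSEQ_le)
    show "(\<lambda>n. \<Sum>k\<in>T. Q i k * I (t n) k) \<longlonglongrightarrow> (\<Sum>k\<in>T. Q i k * f k)"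
      by (intro tendsto_intros lim)
    have "(\<lambda>n. \<Phi> (t n) + - Q i i * I (t n) i) \<longlonglongrightarrow> 0 + - Q i i * f i"
      by (intro tendsto_intros lim \<Phi>_lim)
    then show "(\<lambda>n. \<Phi> (t n) + - Q i i * I (t n) i) \<longlonglongrightarrow> - Q i i * f i" by simp
    have "(\<Sum>k\<in>T. Q i k * I (t n) k) \<le> \<Phi> (t n) + - Q i i * I (t n) i" for n
    proof -
      have y: "0 \<le> t n" "t n < 1" using t[of n] by auto
      have "(\<Sum>k\<in>T. Q i k * I (t n) k) \<le> vpow (V (t n)) i * \<Phi> (t n) + (- Q i i) * I (t n) i"
        by (rule finite_sum_le_has_sum[OF Q_I_has_sum[OF i y] T]) (use Q_nonneg I_nonneg[OF y(2)] in auto)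
      moreover have "vpow (V (t n)) i * \<Phi> (t n) \<le> 1 * \<Phi> (t n)"
        using vpow_V(2)[OF y] \<Phi>_pos[of "t n"] by (intro mult_right_mono) auto
      ultimately show ?thesis by simp
    qed
    then show "\<exists>N. \<forall>n\<ge>N. (\<Sum>k\<in>T. Q i k * I (t n) k) \<le> \<Phi> (t n) + - Q i i * I (t n) i" by blast
  qed
  have sum0: "((\<lambda>k. Q 0 k * f 0) has_sum (- Q 0 0 * f 0)) (UNIV - {0})"
    by (intro has_sum_cmult_left Q_conservative)
  have nn: "0 \<le> Q i k * f k" if "k \<in> UNIV - {i}" for i k using that Q_nonneg f_nn by simp
  have summ: "(\<lambda>k. Q i k * f k) summable_on (UNIV - {i})" for i
  proof (cases "i = 0")
    case True
    show ?thesis unfolding True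
      by (rule summable_on_comparison_test[of "\<lambda>k. Q 0 k * f 0"])
         (use sum0 Q_nonneg f_nn f_le in \<open>auto simp: summable_on_def intro: mult_left_mono\<close>)
  next
    case False
    show ?thesis
      by (rule nonneg_bdd_above_summable_on[OF nn]) (use fin[OF False] in \<open>auto intro!: bdd_aboveI2\<close>)
  qed
  obtain m where m: "m \<noteq> 0" "h m > 0" using ex_h_pos by blast
  have "I (t 0) m < I (t 0) 0"
    unfolding I_def
  proof (rule integral_less_real)
    show "continuous_on {0..t 0} (\<lambda>x. vpow (V x) m * \<psi> x)" "continuous_on {0..t 0} (\<lambda>x. vpow (V x) 0 * \<psi> x)"
      by (rule continuous_on_integrand[OF t(2)])+
    show "{0<..<t 0} \<noteq> {}" using t(1)[of 0] by simp
    fix x assume "x \<in> {0<..<t 0}"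
    then have x: "0 \<le> x" "x < 1" "x \<le> 1" using t(2)[of 0] by auto
    have "vpow (V x) m < 1" by (intro vpow_less_one V_cube V_less_one x m)
    then show "vpow (V x) m * \<psi> x < vpow (V x) 0 * \<psi> x"
      using \<psi>_pos[OF x(1,2)] by simp
  qed
  then have "f m < f 0" using f_diff[of 0 m] by simp
  then have strict: "Q 0 m * f m < Q 0 m * f 0" using m by (simp add: Q)
  show ?thesis
  proof (rule transient_if_supersolution[where f=f and s="\<lambda>i. infsum (\<lambda>k. Q i k * f k) (UNIV - {i})", OF Q_neg Q_nonneg f_nn])
    show "((\<lambda>k. Q i k * f k) has_sum infsum (\<lambda>k. Q i k * f k) (UNIV - {i})) (UNIV - {i})" for i
      by (rule has_sum_infsum[OF summ])
    show "infsum (\<lambda>k. Q i k * f k) (UNIV - {i}) \<le> - Q i i * f i" if "i \<noteq> 0" for i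
      by (rule infsum_le_finite_sums[OF summ fin[OF that]])
    show "infsum (\<lambda>k. Q 0 k * f k) (UNIV - {0}) < - Q 0 0 * f 0"
      by (rule has_sum_strict_mono[OF has_sum_infsum[OF summ] sum0, of m])
         (use m strict Q_nonneg f_le in \<open>auto intro: mult_left_mono\<close>)
  qed
qed

end

text \<open>Strictness at \<open>0\<close> comes from \<open>q $ k < 1\<close> for all
  \<open>k\<close>: it puts \<open>vpow q m\<close> below \<open>vpow q 0 = 1\<close> at a state
  \<open>m\<close> that resurrection can reach.\<close>

lemma (in nTBI_mean) transient_if_rho_pos:
  assumes "rho b 1 > 0"
  shows "green Q 0 0 \<noteq> \<infinity>"
proof -
  obtain q where q: "q \<in> {0..1}" "\<And>k. q $ k < 1" "\<And>k. B k q \<le> 0"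
    using rho_pos_subsolution[OF assms] by blast
  have sum0: "((\<lambda>k. Q 0 k * 1) has_sum (- Q 0 0 * 1)) (UNIV - {0})"
    by (intro has_sum_cmult_left Q_conservative)
  have summ: "(\<lambda>k. Q i k * vpow q k) summable_on (UNIV - {i})" for i
  proof (rule summable_on_comparison_test[of "Q i"])
    show "Q i summable_on (UNIV - {i})" using Q_conservative[of i] by (auto simp: summable_on_def)
  qed (use Q_nonneg vpow_nonneg[OF q(1)] vpow_le_one[OF q(1)] in \<open>auto intro: mult_left_le\<close>)
  obtain m where m: "m \<noteq> 0" "h m > 0" using ex_h_pos by blast
  have strict: "Q 0 m * vpow q m < Q 0 m * 1"
    using m vpow_less_one[OF q(1,2) m(1)] by (intro mult_strict_left_mono) (simp_all add: Q)
  show ?thesis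
  proof (rule transient_if_supersolution[where f="vpow q" and s="\<lambda>i. infsum (\<lambda>k. Q i k * vpow q k) (UNIV - {i})", OF Q_neg Q_nonneg vpow_nonneg[OF q(1)]])
    show "((\<lambda>k. Q i k * vpow q k) has_sum infsum (\<lambda>k. Q i k * vpow q k) (UNIV - {i})) (UNIV - {i})" for i
      by (rule has_sum_infsum[OF summ])
    show "infsum (\<lambda>k. Q i k * vpow q k) (UNIV - {i}) \<le> - Q i i * vpow q i" if i: "i \<noteq> 0" for i
    proof -
      have "(\<Sum>k\<in>UNIV. real (i $ k) * vpow q (i - axis k 1) * B k q) \<le> 0"
        by (intro sum_nonpos mult_nonneg_nonpos mult_nonneg_nonneg vpow_nonneg q) simp_all
      moreover have "vpow q i * A q \<le> 0"
        by (intro mult_nonneg_nonpos vpow_nonneg A_nonpos q)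
      ultimately show ?thesis
        using infsumI[OF Q_vpow_off_diagonal[OF i q(1)]] by simp
    qed
    show "infsum (\<lambda>k. Q 0 k * vpow q k) (UNIV - {0}) < - Q 0 0 * vpow q 0"
      unfolding vpow_zero_right
      by (rule has_sum_strict_mono[OF has_sum_infsum[OF summ] sum0, of m])
         (use m strict Q_nonneg vpow_le_one[OF q(1)] in \<open>auto intro: mult_left_le\<close>)
  qed
qed

theorem theorem4p1:
  fixes Q :: "nat^'n \<Rightarrow> nat^'n \<Rightarrow> real"
    and h a :: "nat^'n \<Rightarrow> real"
    and b :: "'n \<Rightarrow> nat^'n \<Rightarrow> real"
    and one :: 'n
  assumes "is_nTBI_qmatrix Q h a b"
    and "h 0 < 0"
    and "regular_qmatrix Q"
    and "nonsingular_family b"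
    and "finite_mean_matrix b"
    and "positively_regular (Gmat b 1)"
    and "genfun (b one) 0 > 0"
  shows "recurrent_transition (feller_minimal Q) \<longleftrightarrow>
           rho b 1 \<le> 0 \<and> J_integral a b one = \<infinity>"
proof -
  interpret nTBI_mean Q h a b
    by unfold_locales (rule assms)+
  have rec: "recurrent_transition (feller_minimal Q) \<longleftrightarrow> (\<forall>i. green Q i i = \<infinity>)"
    by (simp add: recurrent_transition_def green_def)
  show ?thesis
  proof (cases "rho b 1 \<le> 0")
    case False
    \<comment> \<open>Recurrence demands an infinite Green function at every state, so state
      \<open>0\<close> alone refutes it.\<close>
    then show ?thesis using transient_if_rho_pos unfolding rec by auto
  next
    case True
    obtain V where V: "branching_curve b one V" "\<And>x k. 0 \<le> x \<Longrightarrow> x < 1 \<Longrightarrow> V x $ k < 1"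
        "\<And>x. 0 \<le> x \<Longrightarrow> x < 1 \<Longrightarrow> B one (V x) > 0"
      using ex_branching_curve[OF True assms(7)] by blast
    \<comment> \<open>\<open>the_curve\<close> is a choice among all branching curves. Uniqueness
      gives it the properties known of the constructed \<open>V\<close>: coordinates below
      \<open>1\<close> and positive \<open>B one\<close> before the endpoint.\<close>
    define U where "U = the_curve b one"
    have U: "branching_curve b one U"
      unfolding U_def the_curve_def by (rule someI[of "branching_curve b one", OF V(1)])
    have UV: "U x = V x" if "0 \<le> x" "x \<le> 1" for x
      by (rule branching_curve_unique[OF U V(1,3) that])
    interpret nTBI_curve Q h a b one U
      by unfold_locales (use U V UV in auto)
    have "J_integral a b one = (\<integral>\<^sup>+x\<in>{0<..<1}. ennreal (\<psi> x) \<partial>lborel)"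
      by (simp add: J_integral_def Let_def U_def[symmetric] \<psi>_def \<Phi>_def)
    then show ?thesis
      using recurrent_if_J_infinite[OF True assms(7)] transient_if_J_finite True unfolding rec by auto
  qed
qed

end
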